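(* Let $(\eta_t)_{t\ge0}$ be median dynamics on $\mathbb Z^2$ (with nearest-neighbor edges). Then $(\eta_t)_{t\ge 0}$ fixates: for every $x\in\mathbb Z^2$, almost surely there is a (random) time after which $\eta_t(x)$ is constant in $t$. In particular, writing $\eta_\infty(0)=\lim_{t\to\infty}\eta_t(0)$, the distribution of $\eta_\infty(0)$ is absolutely continuous with respect to Lebesgue measure.
   Context: For a vertex $x$ of a graph, $N(x)$ is the set of neighbors of $x$, with the convention that $x$ itself is added to $N(x)$ if its degree is even, so that $|N(x)|$ is always odd (in particular, on $\mathbb Z^2$, $N(x)$ consists of $x$ and its four nearest neighbors). Median dynamics $(\eta_t)_{t\ge0}$ on a graph with vertex set $V$ has state space $[0,1]^{V}$. The initial values $(\eta_0(x))_{x\in V}$ are i.i.d. uniform on $[0,1]$. Independently, each vertex has an independent rate-one Poisson clock. At each ring $s$ of the clock of $x$, the value at $x$ is replaced by the median of $\{\eta_{s-}(z): z\in N(x)\}$ (counted with multiplicity), and no other value changes. On $\mathbb Z^2$ this is well defined: almost surely each $\eta_t(x)$ is determined by finitely many initial values and clock rings. *)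

theory Defs
  imports "HOL-Probability.Probability"
begin

type_synonym site = "int \<times> int"

definition z2_adj :: "site \<Rightarrow> site \<Rightarrow> bool" where
  "z2_adj x y \<longleftrightarrow> \<bar>fst x - fst y\<bar> + \<bar>snd x - snd y\<bar> = 1"

text \<open>A graph is given by its adjacency relation; it is meant to be simple and locally finite.\<close>

definition nbhd :: "('v \<Rightarrow> 'v \<Rightarrow> bool) \<Rightarrow> 'v \<Rightarrow> 'v set" where
  "nbhd adj x =
     (if even (card {y. adj x y}) then insert x {y. adj x y} else {y. adj x y})"

lemma nbhd_z2:
  "nbhd z2_adj (a, b) = {(a, b), (a + 1, b), (a - 1, b), (a, b + 1), (a, b - 1)}"
proof -
  have "{y. z2_adj (a, b) y} = {(a + 1, b), (a - 1, b), (a, b + 1), (a, b - 1)}"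
    by (auto simp: z2_adj_def)
  then show ?thesis
    by (simp add: nbhd_def)
qed

text \<open>The middle entry in increasing order; only used for multisets of odd size.\<close>

definition median :: "'b::linorder multiset \<Rightarrow> 'b" where
  "median A = sorted_list_of_multiset A ! (size A div 2)"

definition rings :: "('a \<Rightarrow> real set) \<Rightarrow> real \<Rightarrow> real \<Rightarrow> 'a \<Rightarrow> nat" where
  "rings R s t \<omega> = card (R \<omega> \<inter> {s<..t})"

text \<open>A rate-one Poisson process on \<open>(0, \<infinity>)\<close>, given as the random locally finite set
  \<open>R \<omega>\<close> of its points.\<close>

definition poisson_clock :: "'a measure \<Rightarrow> ('a \<Rightarrow> real set) \<Rightarrow> bool" where
  "poisson_clock M R \<longleftrightarrow>
     (\<forall>\<omega>\<in>space M. R \<omega> \<subseteq> {0<..} \<and> (\<forall>t. finite (R \<omega> \<inter> {..t}))) \<and>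
     (\<forall>s t. 0 \<le> s \<and> s < t \<longrightarrow>
        rings R s t \<in> M \<rightarrow>\<^sub>M count_space UNIV \<and>
        distr M (count_space UNIV) (rings R s t) = measure_pmf (poisson_pmf (t - s))) \<and>
     (\<forall>\<tau> :: nat \<Rightarrow> real. 0 \<le> \<tau> 0 \<and> strict_mono \<tau> \<longrightarrow>
        prob_space.indep_vars M (\<lambda>_. count_space UNIV)
          (\<lambda>i. rings R (\<tau> i) (\<tau> (Suc i))) UNIV)"

definition value_events :: "'a measure \<Rightarrow> ('a \<Rightarrow> real) \<Rightarrow> 'a set set" where
  "value_events M X = {X -` B \<inter> space M |B. B \<in> sets borel}"

definition clock_events :: "'a measure \<Rightarrow> ('a \<Rightarrow> real set) \<Rightarrow> 'a set set" where
  "clock_events M R =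
     sigma_sets (space M)
       {rings R s t -` {k} \<inter> space M |s t k. 0 \<le> s \<and> s < t}"

text \<open>The path rule for a realization: \<open>f t x\<close> is the value at \<open>x\<close> at time \<open>t\<close> and \<open>C x\<close> is
  the set of rings at \<open>x\<close>.  For locally finite \<open>C\<close> the second clause makes every \<open>\<lambda>t. f t z\<close>
  constant on an interval to the left of each \<open>s > 0\<close>, so the limit in the first clause
  exists and is the value at time \<open>s-\<close>.\<close>

definition median_path ::
    "('v \<Rightarrow> 'v \<Rightarrow> bool) \<Rightarrow> ('v \<Rightarrow> real set) \<Rightarrow> (real \<Rightarrow> 'v \<Rightarrow> real) \<Rightarrow> bool" where
  "median_path adj C f \<longleftrightarrow>
     (\<forall>x. \<forall>s\<in>C x.
        f s x = median {# Lim (at_left s) (\<lambda>t. f t z). z \<in># mset_set (nbhd adj x) #}) \<and>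
     (\<forall>x s t. 0 \<le> s \<and> s \<le> t \<and> C x \<inter> {s<..t} = {} \<longrightarrow> f t x = f s x)"

text \<open>\<open>\<eta> t x\<close> is the random value at \<open>x\<close> at time \<open>t \<ge> 0\<close>; values of \<open>\<eta>\<close> at negative times
  are irrelevant.\<close>

definition median_dynamics ::
    "('v \<Rightarrow> 'v \<Rightarrow> bool) \<Rightarrow> 'a measure \<Rightarrow> ('v \<Rightarrow> 'a \<Rightarrow> real set) \<Rightarrow>
     (real \<Rightarrow> 'v \<Rightarrow> 'a \<Rightarrow> real) \<Rightarrow> bool" where
  "median_dynamics adj M R \<eta> \<longleftrightarrow>
     prob_space M \<and>
     (\<forall>t\<ge>0. \<forall>x. \<eta> t x \<in> M \<rightarrow>\<^sub>M restrict_space borel {0..1}) \<and>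
     (\<forall>x. distr M lborel (\<eta> 0 x) = uniform_measure lborel {0..1}) \<and>
     (\<forall>x. poisson_clock M (R x)) \<and>
     prob_space.indep_sets M
       (case_sum (\<lambda>x. value_events M (\<eta> 0 x)) (\<lambda>x. clock_events M (R x))) UNIV \<and>
     (AE \<omega> in M. median_path adj (\<lambda>x. R x \<omega>) (\<lambda>t x. \<eta> t x \<omega>))"

definition fixates :: "'a measure \<Rightarrow> (real \<Rightarrow> 'v \<Rightarrow> 'a \<Rightarrow> real) \<Rightarrow> bool" where
  "fixates M \<eta> \<longleftrightarrow>
     (\<forall>x. AE \<omega> in M. \<exists>T\<ge>0. \<forall>t\<ge>T. \<eta> t x \<omega> = \<eta> T x \<omega>)"

end

theory Submission
  imports Defs
begin

text \<open>
  For a level \<open>p\<close>, the indicators of \<open>\<eta> \<le> p\<close> perform majority dynamics in which ties keep the spin,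
  so every flip lowers the number of disagreeing edges by at least two; by translation invariance
  each site flips finitely often. This alone does not give fixation, because values might travel
  in from infinity for ever. At level \<open>1/2\<close> the limiting signs form a positively associated, mixing
  random field that is invariant under the lattice symmetries and under exchanging the signs. In the plane
  such a field has no infinite cluster: if both signs percolated, a Russo-Seymour-Welsh argument
  in the style of Tassion would produce circuits of one sign, with a probability bounded below at
  infinitely many scales, that confine the clusters of the other sign. Hence every site lies in a finite
  cluster of constant limiting sign. Once the signs in and around such a cluster have settled,
  an update can only copy a value from the cluster itself, so only finitely many values remain,
  and fixation at the rational levels separates them.

  The dynamics is approximated by parallel updates along the meshes \<open>2 ^ - m\<close>; almost surely the
  approximations at a given time and site are eventually exact, since there is no infinite
  chain of neighbouring rings backwards in time.
\<close>

section \<open>Nearest-neighbour connectivity in the plane\<close>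

text \<open>If one sign fails to cross a box along nearest neighbours, the other sign crosses it
  only with diagonal steps allowed, so the self-dual value 1/2 for crossing a square is not at hand.
  The input is instead a lower bound on one-arm probabilities, which is the assumption to be
  refuted; arms are glued by lattice symmetries and the meeting of planar paths. Two estimates then
  collide: mixing forces the minus sign to percolate with probability 0 or 1, while plus circuits of
  probability at least \<kappa> at arbitrarily large scales keep that probability below
  \<open>1 - \<kappa>\<close>.

  Level 1/2 is the one where exchanging signs preserves the law of the initial comparisons. Positive
  association cannot be read off from monotonicity in all bits at once, since the effect of a ring
  depends on the configuration it meets; it is propagated step by step in time. Neighbours that
  update in the same step of a mesh spoil the energy inequality, but the loss per step is of the
  order of the squared mesh width and stays bounded in total when the time horizon is at most
  \<open>2 ^ m\<close>.\<close>

definition conn :: "site set \<Rightarrow> site \<Rightarrow> site \<Rightarrow> bool" where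
  "conn G x y \<longleftrightarrow> x \<in> G \<and> (x, y) \<in> {(u, v). v \<in> G \<and> z2_adj u v}\<^sup>*"

lemma z2_adj_sym: "z2_adj x y \<longleftrightarrow> z2_adj y x"
  by (auto simp: z2_adj_def abs_minus_commute)

lemma z2_adj_cases:
  assumes "z2_adj x y"
  obtains "y = (fst x + 1, snd x)" | "y = (fst x - 1, snd x)"
    | "y = (fst x, snd x + 1)" | "y = (fst x, snd x - 1)"
proof -
  have "(fst y = fst x + 1 \<and> snd y = snd x) \<or> (fst y = fst x - 1 \<and> snd y = snd x)
    \<or> (fst y = fst x \<and> snd y = snd x + 1) \<or> (fst y = fst x \<and> snd y = snd x - 1)"
    using assms unfolding z2_adj_def by linarith
  then show ?thesis using that by (metis prod.collapse)
qed

lemma conn_refl: "x \<in> G \<Longrightarrow> conn G x x"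
  by (simp add: conn_def)

lemma conn_in1: "conn G x y \<Longrightarrow> x \<in> G"
  by (simp add: conn_def)

lemma conn_in2: "conn G x y \<Longrightarrow> y \<in> G"
  unfolding conn_def by (auto elim: rtranclE)

lemma conn_step: "conn G x y \<Longrightarrow> z2_adj y z \<Longrightarrow> z \<in> G \<Longrightarrow> conn G x z"
  unfolding conn_def by (auto intro: rtrancl_into_rtrancl)

lemma conn_trans: "conn G x y \<Longrightarrow> conn G y z \<Longrightarrow> conn G x z"
  unfolding conn_def by (auto intro: rtrancl_trans)

lemma conn_induct [consumes 1, case_names refl step]:
  assumes "conn G x y" "x \<in> G \<Longrightarrow> P x"
    and "\<And>y z. conn G x y \<Longrightarrow> z2_adj y z \<Longrightarrow> z \<in> G \<Longrightarrow> P y \<Longrightarrow> P z"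
  shows "P y"
proof -
  have xG: "x \<in> G" and r: "(x, y) \<in> {(u, v). v \<in> G \<and> z2_adj u v}\<^sup>*"
    using assms(1) by (auto simp: conn_def)
  from r show ?thesis
  proof (induction rule: rtrancl_induct)
    case base show ?case using assms(2) xG by simp
  next
    case (step y z)
    then show ?case using assms(3)[of y z] xG by (auto simp: conn_def)
  qed
qed

lemma conn_mono: "conn G x y \<Longrightarrow> G \<subseteq> G' \<Longrightarrow> conn G' x y"
  by (induction rule: conn_induct) (auto intro: conn_refl conn_step)

lemma conn_sym: "conn G x y \<Longrightarrow> conn G y x"
proof (induction rule: conn_induct)
  case refl then show ?case by (rule conn_refl)
next
  case (step y z)
  have "conn G z y"
    using conn_step[OF conn_refl[OF step(3)]] step(2) conn_in2[OF step(1)] z2_adj_sym by blast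
  then show ?case using conn_trans step(4) by blast
qed

lemma conn_image:
  assumes "conn G x y" "\<And>u v. z2_adj u v \<Longrightarrow> z2_adj (f u) (f v)" "f ` G \<subseteq> G'"
  shows "conn G' (f x) (f y)"
  using assms(1)
proof (induction rule: conn_induct)
  case refl then show ?case using assms(3) by (auto intro: conn_refl)
next
  case (step y z)
  have "z2_adj (f y) (f z)" "f z \<in> G'" using step assms(2,3) by blast+
  then show ?case using step(4) conn_step by blast
qed

lemma conn_vline:
  assumes "\<And>j. a \<le> j \<Longrightarrow> j \<le> b \<Longrightarrow> (i, j) \<in> G" "a \<le> b"
  shows "conn G (i, a) (i, b)"
  using assms(2,1)
proof (induction rule: int_ge_induct)
  case base then show ?case by (auto intro: conn_refl)
next
  case (step b)
  then have "conn G (i, a) (i, b)" by auto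
  then show ?case by (rule conn_step) (use step in \<open>auto simp: z2_adj_def\<close>)
qed

lemma conn_hline:
  assumes "\<And>i. a \<le> i \<Longrightarrow> i \<le> b \<Longrightarrow> (i, j) \<in> G" "a \<le> b"
  shows "conn G (a, j) (b, j)"
  using assms(2,1)
proof (induction rule: int_ge_induct)
  case base then show ?case by (auto intro: conn_refl)
next
  case (step b)
  then have "conn G (a, j) (b, j)" by auto
  then show ?case by (rule conn_step) (use step in \<open>auto simp: z2_adj_def\<close>)
qed

section \<open>Lattice paths as continuous paths, and crossings of a box\<close>

definition site_vec :: "site \<Rightarrow> real^2" where
  "site_vec x = vector [real_of_int (fst x), real_of_int (snd x)]"

lemma site_vec_nth [simp]: "site_vec x $ 1 = of_int (fst x)" "site_vec x $ 2 = of_int (snd x)"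
  by (simp_all add: site_vec_def)

lemma vec2_eq: "(x :: real^2) = y \<longleftrightarrow> x $ 1 = y $ 1 \<and> x $ 2 = y $ 2"
  by (simp add: vec_eq_iff forall_2)

text \<open>The image is covered by edges with both ends reachable from \<open>x\<close> inside
  \<open>G\<close>, so that a common point of two such paths can be traced back to reachable sites.
  The inserted point accounts for the path without edges.\<close>

lemma conn_continuous_path:
  assumes "conn G x y"
  shows "\<exists>g. path g \<and> pathstart g = site_vec x \<and> pathfinish g = site_vec y \<and>
    path_image g \<subseteq> insert (site_vec x)
      (\<Union>{closed_segment (site_vec u) (site_vec v) |u v. conn G x u \<and> conn G x v \<and> z2_adj u v})"
  using assms
proof (induction rule: conn_induct)
  case refl
  show ?case
    by (rule exI[of _ "\<lambda>_. site_vec x"])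
      (auto simp: path_def pathstart_def pathfinish_def path_image_def)
next
  case (step y z)
  then obtain g where g: "path g" "pathstart g = site_vec x" "pathfinish g = site_vec y"
    "path_image g \<subseteq> insert (site_vec x)
      (\<Union>{closed_segment (site_vec u) (site_vec v) |u v. conn G x u \<and> conn G x v \<and> z2_adj u v})"
    by blast
  have "conn G x z" using step by (auto intro: conn_step)
  then have "closed_segment (site_vec y) (site_vec z) \<subseteq>
     \<Union>{closed_segment (site_vec u) (site_vec v) |u v. conn G x u \<and> conn G x v \<and> z2_adj u v}"
    using step by blast
  then show ?case
    using g by (intro exI[of _ "g +++ linepath (site_vec y) (site_vec z)"])
      (auto simp: path_image_join)
qed

lemma segment_site_vec:
  assumes "z \<in> closed_segment (site_vec u) (site_vec v)" "z2_adj u v"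
  obtains (H) k where "z $ 2 = of_int (snd u)" "snd v = snd u"
      "{fst u, fst v} = {k, k + 1}" "of_int k \<le> z $ 1" "z $ 1 \<le> of_int k + 1"
    | (V) k where "z $ 1 = of_int (fst u)" "fst v = fst u"
      "{snd u, snd v} = {k, k + 1}" "of_int k \<le> z $ 2" "z $ 2 \<le> of_int k + 1"
proof -
  obtain t where t: "0 \<le> t" "t \<le> 1" "z = (1 - t) *\<^sub>R site_vec u + t *\<^sub>R site_vec v"
    using assms(1) by (auto simp: in_segment)
  have z: "z $ 1 = (1 - t) * of_int (fst u) + t * of_int (fst v)"
    "z $ 2 = (1 - t) * of_int (snd u) + t * of_int (snd v)"
    using t(3) by auto
  note t = t(1,2)
  show ?thesis
    using assms(2)
  proof (cases rule: z2_adj_cases)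
    case 1
    show ?thesis by (rule H[of "fst u"]) (use z t 1 in \<open>auto simp: algebra_simps\<close>)
  next
    case 2
    show ?thesis by (rule H[of "fst u - 1"]) (use z t 2 in \<open>auto simp: algebra_simps\<close>)
  next
    case 3
    show ?thesis by (rule V[of "snd u"]) (use z t 3 in \<open>auto simp: algebra_simps\<close>)
  next
    case 4
    show ?thesis by (rule V[of "snd u - 1"]) (use z t 4 in \<open>auto simp: algebra_simps\<close>)
  qed
qed

lemma int_unit_overlap:
  assumes "of_int k \<le> (r::real)" "r \<le> of_int k + 1" "of_int l \<le> r" "r \<le> of_int l + 1"
  shows "{k, k + 1} \<inter> {l, l + 1} \<noteq> {}"
proof -
  have "real_of_int k \<le> of_int (l + 1)" "real_of_int l \<le> of_int (k + 1)" using assms by simp_all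
  then have "k \<le> l + 1" "l \<le> k + 1" by (simp_all only: of_int_le_iff)
  then show ?thesis by auto
qed

lemma int_unit_mem:
  assumes "of_int k \<le> real_of_int i" "real_of_int i \<le> of_int k + 1"
  shows "i \<in> {k, k + 1}"
proof -
  have "real_of_int i \<le> of_int (k + 1)" using assms by simp
  then have "i \<le> k + 1" by (simp only: of_int_le_iff)
  then show ?thesis using assms by auto
qed

text \<open>The lattice is a plane graph: perpendicular edges can only meet at a point with integer
  coordinates, and collinear edges whose unit intervals overlap share an end.\<close>

lemma segments_share_endpoint:
  assumes "z \<in> closed_segment (site_vec u) (site_vec v)" "z2_adj u v"
    and "z \<in> closed_segment (site_vec u') (site_vec v')" "z2_adj u' v'"
  shows "{u, v} \<inter> {u', v'} \<noteq> {}"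
proof -
  obtain a b where u: "u = (a, b)" by force
  obtain c d where v: "v = (c, d)" by force
  obtain a' b' where u': "u' = (a', b')" by force
  obtain c' d' where v': "v' = (c', d')" by force
  from assms(1,2) show ?thesis
  proof (cases rule: segment_site_vec)
    case 1: (H k)
    from assms(3,4) show ?thesis
    proof (cases rule: segment_site_vec)
      case 2: (H l)
      have "b = b'" using 1 2 by (simp add: u u')
      then show ?thesis using int_unit_overlap[OF 1(4,5) 2(4,5)] 1 2
        by (auto simp: u v u' v' doubleton_eq_iff)
    next
      case 2: (V l)
      have "b \<in> {l, l + 1}" "a' \<in> {k, k + 1}"
        using 1 2 by (auto intro!: int_unit_mem simp: u u')
      then show ?thesis using 1 2 by (auto simp: u v u' v' doubleton_eq_iff)
    qed
  next
    case 1: (V k)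
    from assms(3,4) show ?thesis
    proof (cases rule: segment_site_vec)
      case 2: (V l)
      have "a = a'" using 1 2 by (simp add: u u')
      then show ?thesis using int_unit_overlap[OF 1(4,5) 2(4,5)] 1 2
        by (auto simp: u v u' v' doubleton_eq_iff)
    next
      case 2: (H l)
      have "b' \<in> {k, k + 1}" "a \<in> {l, l + 1}"
        using 1 2 by (auto intro!: int_unit_mem simp: u u')
      then show ?thesis using 1 2 by (auto simp: u v u' v' doubleton_eq_iff)
    qed
  qed
qed

text \<open>The site lies on the horizontal edges to its right and to its left. An edge that shares
  an end with both of them without having the site as an end would join two sites at distance
  two.\<close>

lemma segment_site_vec_point:
  assumes "site_vec x \<in> closed_segment (site_vec u) (site_vec v)" "z2_adj u v"
  shows "x \<in> {u, v}"
proof -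
  have "site_vec x \<in> closed_segment (site_vec x) (site_vec (fst x + 1, snd x))"
    "site_vec x \<in> closed_segment (site_vec x) (site_vec (fst x - 1, snd x))" by simp_all
  moreover have "z2_adj x (fst x + 1, snd x)" "z2_adj x (fst x - 1, snd x)"
    by (simp_all add: z2_adj_def)
  ultimately have "{u, v} \<inter> {x, (fst x + 1, snd x)} \<noteq> {}" "{u, v} \<inter> {x, (fst x - 1, snd x)} \<noteq> {}"
    using segments_share_endpoint[OF assms] by blast+
  then show ?thesis using assms(2) by (cases x) (auto simp: z2_adj_def)
qed

text \<open>The Fashoda meet theorem gives a common point of the two polygonal paths, and since
  edges meet only at sites this forces a common site. The conclusion speaks of reachability from
  both starting points and not merely of membership, because paths are to be glued there.\<close>

theorem crossing_paths_meet:
  assumes "conn G x y" "conn G' x' y'"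
    and "G \<subseteq> {a..b} \<times> {c..d}" "G' \<subseteq> {a..b} \<times> {c..d}"
    and "fst x = a" "fst y = b" "snd x' = c" "snd y' = d"
  shows "\<exists>z. conn G x z \<and> conn G' x' z"
proof -
  obtain g where g: "path g" "pathstart g = site_vec x" "pathfinish g = site_vec y"
    "path_image g \<subseteq> insert (site_vec x)
      (\<Union>{closed_segment (site_vec u) (site_vec v) |u v. conn G x u \<and> conn G x v \<and> z2_adj u v})"
    using conn_continuous_path[OF assms(1)] by blast
  obtain g' where g': "path g'" "pathstart g' = site_vec x'" "pathfinish g' = site_vec y'"
    "path_image g' \<subseteq> insert (site_vec x')
      (\<Union>{closed_segment (site_vec u) (site_vec v) |u v. conn G' x' u \<and> conn G' x' v \<and> z2_adj u v})"
    using conn_continuous_path[OF assms(2)] by blast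
  let ?B = "cbox (site_vec (a, c)) (site_vec (b, d))"
  have inB: "site_vec u \<in> ?B" if "u \<in> {a..b} \<times> {c..d}" for u
    using that by (auto simp: mem_box_cart forall_2)
  have seg: "closed_segment (site_vec u) (site_vec v) \<subseteq> ?B"
    if "u \<in> {a..b} \<times> {c..d}" "v \<in> {a..b} \<times> {c..d}" for u v
    using that inB convex_box(1) by (meson closed_segment_subset)
  have "path_image g \<subseteq> ?B"
  proof (rule order.trans[OF g(4)], safe)
    show "site_vec x \<in> ?B" using inB conn_in1[OF assms(1)] assms(3) by blast
  next
    fix p u v assume "conn G x u" "conn G x v" "p \<in> closed_segment (site_vec u) (site_vec v)"
    then show "p \<in> ?B" using seg[of u v] assms(3) conn_in2 by blast
  qed
  moreover have "path_image g' \<subseteq> ?B"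
  proof (rule order.trans[OF g'(4)], safe)
    show "site_vec x' \<in> ?B" using inB conn_in1[OF assms(2)] assms(4) by blast
  next
    fix p u v assume "conn G' x' u" "conn G' x' v" "p \<in> closed_segment (site_vec u) (site_vec v)"
    then show "p \<in> ?B" using seg[of u v] assms(4) conn_in2 by blast
  qed
  ultimately obtain p where p: "p \<in> path_image g" "p \<in> path_image g'"
    using fashoda[OF g(1) g'(1), of "site_vec (a, c)" "site_vec (b, d)"] g(2,3) g'(2,3) assms(5-8) by auto
  have rx: "conn G x x" "conn G' x' x'"
    using assms(1,2) conn_in1 conn_refl by blast+
  \<comment> \<open>A path of length zero has no edge, hence the separate cases for the starting
    points.\<close>
  consider "p = site_vec x" "p = site_vec x'"
    | u v where "p = site_vec x" "conn G' x' u" "conn G' x' v" "z2_adj u v"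
        "p \<in> closed_segment (site_vec u) (site_vec v)"
    | u v where "p = site_vec x'" "conn G x u" "conn G x v" "z2_adj u v"
        "p \<in> closed_segment (site_vec u) (site_vec v)"
    | u v u' v' where "conn G x u" "conn G x v" "z2_adj u v" "p \<in> closed_segment (site_vec u) (site_vec v)"
      "conn G' x' u'" "conn G' x' v'" "z2_adj u' v'" "p \<in> closed_segment (site_vec u') (site_vec v')"
  proof -
    have "p = site_vec x \<or> (\<exists>u v. conn G x u \<and> conn G x v \<and> z2_adj u v \<and>
        p \<in> closed_segment (site_vec u) (site_vec v))"
      using p(1) g(4) by blast
    moreover have "p = site_vec x' \<or> (\<exists>u v. conn G' x' u \<and> conn G' x' v \<and> z2_adj u v \<and>
        p \<in> closed_segment (site_vec u) (site_vec v))"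
      using p(2) g'(4) by blast
    ultimately show thesis using that by (elim disjE exE conjE) blast+
  qed
  then show ?thesis
  proof cases
    case 1
    then have "x = x'" by (simp add: vec2_eq prod_eq_iff)
    then show ?thesis using rx by blast
  next
    case 2 then show ?thesis using segment_site_vec_point[of x u v] rx by blast
  next
    case 3 then show ?thesis using segment_site_vec_point[of x' u v] rx by blast
  next
    case 4 then show ?thesis using segments_share_endpoint[of p u v u' v'] by blast
  qed
qed

lemma conn_component: "conn G x y \<Longrightarrow> conn {v. conn G x v} x y"
proof (induction rule: conn_induct)
  case refl then show ?case by (auto intro: conn_refl)
next
  case (step y z)
  then show ?case by (metis conn_step mem_Collect_eq)
qed

lemma crossing_sets_intersect:
  assumes "conn G x y" "conn G' x' y'"
    and "G \<subseteq> {a..b} \<times> {c..d}" "G' \<subseteq> {a..b} \<times> {c..d}"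
    and "fst x = a" "fst y = b" "snd x' = c" "snd y' = d"
  shows "\<exists>z\<in>G. z \<in> G'"
  using crossing_paths_meet[OF assms] conn_in2 by blast

text \<open>A new column \<open>b + 1\<close> is added to the box: the first path steps into it at
  height \<open>y\<close>, and the two ends of the second path are prolonged in it to the top and to
  the bottom. This yields a horizontal and a vertical crossing. If they meet in the new column, then
  \<open>y\<close> is \<open>y1\<close> or \<open>y2\<close> and the arms already share
  \<open>(b, y)\<close>.\<close>

lemma arms_meet:
  assumes "conn G p (a, y0)" "conn G p (b, y)"
    and "conn G' q (b, y1)" "conn G' q (b, y2)" "y2 \<le> y" "y \<le> y1"
    and "G \<subseteq> {a..b} \<times> {c..d}" "G' \<subseteq> {a..b} \<times> {c..d}"
  shows "\<exists>w. conn G p w \<and> conn G' q w"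
proof -
  define C where "C = {v. conn G p v}"
  define C' where "C' = {v. conn G' q v}"
  have C: "conn C p (a, y0)" "conn C p (b, y)" "C \<subseteq> G"
    unfolding C_def using conn_component assms(1,2) conn_in2 by blast+
  have C': "conn C' q (b, y1)" "conn C' q (b, y2)" "C' \<subseteq> G'"
    unfolding C'_def using conn_component assms(3,4) conn_in2 by blast+
  have mem: "(b, y) \<in> C" "(b, y1) \<in> C'" "(b, y2) \<in> C'"
    using C C' conn_in2 by blast+
  then have mem': "(b, y) \<in> {a..b} \<times> {c..d}" "(b, y1) \<in> {a..b} \<times> {c..d}" "(b, y2) \<in> {a..b} \<times> {c..d}"
    using assms(7,8) C C' by blast+
  define G1 where "G1 = insert (b + 1, y) C"
  define G2 where "G2 = C' \<union> {b + 1} \<times> {y1..d} \<union> {b + 1} \<times> {c..y2}"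
  have "conn C (a, y0) (b, y)" using C conn_sym conn_trans by blast
  then have "conn G1 (a, y0) (b, y)" by (rule conn_mono) (auto simp: G1_def)
  then have 1: "conn G1 (a, y0) (b + 1, y)"
    by (rule conn_step) (auto simp: G1_def z2_adj_def)
  have "conn C' (b, y2) (b, y1)" using C' conn_sym conn_trans by blast
  then have 2: "conn G2 (b, y2) (b, y1)" by (rule conn_mono) (auto simp: G2_def)
  have "conn G2 (b + 1, c) (b + 1, y2)" by (rule conn_vline) (use mem' in \<open>auto simp: G2_def\<close>)
  then have 3: "conn G2 (b + 1, c) (b, y2)"
    by (rule conn_step) (use mem in \<open>auto simp: G2_def z2_adj_def\<close>)
  have "conn G2 (b, y2) (b + 1, y1)"
    by (rule conn_step[OF 2]) (use mem' in \<open>auto simp: G2_def z2_adj_def\<close>)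
  moreover have "conn G2 (b + 1, y1) (b + 1, d)"
    by (rule conn_vline) (use mem' in \<open>auto simp: G2_def\<close>)
  ultimately have 4: "conn G2 (b + 1, c) (b + 1, d)"
    using 3 conn_trans by blast
  have "\<exists>z\<in>G1. z \<in> G2"
    by (rule crossing_sets_intersect[OF 1 4, of a "b + 1" c d])
      (use assms(7,8) C(3) C'(3) mem' in \<open>auto simp: G1_def G2_def\<close>)
  then obtain z where z: "z \<in> G1" "z \<in> G2" by blast
  have "\<exists>w\<in>C. w \<in> C'"
  proof (cases "z = (b + 1, y)")
    case True
    have "(b + 1, y) \<notin> C'" using C'(3) assms(8) by auto
    then have "y = y1 \<or> y = y2" using z True assms(5,6) by (auto simp: G2_def)
    then show ?thesis using mem by auto
  next
    case False
    then have "z \<in> C" using z by (auto simp: G1_def)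
    moreover have "fst z \<noteq> b + 1" using \<open>z \<in> C\<close> C(3) assms(7) by auto
    ultimately show ?thesis using z by (auto simp: G2_def)
  qed
  then show ?thesis by (auto simp: C_def C'_def)
qed

section \<open>Squares, exits from them, and blocking circuits\<close>

definition square :: "int \<Rightarrow> site set" where
  "square n = {-n..n} \<times> {-n..n}"

definition on_sphere :: "int \<Rightarrow> site \<Rightarrow> bool" where
  "on_sphere n y \<longleftrightarrow> y \<in> square n \<and> (\<bar>fst y\<bar> = n \<or> \<bar>snd y\<bar> = n)"

lemma finite_square [simp]: "finite (square n)"
  by (simp add: square_def)

lemma conn_exits_square:
  assumes "conn G x y" "x \<in> square n" "y \<notin> square n"
  shows "\<exists>w. on_sphere n w \<and> conn (G \<inter> square n) x w"
proof -
  have "conn (G \<inter> square n) x y \<or> (\<exists>w. on_sphere n w \<and> conn (G \<inter> square n) x w)"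
    using assms(1)
  proof (induction rule: conn_induct)
    case refl then show ?case using assms(2) by (auto intro: conn_refl)
  next
    case (step y z)
    show ?case
    proof (cases "\<exists>w. on_sphere n w \<and> conn (G \<inter> square n) x w")
      case False
      then have c: "conn (G \<inter> square n) x y" using step by blast
      show ?thesis
      proof (cases "z \<in> square n")
        case True then show ?thesis using c step by (auto intro: conn_step)
      next
        case False
        have "y \<in> square n" using conn_in2[OF c] by blast
        then have "on_sphere n y" using \<open>z2_adj y z\<close> False
          by - (erule z2_adj_cases; cases y; auto simp: on_sphere_def square_def)
        then show ?thesis using c by blast
      qed
    qed blast
  qed
  then show ?thesis using assms(3) conn_in2 by blast
qed

text \<open>Only the final stretch of the path is kept, from the moment it was last strictly below
  height \<open>d\<close>, or from its start if that is at height \<open>d\<close> and the path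
  never goes below.\<close>

lemma conn_last_entrance:
  assumes "conn G x y" "snd x \<le> d" "d \<le> snd y"
  shows "\<exists>w. snd w = d \<and> conn (G \<inter> {u. d \<le> snd u}) w y"
proof -
  have "d \<le> snd y \<longrightarrow> (\<exists>w. snd w = d \<and> conn (G \<inter> {u. d \<le> snd u}) w y)"
    using assms(1)
  proof (induction rule: conn_induct)
    case refl
    then have "snd x = d \<and> conn (G \<inter> {u. d \<le> snd u}) x x" if "d \<le> snd x"
      using assms(2) that by (auto intro: conn_refl)
    then show ?case by blast
  next
    case (step y z)
    show ?case
    proof
      assume z: "d \<le> snd z"
      show "\<exists>w. snd w = d \<and> conn (G \<inter> {u. d \<le> snd u}) w z"
      proof (cases "d \<le> snd y")
        case True
        then obtain w where "snd w = d" "conn (G \<inter> {u. d \<le> snd u}) w y" using step by blast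
        then show ?thesis using step z conn_step[of "G \<inter> {u. d \<le> snd u}" w y z] by blast
      next
        case False
        then have "snd z = d" using \<open>z2_adj y z\<close> z by (auto simp: z2_adj_def)
        then have "conn (G \<inter> {u. d \<le> snd u}) z z" using step by (auto intro: conn_refl)
        then show ?thesis using \<open>snd z = d\<close> by blast
      qed
    qed
  qed
  then show ?thesis using assms(3) by blast
qed

text \<open>Straight segments at height \<open>h\<close> prolong the path to the full width
  \<open>L\<close>. They lie at abscissas of modulus at least \<open>A\<close>, out of reach of
  \<open>M\<close> because \<open>a < A\<close>, so the site where the crossings meet lies in
  \<open>P\<close>.\<close>

lemma horizontal_chain_blocks:
  assumes "conn P (-A, h) (A, h)" "P \<subseteq> {-L..L} \<times> {c..d}"
    and "conn M x y" "M \<subseteq> {-a..a} \<times> {c..d}" "a < A" "snd x = c" "snd y = d"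
  shows "\<exists>z\<in>P. z \<in> M"
proof -
  define G where "G = P \<union> {-L..-A} \<times> {h} \<union> {A..L} \<times> {h}"
  have mem: "(-A, h) \<in> P" "(A, h) \<in> P" using assms(1) conn_in1 conn_in2 by blast+
  then have mem': "(-A, h) \<in> {-L..L} \<times> {c..d}" "(A, h) \<in> {-L..L} \<times> {c..d}" using assms(2) by blast+
  have "conn G (-L, h) (-A, h)" by (rule conn_hline) (use mem' in \<open>auto simp: G_def\<close>)
  moreover have "conn G (-A, h) (A, h)" by (rule conn_mono[OF assms(1)]) (auto simp: G_def)
  moreover have "conn G (A, h) (L, h)" by (rule conn_hline) (use mem' in \<open>auto simp: G_def\<close>)
  ultimately have "conn G (-L, h) (L, h)" using conn_trans by blast
  moreover have "M \<subseteq> {-L..L} \<times> {c..d}"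
  proof -
    have "a \<le> L" using mem' assms(5) by auto
    then show ?thesis using assms(4) by auto
  qed
  ultimately have "\<exists>z\<in>G. z \<in> M"
    by (rule_tac crossing_sets_intersect[of G "(-L, h)" "(L, h)" M x y "-L" L c d])
      (use assms mem' in \<open>auto simp: G_def\<close>)
  then show ?thesis using assms(4,5) by (force simp: G_def)
qed

text \<open>One map for each side of the square, taking that side to the top (the identity for the
  top itself). All are involutions, so pulling a configuration back and pushing a path forward use
  the same map.\<close>

definition square_involutions :: "(site \<Rightarrow> site) set" where
  "square_involutions = {\<lambda>x. x, \<lambda>x. (fst x, - snd x), \<lambda>x. (snd x, fst x), \<lambda>x. (- snd x, - fst x)}"

text \<open>The path will be built from sixteen links of length \<open>d\<close> at height
  \<open>4*d\<close>, each confined to a square of radius \<open>3*d\<close>, which explains the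
  rectangle. Its ends at \<open>8*d\<close> overshoot the square of radius \<open>7*d\<close>, so
  inside that square it separates the bottom of the band of heights \<open>d\<close> to
  \<open>7*d\<close> from the top.\<close>

definition blocking :: "int \<Rightarrow> (site \<Rightarrow> bool) \<Rightarrow> bool" where
  "blocking d s \<longleftrightarrow> conn ({x. s x} \<inter> {-11*d..11*d} \<times> {d..7*d}) (-8*d, 4*d) (8*d, 4*d)"

text \<open>A path of the opposite sign from the inner square to the outer sphere ends on some side;
  the matching reflection puts that side on top. Its final stretch above height \<open>d\<close>
  then crosses the band at abscissas of modulus at most \<open>7*d\<close> and has to meet the
  chain.\<close>

lemma blocking_circuit:
  assumes "\<forall>f\<in>square_involutions. blocking d (\<lambda>x. s (f x))" "x \<in> square d" "0 < d"
    and "on_sphere (7 * d) y"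
  shows "\<not> conn ({x. \<not> s x} \<inter> square (7 * d)) x y"
proof
  assume c: "conn ({x. \<not> s x} \<inter> square (7 * d)) x y"
  have "\<exists>f\<in>square_involutions. snd (f y) = 7 * d"
    using assms(4) unfolding on_sphere_def square_involutions_def square_def by auto
  then obtain f where f: "f \<in> square_involutions" "snd (f y) = 7 * d" by blast
  have inv: "f (f u) = u" and sq: "f u \<in> square n \<longleftrightarrow> u \<in> square n" for u n
    using f(1) by (cases u; auto simp: square_involutions_def square_def)+
  have adj: "z2_adj u v \<Longrightarrow> z2_adj (f u) (f v)" for u v
    using f(1) by (auto simp: square_involutions_def z2_adj_def)
  have "conn ({x. \<not> s (f x)} \<inter> square (7 * d)) (f x) (f y)"
    by (rule conn_image[OF c adj]) (auto simp: inv sq)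
  moreover have "f x \<in> square d" using assms(2) sq by simp
  then have "snd (f x) \<le> d" by (auto simp: square_def)
  ultimately obtain w where w: "snd w = d"
    "conn ({x. \<not> s (f x)} \<inter> square (7 * d) \<inter> {u. d \<le> snd u}) w (f y)"
    using conn_last_entrance[of _ "f x" "f y" d] f(2) assms(3) by fastforce
  have "conn ({x. s (f x)} \<inter> {-11*d..11*d} \<times> {d..7*d}) (-(8*d), 4*d) (8*d, 4*d)"
    using assms(1) f(1) by (auto simp: blocking_def)
  from horizontal_chain_blocks[OF this _ w(2), of "11 * d" d "7 * d" "7 * d"]
  show False using w(1) f(2) assms(3) by (force simp: square_def)
qed

section \<open>Percolation in positively associated random fields\<close>

text \<open>The index type stays general because the same notion serves configurations on sites,
  pairs of configurations indexed by \<open>site + site\<close>, and families of random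
  bits.\<close>

definition local_on :: "'i set \<Rightarrow> (('i \<Rightarrow> bool) \<Rightarrow> 'c) \<Rightarrow> bool" where
  "local_on W A \<longleftrightarrow> (\<forall>s s'. (\<forall>x\<in>W. s x = s' x) \<longrightarrow> A s = A s')"

definition increasing :: "((site \<Rightarrow> bool) \<Rightarrow> bool) \<Rightarrow> bool" where
  "increasing A \<longleftrightarrow> (\<forall>s s'. (\<forall>x. s x \<longrightarrow> s' x) \<longrightarrow> A s \<longrightarrow> A s')"

definition automorphism :: "(site \<Rightarrow> site) \<Rightarrow> bool" where
  "automorphism f \<longleftrightarrow> bij f \<and> (\<forall>x y. z2_adj (f x) (f y) \<longleftrightarrow> z2_adj x y)"

lemma local_onD: "local_on W A \<Longrightarrow> (\<And>x. x \<in> W \<Longrightarrow> s x = s' x) \<Longrightarrow> A s = A s'"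
  unfolding local_on_def by blast

lemma local_on_mono: "local_on W A \<Longrightarrow> W \<subseteq> W' \<Longrightarrow> local_on W' A"
  unfolding local_on_def by blast

lemma local_on_conj: "local_on W A \<Longrightarrow> local_on W B \<Longrightarrow> local_on W (\<lambda>s. A s \<and> B s)"
  unfolding local_on_def by blast

lemma local_on_ball: "(\<And>i. i \<in> I \<Longrightarrow> local_on W (A i)) \<Longrightarrow> local_on W (\<lambda>s. \<forall>i\<in>I. A i s)"
  unfolding local_on_def by blast

lemma local_on_ex: "(\<And>i. local_on W (A i)) \<Longrightarrow> local_on W (\<lambda>s. \<exists>i. P i \<and> A i s)"
  unfolding local_on_def by blast

lemma local_on_comp: "local_on W A \<Longrightarrow> local_on (f ` W) (\<lambda>s. A (\<lambda>x. s (f x)))"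
  unfolding local_on_def by (metis imageI)

lemma local_on_conn: "W \<subseteq> W' \<Longrightarrow> local_on W' (\<lambda>s. conn ({x. s x} \<inter> W) x y)"
  unfolding local_on_def
proof (intro allI impI)
  fix s s' :: "site \<Rightarrow> bool"
  assume "W \<subseteq> W'" "\<forall>x\<in>W'. s x = s' x"
  then have "{x. s x} \<inter> W = {x. s' x} \<inter> W" by blast
  then show "conn ({x. s x} \<inter> W) x y = conn ({x. s' x} \<inter> W) x y" by simp
qed

lemma increasing_comp: "increasing A \<Longrightarrow> increasing (\<lambda>s. A (\<lambda>x. s (f x)))"
  unfolding increasing_def
proof (intro allI impI)
  fix s s' :: "site \<Rightarrow> bool"
  assume A: "\<forall>s s'. (\<forall>x. s x \<longrightarrow> s' x) \<longrightarrow> A s \<longrightarrow> A s'"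
    and le: "\<forall>x. s x \<longrightarrow> s' x" and s: "A (\<lambda>x. s (f x))"
  show "A (\<lambda>x. s' (f x))"
    by (rule A[rule_format, OF _ s]) (rule le[rule_format])
qed

lemma increasing_ball: "(\<And>i. i \<in> I \<Longrightarrow> increasing (A i)) \<Longrightarrow> increasing (\<lambda>s. \<forall>i\<in>I. A i s)"
  unfolding increasing_def by blast

lemma increasing_ex: "(\<And>i. increasing (A i)) \<Longrightarrow> increasing (\<lambda>s. \<exists>i. P i \<and> A i s)"
  unfolding increasing_def by blast

lemma increasing_conn: "increasing (\<lambda>s. conn ({x. s x} \<inter> W) x y)"
  unfolding increasing_def by (auto elim!: conn_mono)

lemma conn_pullback:
  assumes "conn ({x. s (f x)} \<inter> W) x y" "automorphism f" "f ` W \<subseteq> W'"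
  shows "conn ({x. s x} \<inter> W') (f x) (f y)"
  by (rule conn_image[OF assms(1)]) (use assms(2,3) in \<open>auto simp: automorphism_def\<close>)

lemma automorphism_add [simp]: "automorphism (\<lambda>x. x + z)" "automorphism ((+) z)"
proof -
  have "z2_adj (x + z) (y + z) = z2_adj x y" "z2_adj (z + x) (z + y) = z2_adj x y" for x y
    by (auto simp: z2_adj_def)
  moreover have "bij (\<lambda>x. x + z)" "bij ((+) z)"
    by (rule bij_plus_right bij_plus)+
  ultimately show "automorphism (\<lambda>x. x + z)" "automorphism ((+) z)"
    by (auto simp: automorphism_def)
qed

lemma automorphism_involution:
  assumes "\<And>x. f (f x) = x" "\<And>x y. z2_adj x y \<Longrightarrow> z2_adj (f x) (f y)"
  shows "automorphism f"
  unfolding automorphism_def using assms by (metis involuntory_imp_bij)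

lemma automorphism_square_involutions: "f \<in> square_involutions \<Longrightarrow> automorphism f"
  by (rule automorphism_involution) (auto simp: square_involutions_def z2_adj_def)

lemma automorphism_reflect [simp]: "automorphism (\<lambda>x. (c - fst x, snd x))"
  by (rule automorphism_involution) (auto simp: z2_adj_def)

text \<open>A functional of finitely many coordinates holds on a finite union of pattern events, one
  for each pattern \<open>D\<close> on \<open>W\<close> that satisfies it.\<close>

lemma (in prob_space) local_collect_event:
  assumes "finite W" "local_on W \<psi>" "\<And>i. i \<in> W \<Longrightarrow> {\<omega>\<in>space M. Y \<omega> i} \<in> events"
  shows "{\<omega>\<in>space M. \<psi> (Y \<omega>)} \<in> events"
proof -
  have "{\<omega>\<in>space M. \<psi> (Y \<omega>)} =
    (\<Union>D\<in>{D\<in>Pow W. \<psi> (\<lambda>i. i \<in> D)}. {\<omega>\<in>space M. \<forall>i\<in>W. Y \<omega> i \<longleftrightarrow> i \<in> D})" (is "?L = ?R")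
  proof (intro equalityI subsetI)
    fix \<omega> assume w: "\<omega> \<in> ?L"
    let ?D = "{i\<in>W. Y \<omega> i}"
    have "\<psi> (\<lambda>i. i \<in> ?D)" using local_onD[OF assms(2), of "\<lambda>i. i \<in> ?D" "Y \<omega>"] w by auto
    then show "\<omega> \<in> ?R" using w by (intro UN_I[of ?D]) auto
  next
    fix \<omega> assume "\<omega> \<in> ?R"
    then obtain D where "\<psi> (\<lambda>i. i \<in> D)" "\<omega> \<in> space M" "\<forall>i\<in>W. Y \<omega> i \<longleftrightarrow> i \<in> D" by blast
    then show "\<omega> \<in> ?L" using local_onD[OF assms(2), of "Y \<omega>" "\<lambda>i. i \<in> D"] by auto
  qed
  also have "\<dots> \<in> events"
  proof (intro sets.finite_UN)
    show "finite {D\<in>Pow W. \<psi> (\<lambda>i. i \<in> D)}" using assms(1) by simp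
    fix D
    have "{\<omega>\<in>space M. Y \<omega> i \<longleftrightarrow> i \<in> D} \<in> events" if "i \<in> W" for i
      using assms(3)[OF that] by (cases "i \<in> D") (auto intro: sets.sets_Collect_neg)
    then show "{\<omega>\<in>space M. \<forall>i\<in>W. Y \<omega> i \<longleftrightarrow> i \<in> D} \<in> events"
      using assms(1) by (intro sets.sets_Collect_finite_All) auto
  qed
  finally show ?thesis .
qed

text \<open>Every axiom on the law speaks of functionals of finitely many sites, so that it can be
  checked on discrete approximations and carried through limits of probabilities.\<close>

locale planar_field = prob_space M for M :: "'a measure" +
  fixes \<sigma> :: "'a \<Rightarrow> site \<Rightarrow> bool"
  assumes site_event: "\<And>x. {\<omega>\<in>space M. \<sigma> \<omega> x} \<in> events"
    and positive_association: "\<And>W A B. finite W \<Longrightarrow> local_on W A \<Longrightarrow> local_on W B \<Longrightarrow>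
      increasing A \<Longrightarrow> increasing B \<Longrightarrow>
      prob {\<omega>\<in>space M. A (\<sigma> \<omega>)} * prob {\<omega>\<in>space M. B (\<sigma> \<omega>)}
        \<le> prob {\<omega>\<in>space M. A (\<sigma> \<omega>) \<and> B (\<sigma> \<omega>)}"
    and invariance: "\<And>W A f. finite W \<Longrightarrow> local_on W A \<Longrightarrow> automorphism f \<Longrightarrow>
      prob {\<omega>\<in>space M. A (\<lambda>x. \<sigma> \<omega> (f x))} = prob {\<omega>\<in>space M. A (\<sigma> \<omega>)}"
    and flip_symmetry: "\<And>W A. finite W \<Longrightarrow> local_on W A \<Longrightarrow>
      prob {\<omega>\<in>space M. A (\<lambda>x. \<not> \<sigma> \<omega> x)} = prob {\<omega>\<in>space M. A (\<sigma> \<omega>)}"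
    and mixing: "\<And>W A B. finite W \<Longrightarrow> local_on W A \<Longrightarrow> local_on W B \<Longrightarrow>
      (\<lambda>n. prob {\<omega>\<in>space M. A (\<sigma> \<omega>) \<and> B (\<lambda>x. \<sigma> \<omega> (x + (int n, 0)))})
        \<longlonglongrightarrow> prob {\<omega>\<in>space M. A (\<sigma> \<omega>)} * prob {\<omega>\<in>space M. B (\<sigma> \<omega>)}"
begin

definition pr :: "((site \<Rightarrow> bool) \<Rightarrow> bool) \<Rightarrow> real" where
  "pr A = prob {\<omega>\<in>space M. A (\<sigma> \<omega>)}"

lemma local_event: "finite W \<Longrightarrow> local_on W A \<Longrightarrow> {\<omega>\<in>space M. A (\<sigma> \<omega>)} \<in> events"
  by (rule local_collect_event[of W A \<sigma>]) (assumption | rule site_event)+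

lemma pr_mono:
  assumes "finite W" "local_on W B" "\<And>s. A s \<Longrightarrow> B s"
  shows "pr A \<le> pr B"
  unfolding pr_def by (intro finite_measure_mono local_event[OF assms(1,2)]) (use assms in auto)

lemma pr_nonneg [simp]: "0 \<le> pr A"
  by (simp add: pr_def)

lemma pr_comp: "finite W \<Longrightarrow> local_on W A \<Longrightarrow> automorphism f \<Longrightarrow> pr (\<lambda>s. A (\<lambda>x. s (f x))) = pr A"
  unfolding pr_def by (rule invariance)

lemma pr_conj:
  assumes "finite W" "local_on W A" "finite W'" "local_on W' B" "increasing A" "increasing B"
    and "a \<le> pr A" "b \<le> pr B" "0 \<le> a" "0 \<le> b"
  shows "a * b \<le> pr (\<lambda>s. A s \<and> B s)"
proof -
  have "local_on (W \<union> W') A" "local_on (W \<union> W') B" "finite (W \<union> W')"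
    using assms(1,3) by (auto intro: local_on_mono[OF assms(2)] local_on_mono[OF assms(4)])
  then have "pr A * pr B \<le> pr (\<lambda>s. A s \<and> B s)"
    unfolding pr_def using positive_association assms(5,6) by blast
  moreover have "a * b \<le> pr A * pr B" using assms by (intro mult_mono) auto
  ultimately show ?thesis by linarith
qed

lemma pr_ball:
  assumes "finite I" "\<And>i. i \<in> I \<Longrightarrow> finite (W i) \<and> local_on (W i) (A i)"
    and "\<And>i. i \<in> I \<Longrightarrow> increasing (A i)" "\<And>i. i \<in> I \<Longrightarrow> c \<le> pr (A i)" "0 \<le> c"
  shows "c ^ card I \<le> pr (\<lambda>s. \<forall>i\<in>I. A i s)"
  using assms(1-4)
proof (induction I rule: finite_induct)
  case empty
  then show ?case by (simp add: pr_def prob_space)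
next
  case (insert i I)
  have IH: "c ^ card I \<le> pr (\<lambda>s. \<forall>i\<in>I. A i s)" using insert by blast
  have "local_on (\<Union>i\<in>I. W i) (\<lambda>s. \<forall>i\<in>I. A i s)"
  proof (rule local_on_ball)
    fix j assume "j \<in> I"
    then have "local_on (W j) (A j)" "W j \<subseteq> (\<Union>i\<in>I. W i)"
      using insert.prems(1)[of j] by blast+
    then show "local_on (\<Union>i\<in>I. W i) (A j)" by (rule local_on_mono)
  qed
  moreover have "increasing (\<lambda>s. \<forall>i\<in>I. A i s)"
    by (rule increasing_ball) (use insert.prems(2) in blast)
  moreover have "finite (\<Union>i\<in>I. W i)" using insert.hyps(1) insert.prems(1) by blast
  moreover have "finite (W i)" "local_on (W i) (A i)" "increasing (A i)" "c \<le> pr (A i)"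
    using insert.prems by blast+
  ultimately have "c * c ^ card I \<le> pr (\<lambda>s. A i s \<and> (\<forall>i\<in>I. A i s))"
    using IH assms(5) by (intro pr_conj[of "W i" _ "\<Union>i\<in>I. W i"]) auto
  then show ?case using insert by simp
qed

lemma pr_bex_le:
  assumes "finite I" "\<And>i. i \<in> I \<Longrightarrow> finite (W i) \<and> local_on (W i) (A i)"
    and "\<And>s. C s \<Longrightarrow> \<exists>i\<in>I. A i s"
  shows "pr C \<le> (\<Sum>i\<in>I. pr (A i))"
proof -
  have ev: "{\<omega>\<in>space M. A i (\<sigma> \<omega>)} \<in> events" if "i \<in> I" for i
    using assms(2)[OF that] local_event by blast
  have "pr C \<le> prob (\<Union>i\<in>I. {\<omega>\<in>space M. A i (\<sigma> \<omega>)})"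
    unfolding pr_def using assms(1,3) ev by (intro finite_measure_mono sets.finite_UN) auto
  also have "\<dots> \<le> (\<Sum>i\<in>I. pr (A i))"
    unfolding pr_def using assms(1) ev by (intro finite_measure_subadditive_finite) auto
  finally show ?thesis .
qed

section \<open>Arms and their gluing\<close>

definition arm :: "int \<Rightarrow> (site \<Rightarrow> bool) \<Rightarrow> bool" where
  "arm n s \<longleftrightarrow> (\<exists>y. on_sphere n y \<and> conn ({x. s x} \<inter> square n) (0, 0) y)"

definition side :: "int \<Rightarrow> int \<Rightarrow> int \<Rightarrow> (site \<Rightarrow> bool) \<Rightarrow> bool" where
  "side n lo hi s \<longleftrightarrow> (\<exists>j. (lo \<le> j \<and> j \<le> hi) \<and> conn ({x. s x} \<inter> square n) (0, 0) (n, j))"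

text \<open>The radius \<open>3 * d\<close> fits the construction with \<open>d = 2 * u\<close>: it
  holds the rectangle of half-width \<open>4 * u\<close> and half-height \<open>6 * u\<close> used
  for half a link, together with its mirror image in the vertical line at abscissa
  \<open>u\<close>.\<close>

definition link :: "int \<Rightarrow> (site \<Rightarrow> bool) \<Rightarrow> bool" where
  "link d s \<longleftrightarrow> conn ({x. s x} \<inter> square (3 * d)) (0, 0) (d, 0)"

lemma local_arm: "local_on (square n) (arm n)"
  unfolding arm_def [abs_def] by (intro local_on_ex local_on_conn) auto

lemma local_side: "local_on (square n) (side n lo hi)"
  unfolding side_def [abs_def] by (intro local_on_ex local_on_conn) auto

lemma increasing_side: "increasing (side n lo hi)"
  unfolding side_def [abs_def] by (intro increasing_ex increasing_conn)

lemma local_link: "local_on (square (3 * d)) (link d)"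
  unfolding link_def [abs_def] by (intro local_on_conn) auto

lemma increasing_link: "increasing (link d)"
  unfolding link_def [abs_def] by (rule increasing_conn)

lemma pr_side_comp:
  assumes "automorphism f"
  shows "pr (\<lambda>s. side n lo hi (\<lambda>x. s (f x))) = pr (side n lo hi)"
  using pr_comp[OF finite_square local_side assms] .

text \<open>Some reflection in \<open>F\<close> takes the side on which the arm ends to the right
  side, and invariance makes the summands of the union bound equal.\<close>

lemma pr_side_full: "pr (arm n) \<le> 4 * pr (side n (- n) n)"
proof -
  define F :: "(site \<Rightarrow> site) set" where
    "F = {\<lambda>x. x, \<lambda>x. (0 - fst x, snd x), \<lambda>x. (snd x, fst x), \<lambda>x. (- snd x, - fst x)}"
  have aut: "automorphism f" if "f \<in> F" for f
    using that automorphism_reflect[of 0] automorphism_square_involutions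
    by (auto simp: square_involutions_def F_def)
  have fin: "finite F" and card: "card F \<le> 4"
    by (auto simp: F_def intro!: card_insert_le_m1)
  have "pr (arm n) \<le> (\<Sum>f\<in>F. pr (\<lambda>s. side n (- n) n (\<lambda>x. s (f x))))"
  proof (rule pr_bex_le[OF fin, of "\<lambda>f. f ` square n"])
    fix f assume "f \<in> F"
    show "finite (f ` square n) \<and> local_on (f ` square n) (\<lambda>s. side n (- n) n (\<lambda>x. s (f x)))"
      using local_on_comp[OF local_side] by simp
  next
    fix s assume "arm n s"
    then obtain y where y: "on_sphere n y" "conn ({x. s x} \<inter> square n) (0, 0) y"
      by (auto simp: arm_def)
    have "\<exists>f\<in>F. fst (f y) = n"
      using y(1) unfolding on_sphere_def F_def by auto
    then obtain f where f: "f \<in> F" "fst (f y) = n" by blast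
    have inv: "f (f x) = x" and sq: "x \<in> square n \<Longrightarrow> f x \<in> square n" and f0: "f (0, 0) = (0, 0)" for x
      using f(1) by (cases x; auto simp: F_def square_def)+
    have "conn ({x. s (f x)} \<inter> square n) (f (0, 0)) (f y)"
      by (rule conn_image[OF y(2)]) (use aut[OF f(1)] inv sq in \<open>auto simp: automorphism_def\<close>)
    then have c: "conn ({x. s (f x)} \<inter> square n) (0, 0) (n, snd (f y))"
      using f0 f(2) by (metis prod.collapse)
    moreover have "(n, snd (f y)) \<in> square n" using conn_in2[OF c] by blast
    ultimately have "side n (- n) n (\<lambda>x. s (f x))" unfolding side_def square_def by auto
    then show "\<exists>f\<in>F. side n (- n) n (\<lambda>x. s (f x))" using f(1) by blast
  qed
  also have "\<dots> = real (card F) * pr (side n (- n) n)"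
    using aut by (simp add: pr_side_comp)
  also have "\<dots> \<le> 4 * pr (side n (- n) n)"
    using card by (intro mult_right_mono) auto
  finally show ?thesis .
qed

lemma pr_side_upper: "pr (side n (- n) n) \<le> 2 * pr (side n 0 n)"
proof -
  define F :: "(site \<Rightarrow> site) set" where "F = {\<lambda>x. x, \<lambda>x. (fst x, - snd x)}"
  have aut: "automorphism f" if "f \<in> F" for f
    using that automorphism_square_involutions by (auto simp: square_involutions_def F_def)
  have fin: "finite F" and card: "card F \<le> 2"
    by (auto simp: F_def intro!: card_insert_le_m1)
  have "pr (side n (- n) n) \<le> (\<Sum>f\<in>F. pr (\<lambda>s. side n 0 n (\<lambda>x. s (f x))))"
  proof (rule pr_bex_le[OF fin, of "\<lambda>f. f ` square n"])
    fix f assume "f \<in> F"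
    show "finite (f ` square n) \<and> local_on (f ` square n) (\<lambda>s. side n 0 n (\<lambda>x. s (f x)))"
      using local_on_comp[OF local_side] by simp
  next
    fix s assume "side n (- n) n s"
    then obtain j where j: "- n \<le> j" "j \<le> n" "conn ({x. s x} \<inter> square n) (0, 0) (n, j)"
      by (auto simp: side_def)
    have "\<exists>f\<in>F. 0 \<le> snd (f (n, j)) \<and> snd (f (n, j)) \<le> n"
      using j(1,2) unfolding F_def by auto
    then obtain f where f: "f \<in> F" "0 \<le> snd (f (n, j))" "snd (f (n, j)) \<le> n" by blast
    have inv: "f (f x) = x" and sq: "x \<in> square n \<Longrightarrow> f x \<in> square n" and f0: "f (0, 0) = (0, 0)"
      and f1: "fst (f x) = fst x" for x
      using f(1) by (cases x; auto simp: F_def square_def)+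
    have "conn ({x. s (f x)} \<inter> square n) (f (0, 0)) (f (n, j))"
      by (rule conn_image[OF j(3)]) (use aut[OF f(1)] inv sq in \<open>auto simp: automorphism_def\<close>)
    then have c: "conn ({x. s (f x)} \<inter> square n) (0, 0) (n, snd (f (n, j)))"
      using f0 f1 by (metis prod.collapse fst_conv)
    then have "side n 0 n (\<lambda>x. s (f x))" using f(2,3) unfolding side_def by auto
    then show "\<exists>f\<in>F. side n 0 n (\<lambda>x. s (f x))" using f(1) by blast
  qed
  also have "\<dots> = real (card F) * pr (side n 0 n)"
    using aut by (simp add: pr_side_comp)
  also have "\<dots> \<le> 2 * pr (side n 0 n)"
    using card by (intro mult_right_mono) auto
  finally show ?thesis .
qed

text \<open>Take the largest \<open>a\<close> for which ending at height at least \<open>a\<close>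
  has probability at least \<theta> / 16. Ending at \<open>a + 1\<close> or higher is then less
  likely than that, so of the mass \<theta> / 8 on the upper half of the side at least \<theta> / 16
  remains at heights up to \<open>a\<close>. The factors 4, 2 and 2 of 16 come from the four sides,
  the two halves and this division.\<close>

lemma splitting_height:
  assumes "0 \<le> n" "0 < \<theta>" "\<theta> \<le> pr (arm n)"
  shows "\<exists>a. 0 \<le> a \<and> a \<le> n \<and> \<theta> / 16 \<le> pr (side n a n) \<and> \<theta> / 16 \<le> pr (side n 0 a)"
proof -
  have up: "\<theta> / 8 \<le> pr (side n 0 n)"
    using pr_side_full[of n] pr_side_upper[of n] assms by linarith
  let ?S = "{a\<in>{0..n}. \<theta> / 16 \<le> pr (side n a n)}"
  have ne: "0 \<in> ?S" using assms up by auto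
  define a where "a = Max ?S"
  have fin: "finite ?S" by (rule finite_subset[of _ "{0..n}"]) auto
  have "a \<in> ?S" unfolding a_def by (rule Max_in[OF fin]) (use ne in blast)
  then have a: "0 \<le> a" "a \<le> n" "\<theta> / 16 \<le> pr (side n a n)" by auto
  have "\<theta> / 16 \<le> pr (side n 0 a)"
  proof (cases "a = n")
    case True then show ?thesis using up assms by auto
  next
    case False
    then have "a + 1 \<notin> ?S" using Max_ge[OF fin, of "a + 1"] unfolding a_def by linarith
    then have lt: "pr (side n (a + 1) n) < \<theta> / 16" using a False by auto
    have "pr (side n 0 n) \<le> (\<Sum>b\<in>{False, True}. pr (if b then side n 0 a else side n (a + 1) n))"
    proof (rule pr_bex_le[of _ "\<lambda>_. square n"])
      fix s assume "side n 0 n s"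
      then obtain j where j: "0 \<le> j" "j \<le> n" "conn ({x. s x} \<inter> square n) (0, 0) (n, j)"
        unfolding side_def by blast
      have "side n 0 a s \<or> side n (a + 1) n s"
      proof (cases "j \<le> a")
        case True then show ?thesis using j unfolding side_def by blast
      next
        case False
        then have "a + 1 \<le> j" by simp
        then show ?thesis using j unfolding side_def by blast
      qed
      then show "\<exists>b\<in>{False, True}. (if b then side n 0 a else side n (a + 1) n) s" by auto
    qed (simp_all add: local_side)
    then show ?thesis using lt up by simp
  qed
  then show ?thesis using a by blast
qed

end

lemma automorphism_comp:
  assumes "automorphism f" "automorphism g"
  shows "automorphism (\<lambda>x. f (g x))"
  using assms bij_comp[of g f] unfolding automorphism_def comp_def by metis

context planar_field
begin

text \<open>The two arms of the shifted configuration leave the square around \<open>(u, a)\<close> above and below the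
  endpoint of the arm of the origin, so that the paths must cross.\<close>

lemma four_arms_link:
  assumes "2 * u \<le> t" "t \<le> 2 * u + 1" "1 \<le> u" "0 \<le> a" "a \<le> t" "a' \<le> 2 * a"
    and left: "side (t + u) (- (t + u)) (t + u) (\<lambda>x. s (0 - fst x, snd x))"
    and right: "side (t + u) 0 a' s"
    and up: "side t a t (\<lambda>x. s ((u, a) + x))"
    and down: "side t a t (\<lambda>x. s ((u, a) + (fst x, - snd x)))"
  shows "conn ({x. s x} \<inter> {- 4 * u..4 * u} \<times> {- 6 * u..6 * u}) (0, 0) (u, a)"
proof -
  let ?R = "{- 4 * u..4 * u} \<times> {- 6 * u..6 * u}"
  define G where "G = {x. s x} \<inter> square (t + u)"
  define H where "H = {x. s x} \<inter> {u - t..u + t} \<times> {a - t..a + t}"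
  obtain j0 where j0: "conn ({x. s (0 - fst x, snd x)} \<inter> square (t + u)) (0, 0) (t + u, j0)"
    using left unfolding side_def by blast
  have 1: "conn G (0, 0) (- (t + u), j0)"
  proof -
    have "(\<lambda>x. (0 - fst x, snd x)) ` square (t + u) \<subseteq> square (t + u)" by (auto simp: square_def)
    from conn_pullback[OF j0 automorphism_reflect this] show ?thesis by (simp add: G_def)
  qed
  obtain j where j: "0 \<le> j" "j \<le> a'" "conn G (0, 0) (t + u, j)"
    using right unfolding side_def G_def by blast
  obtain j1 where j1: "a \<le> j1" "conn ({x. s ((u, a) + x)} \<inter> square t) (0, 0) (t, j1)"
    using up unfolding side_def by blast
  have 2: "conn H (u, a) (u + t, a + j1)"
  proof -
    have "(+) (u, a) ` square t \<subseteq> {u - t..u + t} \<times> {a - t..a + t}" by (auto simp: square_def)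
    from conn_pullback[OF j1(2) automorphism_add(2) this] show ?thesis by (simp add: H_def)
  qed
  obtain j2 where j2: "a \<le> j2" "conn ({x. s ((u, a) + (fst x, - snd x))} \<inter> square t) (0, 0) (t, j2)"
    using down unfolding side_def by blast
  have aut: "automorphism (\<lambda>x. (u, a) + (fst x, - snd x))"
    by (rule automorphism_comp[OF automorphism_add(2) automorphism_square_involutions])
      (simp add: square_involutions_def)
  have 3: "conn H (u, a) (u + t, a - j2)"
  proof -
    have "(\<lambda>x. (u, a) + (fst x, - snd x)) ` square t \<subseteq> {u - t..u + t} \<times> {a - t..a + t}"
      by (auto simp: square_def)
    from conn_pullback[OF j2(2) aut this] show ?thesis by (simp add: H_def)
  qed
  \<comment> \<open>On the line of abscissa \<open>t + u\<close> the heights interlace: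
    \<open>a - j2 \<le> 0 \<le> j \<le> a' \<le> 2 * a \<le> a + j1\<close>. This is where
    \<open>a' \<le> 2 * a\<close> enters.\<close>
  have "\<exists>w. conn G (0, 0) w \<and> conn H (u, a) w"
    by (rule arms_meet[OF 1, where b = "t + u" and y = j and ?y1.0 = "a + j1" and ?y2.0 = "a - j2"
          and c = "- 6 * u" and d = "6 * u"])
      (use j 2 3 j1(1) j2(1) assms in \<open>auto simp: add.commute G_def H_def square_def\<close>)
  then obtain w where w: "conn G (0, 0) w" "conn H (u, a) w" by blast
  have "G \<subseteq> {x. s x} \<inter> ?R" "H \<subseteq> {x. s x} \<inter> ?R"
    using assms by (auto simp: G_def H_def square_def)
  then show ?thesis using w conn_mono conn_sym conn_trans by meson
qed

text \<open>Positive association pays \<theta> / 16 for each of four arms and joins the origin to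
  \<open>(u, a)\<close>. The reflection in the vertical line at abscissa \<open>u\<close> fixes
  \<open>(u, a)\<close> and exchanges the origin with \<open>(2 * u, 0)\<close>, so the mirror image
  of the same event completes the link; hence the square.\<close>

lemma pr_link:
  assumes \<theta>: "0 < \<theta>" "\<And>n. 0 \<le> n \<Longrightarrow> \<theta> \<le> pr (arm n)"
    and u: "2 * u \<le> t" "t \<le> 2 * u + 1" "1 \<le> u" "0 \<le> a" "a \<le> t" "a' \<le> 2 * a"
    and a: "\<theta> / 16 \<le> pr (side t a t)" and a': "\<theta> / 16 \<le> pr (side (t + u) 0 a')"
  shows "((\<theta> / 16) ^ 4) ^ 2 \<le> pr (link (2 * u))"
proof -
  define W where "W = square (20 * u)"
  have fin: "finite W" by (simp add: W_def)
  define ev where "ev s = conn ({x. s x} \<inter> {- 4 * u..4 * u} \<times> {- 6 * u..6 * u}) (0, 0) (u, a)"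
    for s :: "site \<Rightarrow> bool"
  have loc_ev: "local_on W ev" unfolding ev_def [abs_def] W_def
    by (rule local_on_conn) (use u(3) in \<open>auto simp: square_def\<close>)
  have inc_ev: "increasing ev" unfolding ev_def [abs_def] by (rule increasing_conn)
  define refl where "refl = (\<lambda>x::site. (fst x, - snd x))"
  have aut_refl: "automorphism refl"
    using automorphism_square_involutions by (auto simp: square_involutions_def refl_def)
  have aut: "automorphism (\<lambda>x. (u, a) + refl x)"
    by (rule automorphism_comp[OF automorphism_add(2) aut_refl])
  define F :: "nat \<Rightarrow> (site \<Rightarrow> bool) \<Rightarrow> bool" where
    "F i = [\<lambda>s. side (t + u) (- (t + u)) (t + u) (\<lambda>x. s (0 - fst x, snd x)), side (t + u) 0 a',
       \<lambda>s. side t a t (\<lambda>x. s ((u, a) + x)), \<lambda>s. side t a t (\<lambda>x. s ((u, a) + refl x))] ! i" for i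
  have lF: "local_on W (F i)" if i4: "i < 4" for i
  proof -
    consider "i = 0" | "i = 1" | "i = 2" | "i = 3" using i4 by linarith
    then show ?thesis
    proof cases
      case 1
      show ?thesis unfolding 1 F_def
        by (simp, rule local_on_mono[OF local_on_comp[OF local_side]])
          (use u in \<open>auto simp: W_def square_def\<close>)
    next
      case 2
      show ?thesis unfolding 2 F_def
        by (simp, rule local_on_mono[OF local_side]) (use u in \<open>auto simp: W_def square_def\<close>)
    next
      case 3
      show ?thesis unfolding 3 F_def
        by (simp, rule local_on_mono[OF local_on_comp[OF local_side]])
          (use u in \<open>auto simp: W_def square_def\<close>)
    next
      case 4
      show ?thesis unfolding 4 F_def
        by (simp, rule local_on_mono[OF local_on_comp[OF local_side, where f = "\<lambda>x. (u, a) + refl x"]])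
          (use u in \<open>auto simp: W_def square_def refl_def\<close>)
    qed
  qed
  have iF: "increasing (F i)" if i4: "i < 4" for i
  proof -
    consider "i = 0" | "i = 1" | "i = 2" | "i = 3" using i4 by linarith
    then show ?thesis
      by cases (auto simp: F_def intro: increasing_comp increasing_side
          increasing_comp[where f = "\<lambda>x. (u, a) + refl x"])
  qed
  have pF: "\<theta> / 16 \<le> pr (F i)" if i4: "i < 4" for i
  proof -
    have full: "\<theta> / 16 \<le> pr (side (t + u) (- (t + u)) (t + u))"
      using \<theta>(2)[of "t + u"] pr_side_full[of "t + u"] u \<theta>(1) by linarith
    consider "i = 0" | "i = 1" | "i = 2" | "i = 3" using i4 by linarith
    then show ?thesis
      using full a a' pr_side_comp[OF automorphism_reflect[of 0], of "t + u"]
        pr_side_comp[OF automorphism_add(2), of t a t "(u, a)"] pr_side_comp[OF aut, of t a t]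
      by cases (auto simp: F_def)
  qed
  have "(\<theta> / 16) ^ card {..<4::nat} \<le> pr (\<lambda>s. \<forall>i\<in>{..<4}. F i s)"
    by (rule pr_ball[of _ "\<lambda>_. W"]) (use lF iF pF fin \<theta> in auto)
  also have "\<dots> \<le> pr ev"
  proof (rule pr_mono[OF fin loc_ev])
    fix s assume "\<forall>i\<in>{..<4}. F i s"
    then have "F 0 s" "F 1 s" "F 2 s" "F 3 s" by auto
    then show "ev s" unfolding ev_def
      by (intro four_arms_link[OF u]) (auto simp: F_def refl_def)
  qed
  finally have pev: "(\<theta> / 16) ^ 4 \<le> pr ev" by simp
  let ?r = "\<lambda>x::site. (2 * u - fst x, snd x)"
  have "(\<theta> / 16) ^ 4 * (\<theta> / 16) ^ 4 \<le> pr (\<lambda>s. ev s \<and> ev (\<lambda>x. s (?r x)))"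
    by (rule pr_conj[OF fin loc_ev _ local_on_comp[OF loc_ev] inc_ev increasing_comp[OF inc_ev]])
      (use pev fin pr_comp[OF fin loc_ev automorphism_reflect] in auto)
  also have "\<dots> \<le> pr (link (2 * u))"
  proof (rule pr_mono[OF finite_square local_link])
    fix s assume "ev s \<and> ev (\<lambda>x. s (?r x))"
    then have 1: "conn ({x. s x} \<inter> {- 4 * u..4 * u} \<times> {- 6 * u..6 * u}) (0, 0) (u, a)"
      and "conn ({x. s (?r x)} \<inter> {- 4 * u..4 * u} \<times> {- 6 * u..6 * u}) (0, 0) (u, a)"
      by (auto simp: ev_def)
    then have 2: "conn ({x. s x} \<inter> square (3 * (2 * u))) (2 * u, 0) (u, a)"
      using conn_pullback[OF _ automorphism_reflect,
          of s "2 * u" "{- 4 * u..4 * u} \<times> {- 6 * u..6 * u}" "(0, 0)" "(u, a)" "square (3 * (2 * u))"]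
      by (fastforce simp: square_def)
    have "conn ({x. s x} \<inter> square (3 * (2 * u))) (0, 0) (u, a)"
      by (rule conn_mono[OF 1]) (use u(3) in \<open>auto simp: square_def\<close>)
    then show "link (2 * u) s" unfolding link_def using 2 conn_sym conn_trans by blast
  qed
  finally show ?thesis by (simp add: power2_eq_square)
qed

text \<open>Otherwise \<open>\<alpha>\<close> would double whenever its argument grows by a factor \<open>3/2\<close>.\<close>

lemma slow_growth:
  fixes \<alpha> :: "int \<Rightarrow> int"
  assumes "\<And>n. 0 \<le> n \<Longrightarrow> 0 \<le> \<alpha> n \<and> \<alpha> n \<le> n"
  shows "\<exists>t\<ge>N. \<alpha> (t + t div 2) \<le> 2 * \<alpha> t"
proof (rule ccontr)
  assume neg: "\<not> ?thesis"
  define T where "T k = ((\<lambda>t. t + t div 2) ^^ k) (max N 1)" for k :: nat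
  have T: "max N 1 \<le> T k \<and> real_of_int (T k) \<le> (3/2) ^ k * real_of_int (max N 1)" for k
  proof (induction k)
    case 0 show ?case by (simp add: T_def)
  next
    case (Suc k)
    have e: "T (Suc k) = T k + T k div 2" by (simp add: T_def)
    have "2 * (T k div 2) \<le> T k" by simp
    then have "real_of_int (2 * T (Suc k)) \<le> real_of_int (3 * T k)"
      unfolding e of_int_le_iff by (simp add: algebra_simps)
    moreover have "max N 1 \<le> T (Suc k)" using Suc e by auto
    ultimately show ?case using Suc by simp
  qed
  \<comment> \<open>The summand 1 turns the strict integer inequality
    \<open>2 * \<alpha> t < \<alpha> (t + t div 2)\<close> into genuine doubling, even from the
    value 0.\<close>
  have grow: "2 ^ k \<le> \<alpha> (T k) + 1" for k
  proof (induction k)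
    case 0
    show ?case using assms[of "T 0"] T[of 0] by auto
  next
    case (Suc k)
    have "2 * \<alpha> (T k) < \<alpha> (T k + T k div 2)" using neg T[of k] by fastforce
    moreover have "T (Suc k) = T k + T k div 2" by (simp add: T_def)
    ultimately show ?case using Suc by simp
  qed
  \<comment> \<open>Doubling beats the growth rate 3/2 of \<open>T\<close>: the powers of the
    quotient of 2 by 3/2 would have to stay bounded.\<close>
  have "(4/3) ^ k \<le> real_of_int (max N 1) + 1" for k :: nat
  proof -
    have "\<alpha> (T k) + 1 \<le> T k + 1" using assms[of "T k"] T[of k] by auto
    then have "2 ^ k \<le> T k + 1" using grow[of k] by linarith
    then have "real_of_int (2 ^ k) \<le> real_of_int (T k + 1)" by (simp only: of_int_le_iff)
    also have "\<dots> \<le> (3/2) ^ k * real_of_int (max N 1) + (3/2) ^ k"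
    proof -
      have "1 \<le> (3/2::real) ^ k" by (rule one_le_power) simp
      then show ?thesis using T[of k] unfolding of_int_add of_int_1 by linarith
    qed
    also have "\<dots> = (3/2) ^ k * (real_of_int (max N 1) + 1)" by (simp add: algebra_simps)
    finally have "2 ^ k \<le> (3/2) ^ k * (real_of_int (max N 1) + 1)" by simp
    moreover have "(2::real) ^ k = (3/2) ^ k * (4/3) ^ k" by (simp flip: power_mult_distrib)
    ultimately show ?thesis by simp
  qed
  moreover obtain k where "real_of_int (max N 1) + 1 < (4/3) ^ k"
    using real_arch_pow[of "4/3::real"] by auto
  ultimately show False by (meson not_less)
qed

lemma pr_blocking:
  assumes "c \<le> pr (link d)" "0 \<le> c" "0 < d"
  shows "c ^ 16 \<le> pr (blocking d)"
proof -
  let ?I = "{-8..7::int}"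
  let ?L = "\<lambda>i s. link d (\<lambda>x. s ((i * d, 4 * d) + x))"
  have loc: "local_on ((+) (i * d, 4 * d) ` square (3 * d)) (?L i)" for i
    by (rule local_on_comp[OF local_link])
  have "c ^ card ?I \<le> pr (\<lambda>s. \<forall>i\<in>?I. ?L i s)"
  proof (rule pr_ball[of _ "\<lambda>i. (+) (i * d, 4 * d) ` square (3 * d)"])
    fix i
    show "increasing (?L i)" by (rule increasing_comp[OF increasing_link])
    show "c \<le> pr (?L i)" using pr_comp[OF finite_square local_link automorphism_add(2)] assms(1) by simp
  qed (use loc assms(2) in auto)
  also have "\<dots> \<le> pr (blocking d)"
  proof (rule pr_mono[of "square (12 * d)"])
    show "local_on (square (12 * d)) (blocking d)"
      unfolding blocking_def [abs_def] by (rule local_on_conn) (use assms(3) in \<open>auto simp: square_def\<close>)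
  next
    fix s assume L: "\<forall>i\<in>?I. ?L i s"
    let ?G = "{x. s x} \<inter> {-11*d..11*d} \<times> {d..7*d}"
    have link_step: "conn ?G (i * d, 4 * d) ((i + 1) * d, 4 * d)" if "- 8 \<le> i" "i \<le> 7" for i
    proof -
      have "conn ({x. s ((i * d, 4 * d) + x)} \<inter> square (3 * d)) (0, 0) (d, 0)"
        using L that by (auto simp: link_def)
      moreover have "(+) (i * d, 4 * d) ` square (3 * d) \<subseteq> {-11*d..11*d} \<times> {d..7*d}"
      proof -
        have "- 8 * d \<le> i * d" "i * d \<le> 8 * d" using that assms(3) by (intro mult_right_mono; simp)+
        then show ?thesis using that by (auto simp: square_def)
      qed
      ultimately have "conn ?G ((i * d, 4 * d) + (0, 0)) ((i * d, 4 * d) + (d, 0))"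
        by (rule conn_pullback[OF _ automorphism_add(2)])
      then show ?thesis by (simp add: algebra_simps)
    qed
    have "conn ?G (- 8 * d, 4 * d) (i * d, 4 * d)" if "- 7 \<le> i" "i \<le> 8" for i
      using that
    proof (induction i rule: int_ge_induct)
      case base
      then show ?case using link_step[of "-8"] by simp
    next
      case (step i)
      have "conn ?G (- 8 * d, 4 * d) (i * d, 4 * d)" using step by simp
      moreover have "conn ?G (i * d, 4 * d) ((i + 1) * d, 4 * d)"
        by (rule link_step) (use step in auto)
      ultimately show ?case by (rule conn_trans)
    qed
    from this[of 8] show "blocking d s" by (simp add: blocking_def)
  qed simp
  finally show ?thesis by simp
qed

text \<open>Four reflected chains of sixteen links each give the exponent 64. An upper bound on the
  number of reflections suffices because \<open>c ^ 16 \<le> 1\<close>.\<close>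

lemma pr_circuit:
  assumes "c \<le> pr (link d)" "0 \<le> c" "c \<le> 1" "0 < d"
  shows "c ^ 64 \<le> pr (\<lambda>s. \<forall>f\<in>square_involutions. blocking d (\<lambda>x. s (f x)))"
proof -
  have loc: "local_on (square (12 * d)) (blocking d)"
    unfolding blocking_def [abs_def] by (rule local_on_conn) (use assms(4) in \<open>auto simp: square_def\<close>)
  have inc: "increasing (blocking d)" unfolding blocking_def [abs_def] by (rule increasing_conn)
  have fin: "finite square_involutions" and card: "card square_involutions \<le> 4"
    by (auto simp: square_involutions_def intro!: card_insert_le_m1)
  have "(c ^ 16) ^ 4 \<le> (c ^ 16) ^ card square_involutions"
    using assms card by (intro power_decreasing power_le_one) auto
  also have "\<dots> \<le> pr (\<lambda>s. \<forall>f\<in>square_involutions. blocking d (\<lambda>x. s (f x)))"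
  proof (rule pr_ball[OF fin, of "\<lambda>f. f ` square (12 * d)"])
    fix f :: "site \<Rightarrow> site" assume f: "f \<in> square_involutions"
    show "c ^ 16 \<le> pr (\<lambda>s. blocking d (\<lambda>x. s (f x)))"
      using pr_blocking[OF assms(1,2,4)] pr_comp[OF _ loc automorphism_square_involutions[OF f]] by simp
    show "increasing (\<lambda>s. blocking d (\<lambda>x. s (f x)))" by (rule increasing_comp[OF inc])
    show "finite (f ` square (12 * d)) \<and> local_on (f ` square (12 * d)) (\<lambda>s. blocking d (\<lambda>x. s (f x)))"
      using local_on_comp[OF loc] by simp
  qed (use assms in auto)
  finally show ?thesis by (simp flip: power_mult)
qed

text \<open>\<open>slow_growth\<close> supplies arbitrarily large \<open>t\<close> for which the
  splitting height at \<open>t + t div 2\<close> is at most twice the one at \<open>t\<close>; with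
  \<open>u = t div 2\<close> this is the interlacing condition of the gluing. The resulting \<kappa>
  depends on \<theta> only, not on the scale.\<close>

lemma frequent_circuits:
  assumes "0 < \<theta>" "\<And>n. 0 \<le> n \<Longrightarrow> \<theta> \<le> pr (arm n)"
  obtains \<kappa> where "0 < \<kappa>" "\<And>N. \<exists>d\<ge>N. 0 < d \<and>
    \<kappa> \<le> pr (\<lambda>s. \<forall>f\<in>square_involutions. blocking d (\<lambda>x. s (f x)))"
proof
  define c where "c = ((\<theta> / 16) ^ 4) ^ 2"
  have "\<theta> \<le> 1" using assms(2)[of 0] prob_le_1 unfolding pr_def by (meson order.trans order_refl)
  then have c: "0 < c" "c \<le> 1" using assms(1) unfolding c_def by (auto intro!: power_le_one)
  show "0 < c ^ 64" using c by simp
  obtain \<alpha> where \<alpha>: "\<And>n. 0 \<le> n \<Longrightarrow> 0 \<le> \<alpha> n \<and> \<alpha> n \<le> n \<and> \<theta> / 16 \<le> pr (side n (\<alpha> n) n) \<and>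
      \<theta> / 16 \<le> pr (side n 0 (\<alpha> n))"
    using splitting_height[OF _ assms(1) assms(2)] by metis
  fix N
  \<comment> \<open>The scale \<open>2 * (t div 2)\<close> may lose one to rounding, hence the
    summand 1; the maximum with 2 keeps \<open>t div 2\<close> positive.\<close>
  obtain t where t: "max N 2 + 1 \<le> t" "\<alpha> (t + t div 2) \<le> 2 * \<alpha> t"
    using slow_growth[of \<alpha> "max N 2 + 1"] \<alpha> by blast
  have "c \<le> pr (link (2 * (t div 2)))"
    unfolding c_def
    by (rule pr_link[OF assms, of "t div 2" t "\<alpha> t" "\<alpha> (t + t div 2)"])
      (use t \<alpha>[of t] \<alpha>[of "t + t div 2"] in auto)
  then have "c ^ 64 \<le> pr (\<lambda>s. \<forall>f\<in>square_involutions. blocking (2 * (t div 2)) (\<lambda>x. s (f x)))"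
    by (rule pr_circuit) (use c t in auto)
  moreover have "N \<le> 2 * (t div 2)" "0 < 2 * (t div 2)" using t by auto
  ultimately show "\<exists>d\<ge>N. 0 < d \<and> c ^ 64 \<le> pr (\<lambda>s. \<forall>f\<in>square_involutions. blocking d (\<lambda>x. s (f x)))"
    by blast
qed

end

declare split_paired_All [simp del] split_paired_Ex [simp del]

lemma local_on_not: "local_on W A \<Longrightarrow> local_on W (\<lambda>s. A (\<lambda>x. \<not> s x))"
  unfolding local_on_def by simp

lemma local_on_comp_image: "local_on W A \<Longrightarrow> f ` W \<subseteq> W' \<Longrightarrow> local_on W' (\<lambda>s. A (\<lambda>x. s (f x)))"
  by (rule local_on_mono[OF local_on_comp])

section \<open>Zero-one law and finiteness of clusters\<close>

definition cluster :: "(site \<Rightarrow> bool) \<Rightarrow> site \<Rightarrow> site set" where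
  "cluster s x = {y. conn {v. s v} x y}"

definition escapes :: "int \<Rightarrow> (site \<Rightarrow> bool) \<Rightarrow> site \<Rightarrow> bool" where
  "escapes N s x \<longleftrightarrow> (\<exists>y. on_sphere N y \<and> conn ({v. s v} \<inter> square N) x y)"

lemma square_mono: "m \<le> n \<Longrightarrow> square m \<subseteq> square n"
  by (auto simp: square_def)

lemma escapes_antimono:
  assumes "escapes N s x" "x \<in> square m" "m \<le> N"
  shows "escapes m s x"
proof (cases "m = N")
  case False
  from assms obtain y where y: "on_sphere N y" "conn ({v. s v} \<inter> square N) x y"
    unfolding escapes_def by blast
  have "y \<notin> square m" using y(1) assms(3) False by (auto simp: on_sphere_def square_def)
  then obtain w where "on_sphere m w" "conn ({v. s v} \<inter> square N \<inter> square m) x w"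
    using conn_exits_square[OF y(2) assms(2)] by blast
  moreover have "{v. s v} \<inter> square N \<inter> square m = {v. s v} \<inter> square m"
    using square_mono[OF assms(3)] by blast
  ultimately show ?thesis unfolding escapes_def by auto
qed (use assms in simp)

text \<open>A finite cluster fits strictly inside a square whose radius \<open>K\<close> exceeds the
  sum of the moduli of all its coordinates. The infinite event thereby becomes an intersection of
  local events.\<close>

lemma infinite_cluster_iff:
  assumes "x \<in> square k"
  shows "infinite (cluster s x) \<longleftrightarrow> (\<forall>n::nat. k \<le> int n \<longrightarrow> escapes (int n) s x)"
proof (intro iffI allI impI)
  fix n :: nat assume inf: "infinite (cluster s x)" and n: "k \<le> int n"
  have "\<not> cluster s x \<subseteq> square (int n)" using inf finite_subset finite_square by blast
  then obtain y where "conn {v. s v} x y" "y \<notin> square (int n)" by (auto simp: cluster_def)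
  moreover have "x \<in> square (int n)" using assms n square_mono by blast
  ultimately show "escapes (int n) s x" using conn_exits_square unfolding escapes_def by blast
next
  assume esc: "\<forall>n::nat. k \<le> int n \<longrightarrow> escapes (int n) s x"
  show "infinite (cluster s x)"
  proof
    assume fin: "finite (cluster s x)"
    define K where "K = nat (\<bar>k\<bar> + (\<Sum>y\<in>cluster s x. \<bar>fst y\<bar> + \<bar>snd y\<bar>) + 1)"
    have pos: "0 \<le> (\<Sum>y\<in>cluster s x. \<bar>fst y\<bar> + \<bar>snd y\<bar>)" by (intro sum_nonneg) auto
    have K: "int K = \<bar>k\<bar> + (\<Sum>y\<in>cluster s x. \<bar>fst y\<bar> + \<bar>snd y\<bar>) + 1" using pos by (simp add: K_def)
    have "k \<le> int K" using K pos by linarith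
    then have "escapes (int K) s x" using esc by blast
    then obtain y where y: "on_sphere (int K) y" "conn ({v. s v} \<inter> square (int K)) x y"
      unfolding escapes_def by blast
    have "y \<in> cluster s x" using y(2) conn_mono[of _ x y "{v. s v}"] unfolding cluster_def by blast
    then have "\<bar>fst y\<bar> + \<bar>snd y\<bar> \<le> (\<Sum>y\<in>cluster s x. \<bar>fst y\<bar> + \<bar>snd y\<bar>)"
      using fin by (intro member_le_sum) auto
    then show False using y(1) K by (auto simp: on_sphere_def)
  qed
qed

context planar_field
begin

lemma local_escapes: "local_on (square N) (\<lambda>s. escapes N s x)"
  unfolding escapes_def by (intro local_on_ex local_on_conn) auto

lemma flip_pr: "finite W \<Longrightarrow> local_on W A \<Longrightarrow> pr (\<lambda>s. A (\<lambda>x. \<not> s x)) = pr A"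
  unfolding pr_def by (rule flip_symmetry)

definition minus_escape :: "nat \<Rightarrow> nat \<Rightarrow> (site \<Rightarrow> bool) \<Rightarrow> bool" where
  "minus_escape k n s \<longleftrightarrow> (\<exists>x. x \<in> square (int k) \<and> escapes (int n) (\<lambda>v. \<not> s v) x)"

definition minus_infinite :: "nat \<Rightarrow> (site \<Rightarrow> bool) \<Rightarrow> bool" where
  "minus_infinite k s \<longleftrightarrow> (\<exists>x\<in>square (int k). infinite (cluster (\<lambda>v. \<not> s v) x))"

lemma local_minus_escape: "local_on (square (int n)) (minus_escape k n)"
  unfolding minus_escape_def [abs_def] by (intro local_on_ex local_on_not[OF local_escapes])

text \<open>Among the finitely many sites of the square one must serve as starting point for
  infinitely many radii, and escaping to a larger radius implies escaping to every smaller one whose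
  square contains the start.\<close>

lemma minus_infinite_iff: "minus_infinite k s \<longleftrightarrow> (\<forall>i. minus_escape k (k + i) s)"
proof
  assume "minus_infinite k s"
  then obtain x where x: "x \<in> square (int k)" "infinite (cluster (\<lambda>v. \<not> s v) x)"
    unfolding minus_infinite_def by blast
  then show "\<forall>i. minus_escape k (k + i) s"
    unfolding minus_escape_def infinite_cluster_iff[OF x(1)] using le_add1 of_nat_mono by blast
next
  assume esc: "\<forall>i. minus_escape k (k + i) s"
  then obtain X where X: "\<And>i. X i \<in> square (int k) \<and> escapes (int (k + i)) (\<lambda>v. \<not> s v) (X i)"
    unfolding minus_escape_def by metis
  have "finite (range X)" by (rule finite_subset[OF _ finite_square[of "int k"]]) (use X in blast)
  then obtain x where x: "x \<in> range X" "infinite (X -` {x})"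
    using inf_img_fin_domE[of X UNIV] by auto
  have xs: "x \<in> square (int k)" using x X by auto
  have "escapes (int n) (\<lambda>v. \<not> s v) x" if n: "int k \<le> int n" for n
  proof -
    obtain i where i: "n < i" "X i = x" using x(2) unfolding infinite_nat_iff_unbounded by auto
    have "x \<in> square (int n)" using xs n square_mono by blast
    moreover have "escapes (int (k + i)) (\<lambda>v. \<not> s v) x" using X[of i] i by auto
    ultimately show ?thesis using escapes_antimono i(1) by auto
  qed
  then show "minus_infinite k s"
    unfolding minus_infinite_def using infinite_cluster_iff[OF xs] xs by blast
qed

lemma minus_infinite_event: "{\<omega>\<in>space M. minus_infinite k (\<sigma> \<omega>)} \<in> events"
proof -
  have "{\<omega>\<in>space M. minus_infinite k (\<sigma> \<omega>)} = (\<Inter>i. {\<omega>\<in>space M. minus_escape k (k + i) (\<sigma> \<omega>)})"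
    by (auto simp: minus_infinite_iff)
  also have "\<dots> \<in> events"
    by (rule sets.countable_INT) (use local_event[OF finite_square local_minus_escape] in auto)
  finally show ?thesis .
qed

lemma minus_escape_Suc: "minus_escape k (k + Suc i) s \<Longrightarrow> minus_escape k (k + i) s"
  unfolding minus_escape_def
  using escapes_antimono[of "int (k + Suc i)" _ _ "int (k + i)"] square_mono[of "int k" "int (k + i)"]
  by fastforce

text \<open>Translates of the event are needed for the zero-one law.\<close>

lemma minus_infinite_limit:
  assumes "automorphism f"
  shows "{\<omega>\<in>space M. minus_infinite k (\<lambda>x. \<sigma> \<omega> (f x))} \<in> events"
    and "(\<lambda>i. pr (minus_escape k (k + i))) \<longlonglongrightarrow> prob {\<omega>\<in>space M. minus_infinite k (\<lambda>x. \<sigma> \<omega> (f x))}"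
proof -
  let ?E = "\<lambda>i. {\<omega>\<in>space M. minus_escape k (k + i) (\<lambda>x. \<sigma> \<omega> (f x))}"
  have loc: "local_on (f ` square (int (k + i))) (\<lambda>s. minus_escape k (k + i) (\<lambda>x. s (f x)))" for i
    by (rule local_on_comp[OF local_minus_escape])
  have eq: "{\<omega>\<in>space M. minus_infinite k (\<lambda>x. \<sigma> \<omega> (f x))} = (\<Inter>i. ?E i)"
    by (auto simp: minus_infinite_iff)
  have ev: "?E i \<in> events" for i using local_event[OF _ loc] by simp
  then show "{\<omega>\<in>space M. minus_infinite k (\<lambda>x. \<sigma> \<omega> (f x))} \<in> events"
    unfolding eq by (intro sets.countable_INT) auto
  have "(\<lambda>i. prob (?E i)) \<longlonglongrightarrow> prob (\<Inter>i. ?E i)"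
    by (rule finite_Lim_measure_decseq) (use ev minus_escape_Suc in \<open>auto simp: decseq_Suc_iff\<close>)
  moreover have "prob (?E i) = pr (minus_escape k (k + i))" for i
    using pr_comp[OF finite_square local_minus_escape assms] by (simp add: pr_def)
  ultimately show "(\<lambda>i. pr (minus_escape k (k + i)))
      \<longlonglongrightarrow> prob {\<omega>\<in>space M. minus_infinite k (\<lambda>x. \<sigma> \<omega> (f x))}"
    unfolding eq by simp
qed

abbreviation minus_percolates :: "'a set" where
  "minus_percolates \<equiv> (\<Union>k. {\<omega>\<in>space M. minus_infinite k (\<sigma> \<omega>)})"

lemma prob_minus_percolates: "(\<lambda>k. prob {\<omega>\<in>space M. minus_infinite k (\<sigma> \<omega>)}) \<longlonglongrightarrow> prob minus_percolates"
proof (rule finite_Lim_measure_incseq)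
  have "minus_infinite k s \<Longrightarrow> minus_infinite (Suc k) s" for k s
    unfolding minus_infinite_def using square_mono[of "int k" "int (Suc k)"] by fastforce
  then show "incseq (\<lambda>k. {\<omega>\<in>space M. minus_infinite k (\<sigma> \<omega>)})"
    by (auto simp: incseq_Suc_iff)
qed (use minus_infinite_event in auto)

lemma translate_infinite_cluster:
  assumes "infinite (cluster (\<lambda>v. s (v + z)) x)"
  shows "infinite (cluster s (x + z))"
proof -
  have "(\<lambda>v. v + z) ` cluster (\<lambda>v. s (v + z)) x \<subseteq> cluster s (x + z)"
  proof
    fix v assume "v \<in> (\<lambda>v. v + z) ` cluster (\<lambda>v. s (v + z)) x"
    then obtain y where y: "v = y + z" "conn {v. s (v + z)} x y" by (auto simp: cluster_def)
    have "conn {v. s v} (x + z) (y + z)"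
      by (rule conn_image[OF y(2)]) (auto simp: z2_adj_def)
    then show "v \<in> cluster s (x + z)" by (simp add: cluster_def y)
  qed
  moreover have "infinite ((\<lambda>v. v + z) ` cluster (\<lambda>v. s (v + z)) x)"
    using assms by (subst finite_image_iff) auto
  ultimately show ?thesis using finite_subset by blast
qed

text \<open>Percolation is translation invariant but not local. Up to \<epsilon> it is some
  \<open>minus_infinite k\<close>, which lies in the local event \<open>?A\<close>. That event and
  its translate both sit inside \<open>minus_percolates\<close>, so they intersect with probability
  at least \<open>a - 2 * \<epsilon>\<close> for every shift, whereas mixing takes the probability
  of \<open>?A\<close> together with its translate to at most
  \<open>(a + \<epsilon>) ^ 2\<close>.\<close>

lemma minus_percolates_zero_one: "prob minus_percolates \<le> (prob minus_percolates)\<^sup>2"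
proof (rule field_le_epsilon)
  define a where "a = prob minus_percolates"
  have a: "0 \<le> a" "a \<le> 1" by (simp_all add: a_def)
  fix e :: real assume "0 < e"
  \<comment> \<open>The intersection loses 2 \<epsilon> and the expansion of the square 3
    \<epsilon>, the latter by \<epsilon> \<le> 1.\<close>
  define \<epsilon> where "\<epsilon> = min (e / 5) 1"
  have \<epsilon>: "0 < \<epsilon>" "\<epsilon> \<le> 1" "5 * \<epsilon> \<le> e" using \<open>0 < e\<close> by (auto simp: \<epsilon>_def)
  let ?I = "\<lambda>k. {\<omega>\<in>space M. minus_infinite k (\<sigma> \<omega>)}"
  have perc: "minus_percolates \<in> events" using minus_infinite_event by blast
  obtain k where k: "a - \<epsilon> < prob (?I k)"
    using order_tendstoD(1)[OF prob_minus_percolates, of "a - \<epsilon>"] \<epsilon>(1)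
    unfolding a_def by (auto dest: eventually_happens)
  have "prob (?I k) \<le> a" unfolding a_def by (rule finite_measure_mono[OF _ perc]) blast
  then obtain i where i: "pr (minus_escape k (k + i)) < a + \<epsilon>"
    using order_tendstoD(2)[OF minus_infinite_limit(2)[of "\<lambda>x. x" k], of "a + \<epsilon>"] \<epsilon>(1)
      automorphism_square_involutions[of "\<lambda>x. x"]
    by (auto simp: square_involutions_def dest: eventually_happens)
  let ?A = "minus_escape k (k + i)"
  have "a - 2 * \<epsilon> \<le> prob {\<omega>\<in>space M. ?A (\<sigma> \<omega>) \<and> ?A (\<lambda>x. \<sigma> \<omega> (x + (int n, 0)))}" for n
  proof -
    let ?z = "(int n, 0::int)"
    let ?J = "{\<omega>\<in>space M. minus_infinite k (\<lambda>x. \<sigma> \<omega> (x + ?z))}"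
    have J: "?J \<in> events" "prob ?J = prob (?I k)"
      using minus_infinite_limit[OF automorphism_add(1), of k ?z] minus_infinite_limit(2)[of "\<lambda>x. x" k]
        automorphism_square_involutions[of "\<lambda>x. x"] LIMSEQ_unique by (auto simp: square_involutions_def)
    have "?J \<subseteq> minus_percolates"
    proof safe
      fix \<omega> assume "\<omega> \<in> space M" "minus_infinite k (\<lambda>x. \<sigma> \<omega> (x + ?z))"
      then obtain x where "infinite (cluster (\<lambda>v. \<not> \<sigma> \<omega> (v + ?z)) x)"
        unfolding minus_infinite_def by blast
      then have "infinite (cluster (\<lambda>v. \<not> \<sigma> \<omega> v) (x + ?z))"
        by (rule translate_infinite_cluster[where s = "\<lambda>v. \<not> \<sigma> \<omega> v"])
      moreover have "x + ?z \<in> square (int (nat (\<bar>fst (x + ?z)\<bar> + \<bar>snd (x + ?z)\<bar>)))"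
        by (cases x) (auto simp: square_def)
      ultimately have "minus_infinite (nat (\<bar>fst (x + ?z)\<bar> + \<bar>snd (x + ?z)\<bar>)) (\<sigma> \<omega>)"
        unfolding minus_infinite_def by blast
      then show "\<omega> \<in> minus_percolates" using \<open>\<omega> \<in> space M\<close> by blast
    qed
    then have "prob (?I k \<union> ?J) \<le> a"
      unfolding a_def by (intro finite_measure_mono[OF _ perc]) blast
    moreover have "prob (?I k \<union> ?J) = prob (?I k) + prob ?J - prob (?I k \<inter> ?J)"
      using finite_measure_Union'[OF minus_infinite_event J(1)] finite_measure_Diff'[OF J(1) minus_infinite_event]
      by (simp add: Int_commute)
    ultimately have "a - 2 * \<epsilon> \<le> prob (?I k \<inter> ?J)" using k J(2) by linarith
    also have "\<dots> \<le> prob {\<omega>\<in>space M. ?A (\<sigma> \<omega>) \<and> ?A (\<lambda>x. \<sigma> \<omega> (x + ?z))}"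
    proof (rule finite_measure_mono)
      have "local_on (square (int (k + i)) \<union> (\<lambda>x. x + ?z) ` square (int (k + i)))
          (\<lambda>s. ?A s \<and> ?A (\<lambda>x. s (x + ?z)))"
        by (intro local_on_conj local_on_comp_image[OF local_minus_escape] local_on_mono[OF local_minus_escape])
          auto
      from local_event[OF _ this]
      show "{\<omega>\<in>space M. ?A (\<sigma> \<omega>) \<and> ?A (\<lambda>x. \<sigma> \<omega> (x + ?z))} \<in> events" by simp
    qed (auto simp: minus_infinite_iff)
    finally show ?thesis .
  qed
  then have "a - 2 * \<epsilon> \<le> (pr ?A)\<^sup>2"
    using mixing[OF finite_square local_minus_escape local_minus_escape, of k "k + i" k]
    unfolding pr_def power2_eq_square by (intro LIMSEQ_le_const) auto
  also have "\<dots> \<le> (a + \<epsilon>)\<^sup>2" using i by (intro power_mono) auto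
  also have "\<dots> \<le> a\<^sup>2 + 3 * \<epsilon>"
  proof -
    have "2 * a * \<epsilon> \<le> 2 * \<epsilon>" "\<epsilon> * \<epsilon> \<le> \<epsilon>" using a \<epsilon> by (auto intro: mult_left_le_one_le)
    then show ?thesis by (simp add: power2_eq_square algebra_simps)
  qed
  finally show "a \<le> a\<^sup>2 + e" using \<epsilon>(3) by linarith
qed

text \<open>If arms kept probability \<theta>, the sign flip would let the minus sign percolate with
  probability at least \<theta>, hence 1 by the zero-one inequality. The same arms build plus
  circuits around \<open>square (int k)\<close> with probability at least \<kappa> at some scale
  \<open>d\<close>, so each \<open>minus_infinite k\<close> has probability at most
  \<open>1 - \<kappa>\<close>, and so does their increasing union.\<close>

lemma arm_vanishes:
  assumes "0 < \<theta>"
  shows "\<exists>n\<ge>0. pr (arm n) < \<theta>"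
proof (rule ccontr)
  assume "\<not> ?thesis"
  then have arm: "\<And>n. 0 \<le> n \<Longrightarrow> \<theta> \<le> pr (arm n)" by (meson not_less)
  let ?P = "minus_percolates"
  let ?I = "\<lambda>k. {\<omega>\<in>space M. minus_infinite k (\<sigma> \<omega>)}"
  have perc: "?P \<in> events" using minus_infinite_event by blast
  have "\<theta> \<le> prob ?P"
  proof -
    have "\<theta> \<le> pr (minus_escape 0 (0 + i))" for i
    proof -
      have "\<theta> \<le> pr (\<lambda>s. arm (int i) (\<lambda>x. \<not> s x))"
        using arm[of "int i"] flip_pr[OF finite_square local_arm] by simp
      also have "\<dots> \<le> pr (minus_escape 0 (0 + i))"
        by (rule pr_mono[OF finite_square local_minus_escape])
          (auto simp: arm_def minus_escape_def escapes_def square_def)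
      finally show ?thesis .
    qed
    then have "\<theta> \<le> prob (?I 0)"
      using minus_infinite_limit(2)[of "\<lambda>x. x" 0] automorphism_square_involutions[of "\<lambda>x. x"]
      by (intro LIMSEQ_le_const) (auto simp: square_involutions_def)
    also have "\<dots> \<le> prob ?P" by (rule finite_measure_mono[OF _ perc]) blast
    finally show ?thesis .
  qed
  then have "0 < prob ?P" using assms by linarith
  then have one: "1 \<le> prob ?P" using minus_percolates_zero_one by (simp add: power2_eq_square)
  obtain \<kappa> where \<kappa>: "0 < \<kappa>" "\<And>N. \<exists>d\<ge>N. 0 < d \<and>
      \<kappa> \<le> pr (\<lambda>s. \<forall>f\<in>square_involutions. blocking d (\<lambda>x. s (f x)))"
    using frequent_circuits[OF assms arm] by blast
  have "prob (?I k) \<le> 1 - \<kappa>" for k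
  proof -
    obtain d where d: "int k \<le> d" "0 < d"
      and c: "\<kappa> \<le> pr (\<lambda>s. \<forall>f\<in>square_involutions. blocking d (\<lambda>x. s (f x)))"
      using \<kappa>(2) by blast
    let ?O = "{\<omega>\<in>space M. \<forall>f\<in>square_involutions. blocking d (\<lambda>x. \<sigma> \<omega> (f x))}"
    have "local_on (\<Union>f\<in>square_involutions. f ` square (12 * d)) (\<lambda>s. \<forall>f\<in>square_involutions. blocking d (\<lambda>x. s (f x)))"
    proof (rule local_on_ball)
      fix f :: "site \<Rightarrow> site" assume f: "f \<in> square_involutions"
      have "local_on (square (12 * d)) (blocking d)"
        unfolding blocking_def [abs_def] by (rule local_on_conn) (use d in \<open>auto simp: square_def\<close>)
      then show "local_on (\<Union>f\<in>square_involutions. f ` square (12 * d)) (\<lambda>s. blocking d (\<lambda>x. s (f x)))"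
        by (rule local_on_comp_image) (use f in blast)
    qed
    then have O: "?O \<in> events" by (rule local_event[rotated]) (simp add: square_involutions_def)
    have "?I k \<subseteq> space M - ?O"
    proof safe
      fix \<omega> assume inf: "minus_infinite k (\<sigma> \<omega>)"
        and bl: "\<forall>f\<in>square_involutions. blocking d (\<lambda>x. \<sigma> \<omega> (f x))"
      obtain x where x: "x \<in> square (int k)" "infinite (cluster (\<lambda>v. \<not> \<sigma> \<omega> v) x)"
        using inf unfolding minus_infinite_def by blast
      moreover have "int k \<le> int (nat (7 * d))" using d by simp
      ultimately have "escapes (int (nat (7 * d))) (\<lambda>v. \<not> \<sigma> \<omega> v) x"
        using infinite_cluster_iff[OF x(1)] by blast
      then obtain y where "on_sphere (7 * d) y" "conn ({v. \<not> \<sigma> \<omega> v} \<inter> square (7 * d)) x y"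
        using d(2) unfolding escapes_def by auto
      moreover have "x \<in> square d" using x(1) d(1) square_mono by blast
      ultimately show False using blocking_circuit[OF bl _ d(2)] by blast
    qed
    then have "prob (?I k) \<le> prob (space M - ?O)" using O by (intro finite_measure_mono) auto
    also have "\<dots> \<le> 1 - \<kappa>" using c prob_compl[OF O] by (simp add: pr_def)
    finally show ?thesis .
  qed
  then have "prob ?P \<le> 1 - \<kappa>" using prob_minus_percolates by (intro LIMSEQ_le_const2) auto
  then show False using one \<kappa>(1) by linarith
qed

text \<open>After translating \<open>x\<close> to the origin, an infinite cluster produces an arm at
  every radius. The map \<open>g\<close> treats both signs at once, the negated one by flip
  symmetry.\<close>

theorem AE_finite_clusters: "AE \<omega> in M. \<forall>x. finite (cluster (\<sigma> \<omega>) x) \<and> finite (cluster (\<lambda>v. \<not> \<sigma> \<omega> v) x)"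
proof -
  have fin: "AE \<omega> in M. finite (cluster (g (\<sigma> \<omega>)) x)" if g: "g = (\<lambda>s. s) \<or> g = (\<lambda>s v. \<not> s v)" for g x
  proof -
    let ?A = "\<lambda>n s. arm (int n) (\<lambda>v. s (v + x))"
    let ?N = "\<Inter>n. {\<omega>\<in>space M. ?A n (g (\<sigma> \<omega>))}"
    have loc: "local_on ((\<lambda>v. v + x) ` square (int n)) (?A n)" for n by (rule local_on_comp[OF local_arm])
    have locg: "local_on ((\<lambda>v. v + x) ` square (int n)) (\<lambda>s. ?A n (g s))" for n
      using g loc local_on_not by auto
    have ev: "{\<omega>\<in>space M. ?A n (g (\<sigma> \<omega>))} \<in> events" for n
      using local_event[OF _ locg] by simp
    then have N: "?N \<in> events" by (intro sets.countable_INT) auto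
    have "prob ?N \<le> \<theta>" if \<theta>: "0 < \<theta>" for \<theta>
    proof -
      obtain n where n: "pr (arm (int n)) < \<theta>"
        using arm_vanishes[OF \<theta>] nonneg_int_cases by metis
      have "prob ?N \<le> prob {\<omega>\<in>space M. ?A n (g (\<sigma> \<omega>))}"
        by (rule finite_measure_mono[OF _ ev]) blast
      also have "\<dots> = pr (\<lambda>s. ?A n (g s))" by (simp add: pr_def)
      also have "\<dots> = pr (?A n)" using g flip_pr[OF _ loc] by auto
      also have "\<dots> = pr (arm (int n))"
        by (rule pr_comp[OF finite_square local_arm automorphism_add(1)])
      finally show ?thesis using n by simp
    qed
    then have "prob ?N \<le> 0" by (meson field_le_epsilon add_0 dense_ge)
    then have "prob ?N = 0" by (simp add: antisym)
    then have "AE \<omega> in M. \<omega> \<notin> ?N" using N prob_eq_0 by blast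
    with AE_space[of M] show ?thesis
    proof eventually_elim
      case (elim \<omega>)
      show ?case
      proof (rule ccontr)
      assume w: "infinite (cluster (g (\<sigma> \<omega>)) x)"
      have "infinite (cluster (\<lambda>v. g (\<sigma> \<omega>) (v + x)) (x + - x))"
        by (rule translate_infinite_cluster) (use w in simp)
      then have "infinite (cluster (\<lambda>v. g (\<sigma> \<omega>) (v + x)) (0, 0))" by (simp add: zero_prod_def)
      moreover have "(0, 0) \<in> square 0" by (simp add: square_def)
      ultimately have "escapes (int n) (\<lambda>v. g (\<sigma> \<omega>) (v + x)) (0, 0)" for n
        using infinite_cluster_iff by auto
      then show False using elim by (auto simp: arm_def escapes_def)
      qed
    qed
  qed
  have "AE \<omega> in M. \<forall>x. finite (cluster (\<sigma> \<omega>) x)" using fin[of "\<lambda>s. s"] by (subst AE_all_countable) auto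
  moreover have "AE \<omega> in M. \<forall>x. finite (cluster (\<lambda>v. \<not> \<sigma> \<omega> v) x)"
    using fin[of "\<lambda>s v. \<not> s v"] by (subst AE_all_countable) auto
  ultimately show ?thesis by eventually_elim blast
qed

end

section \<open>The parallel median dynamics\<close>

lemma sorted_nth_le_iff:
  fixes xs :: "'b::linorder list"
  assumes "sorted xs" "k < length xs"
  shows "xs ! k \<le> p \<longleftrightarrow> k < length (filter (\<lambda>v. v \<le> p) xs)"
  using assms
proof (induction xs arbitrary: k)
  case (Cons x xs)
  show ?case
  proof (cases "x \<le> p")
    case True
    then show ?thesis using Cons by (cases k) auto
  next
    case False
    then have "\<forall>v\<in>set (x # xs). \<not> v \<le> p" using Cons.prems(1) by auto
    moreover from this have "filter (\<lambda>v. v \<le> p) (x # xs) = []" by (simp add: filter_empty_conv)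
    ultimately show ?thesis using Cons.prems(2) nth_mem[of k "x # xs"] by auto
  qed
qed simp

lemma median_le_iff:
  assumes "A \<noteq> {#}"
  shows "median A \<le> p \<longleftrightarrow> size A div 2 < size (filter_mset (\<lambda>v. v \<le> p) A)"
proof -
  let ?xs = "sorted_list_of_multiset A"
  have m: "mset ?xs = A" by simp
  then have len: "length ?xs = size A" by (metis size_mset)
  have "length (filter (\<lambda>v. v \<le> p) ?xs) = size (filter_mset (\<lambda>v. v \<le> p) A)"
    by (metis m mset_filter size_mset)
  moreover have "size A div 2 < length ?xs" using assms len by (simp add: nonempty_has_size)
  ultimately show ?thesis unfolding median_def by (subst sorted_nth_le_iff) auto
qed

lemma median_in: "A \<noteq> {#} \<Longrightarrow> median A \<in># A"
proof -
  assume "A \<noteq> {#}"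
  have "mset (sorted_list_of_multiset A) = A" by simp
  then have "length (sorted_list_of_multiset A) = size A" by (metis size_mset)
  then have "size A div 2 < length (sorted_list_of_multiset A)"
    using \<open>A \<noteq> {#}\<close> by (simp add: nonempty_has_size)
  then show ?thesis unfolding median_def using nth_mem set_sorted_list_of_multiset by metis
qed

abbreviation nb :: "site \<Rightarrow> site set" where
  "nb \<equiv> nbhd z2_adj"

lemma nb_eq: "nb x = {x, (fst x + 1, snd x), (fst x - 1, snd x), (fst x, snd x + 1), (fst x, snd x - 1)}"
  using nbhd_z2[of "fst x" "snd x"] by simp

lemma finite_nb [simp]: "finite (nb x)"
  by (simp add: nb_eq)

lemma card_nb: "card (nb x) = 5"
  by (cases x) (simp add: nb_eq)

definition med :: "(site \<Rightarrow> real) \<Rightarrow> site \<Rightarrow> real" where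
  "med v x = median (image_mset v (mset_set (nb x)))"

definition maj :: "(site \<Rightarrow> bool) \<Rightarrow> site \<Rightarrow> bool" where
  "maj s x \<longleftrightarrow> 3 \<le> card {z\<in>nb x. s z}"

lemma med_cong: "(\<And>z. z \<in> nb x \<Longrightarrow> v z = w z) \<Longrightarrow> med v x = med w x"
  unfolding med_def by (intro arg_cong[of _ _ median] image_mset_cong) simp

lemma maj_cong: "(\<And>z. z \<in> nb x \<Longrightarrow> s z = s' z) \<Longrightarrow> maj s x = maj s' x"
  unfolding maj_def by (metis (no_types, lifting) Collect_cong)

lemma med_in: "med v x \<in> v ` nb x"
proof -
  have "image_mset v (mset_set (nb x)) \<noteq> {#}" by (simp add: mset_set_empty_iff nb_eq)
  from median_in[OF this] show ?thesis by (simp add: med_def)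
qed

text \<open>A median is at most \<open>p\<close> exactly when more than half of the entries are.
  Thus every level set evolves on its own by majority, and a question about real values becomes one
  about spins at each level.\<close>

lemma med_le_iff: "med v x \<le> p \<longleftrightarrow> maj (\<lambda>z. v z \<le> p) x"
proof -
  have ne: "image_mset v (mset_set (nb x)) \<noteq> {#}" by (simp add: mset_set_empty_iff nb_eq)
  have "size (filter_mset (\<lambda>u. u \<le> p) (image_mset v (mset_set (nb x)))) = card {z\<in>nb x. v z \<le> p}"
    by (simp add: filter_mset_image_mset filter_mset_mset_set)
  then show ?thesis unfolding med_def maj_def median_le_iff[OF ne] by (auto simp: card_nb)
qed

text \<open>Parallel updating in discrete time; \<open>B k x\<close> tells whether \<open>x\<close> is updated in step \<open>k\<close>.\<close>

fun pca :: "((site \<Rightarrow> 'b) \<Rightarrow> site \<Rightarrow> 'b) \<Rightarrow> (site \<Rightarrow> 'b) \<Rightarrow> (nat \<Rightarrow> site \<Rightarrow> bool) \<Rightarrow> nat \<Rightarrow> site \<Rightarrow> 'b" where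
  "pca F u B 0 = u"
| "pca F u B (Suc k) = (\<lambda>x. if B k x then F (pca F u B k) x else pca F u B k x)"

lemma pca_threshold: "(pca med u B k x \<le> p) = pca maj (\<lambda>x. u x \<le> p) B k x"
  by (induction k arbitrary: x) (auto simp: med_le_iff)

text \<open>An update copies a value and never creates one; this is what will make the limit one of
  the countably many initial values.\<close>

lemma pca_med_range: "pca med u B k x \<in> range u"
proof (induction k arbitrary: x)
  case (Suc k)
  have "med (pca med u B k) x \<in> range u"
    using med_in[of "pca med u B k" x] Suc by (metis (no_types, lifting) imageE)
  then show ?case using Suc[of x] by simp
qed simp

lemma pca_idle:
  assumes "\<And>k. i \<le> k \<Longrightarrow> k < j \<Longrightarrow> \<not> B k x" "i \<le> j"
  shows "pca F u B j x = pca F u B i x"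
  using assms(2,1)
proof (induction j rule: dec_induct)
  case (step n)
  have "\<not> B n x" "pca F u B n x = pca F u B i x" using step by auto
  then show ?case by simp
qed simp

text \<open>Mesh intervals are open on the left, so a ring at \<open>s > 0\<close> belongs to step
  \<open>nat \<lceil>s * 2 ^ m\<rceil> - 1\<close> and has taken effect in the configuration with
  index \<open>nat \<lceil>s * 2 ^ m\<rceil>\<close>.\<close>

definition ring_bit :: "(site \<Rightarrow> real set) \<Rightarrow> nat \<Rightarrow> nat \<Rightarrow> site \<Rightarrow> bool" where
  "ring_bit C m k x \<longleftrightarrow> C x \<inter> {real k / 2 ^ m <.. real (Suc k) / 2 ^ m} \<noteq> {}"

text \<open>The start index lies just after the step of a possible ring at \<open>a\<close>, and
  \<open>j < b * 2 ^ m\<close> stops before the step of a possible ring at \<open>b\<close>; in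
  between only rings strictly inside the gap could act.\<close>

lemma pca_gap:
  assumes "C y \<inter> {a<..<b} = {}" "0 \<le> a" "nat \<lceil>a * 2 ^ m\<rceil> \<le> j" "real j < b * 2 ^ m"
  shows "pca F u (ring_bit C m) j y = pca F u (ring_bit C m) (nat \<lceil>a * 2 ^ m\<rceil>) y"
proof (rule pca_idle[OF _ assms(3)])
  fix k assume k: "nat \<lceil>a * 2 ^ m\<rceil> \<le> k" "k < j"
  have "a * 2 ^ m \<le> real k" using k(1) by linarith
  then have "a \<le> real k / 2 ^ m" by (simp add: field_simps)
  moreover have "real (Suc k) < b * 2 ^ m" using k(2) assms(4) by linarith
  then have "real (Suc k) / 2 ^ m < b" by (simp add: field_simps)
  ultimately have "{real k / 2 ^ m <.. real (Suc k) / 2 ^ m} \<subseteq> {a<..<b}" by auto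
  then show "\<not> ring_bit C m k y" using assms(1) unfolding ring_bit_def by blast
qed

lemma eventually_fine: "0 < (\<epsilon>::real) \<Longrightarrow> \<forall>\<^sub>F m in sequentially. 1 < \<epsilon> * 2 ^ m"
proof -
  assume "0 < \<epsilon>"
  obtain N where N: "1 / \<epsilon> < 2 ^ N" using real_arch_pow[of "2::real"] by auto
  have "1 < \<epsilon> * 2 ^ m" if "N \<le> m" for m
  proof -
    have "1 < \<epsilon> * 2 ^ N" using N \<open>0 < \<epsilon>\<close> by (simp add: field_simps)
    also have "\<dots> \<le> \<epsilon> * 2 ^ m" using that \<open>0 < \<epsilon>\<close> by (intro mult_left_mono power_increasing) auto
    finally show ?thesis .
  qed
  then show ?thesis by (auto simp: eventually_sequentially)
qed

text \<open>Well-foundedness of the dependence of a ring on earlier rings in its neighbourhood.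
  Since \<open>x \<in> nb x\<close>, repeated rings at one site are links of such chains
  too.\<close>

definition no_chain :: "(site \<Rightarrow> real set) \<Rightarrow> bool" where
  "no_chain C \<longleftrightarrow> (\<nexists>xs ts. \<forall>i::nat. ts i \<in> C (xs i) \<and> ts (Suc i) < ts i \<and> xs (Suc i) \<in> nb (xs i))"

section \<open>Exactness of fine meshes for one realization\<close>

context
  fixes C :: "site \<Rightarrow> real set" and f :: "real \<Rightarrow> site \<Rightarrow> real"
  assumes path: "median_path z2_adj C f"
    and pos: "\<And>x. C x \<subseteq> {0<..}" and fin: "\<And>x t. finite (C x \<inter> {..t})"
    and chain: "no_chain C"
begin

lemma last_ring:
  assumes "0 < t"
  obtains a where "0 \<le> a" "a < t" "a = 0 \<or> a \<in> C y" "C y \<inter> {a<..<t} = {}"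
proof
  let ?S = "insert 0 (C y \<inter> {..<t})"
  have "C y \<inter> {..<t} \<subseteq> C y \<inter> {..t}" by auto
  then have finS: "finite ?S" using finite_subset fin by blast
  have mem: "Max ?S \<in> ?S" using finS by (intro Max_in) auto
  then show "Max ?S = 0 \<or> Max ?S \<in> C y" "Max ?S < t" "0 \<le> Max ?S" using assms pos[of y] by auto
  show "C y \<inter> {Max ?S<..<t} = {}" using Max_ge[OF finS] by fastforce
qed

lemma constant_between:
  assumes "C y \<inter> {a<..<b} = {}" "0 \<le> a" "a \<le> t" "t < b"
  shows "f t y = f a y"
proof -
  have "C y \<inter> {a<..t} = {}" using assms by auto
  then show ?thesis using path assms unfolding median_path_def by blast
qed

lemma gap_after:
  obtains \<epsilon> where "0 < \<epsilon>" "C y \<inter> {t<..<t + \<epsilon>} = {}"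
proof -
  let ?S = "insert (t + 1) (C y \<inter> {t<..t + 1})"
  have "C y \<inter> {t<..t + 1} \<subseteq> C y \<inter> {..t + 1}" by auto
  then have finS: "finite ?S" using finite_subset fin by blast
  have mem: "Min ?S \<in> ?S" using finS by (intro Min_in) auto
  have "C y \<inter> {t<..<Min ?S} = {}"
  proof safe
    fix r assume r: "r \<in> C y" "r \<in> {t<..<Min ?S}"
    have "Min ?S \<le> t + 1" using finS by simp
    then have "r \<in> ?S" using r by auto
    then have "Min ?S \<le> r" using finS by (intro Min_le)
    then show "r \<in> {}" using r by auto
  qed
  then show ?thesis using that[of "Min ?S - t"] mem by auto
qed

lemma ring_rule:
  "s \<in> C x \<Longrightarrow> f s x = median {# Lim (at_left s) (\<lambda>t. f t z). z \<in># mset_set (nb x) #}"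
  using path unfolding median_path_def by blast

text \<open>Induction over rings along the relation to earlier rings in the neighbourhood. Just
  before \<open>s\<close> each neighbour still has the value of its last ring, or its initial value;
  this is exact by induction, once the mesh separates that ring from \<open>s\<close>. Simultaneous
  rings agree as well, since a parallel step reads the previous configuration just as the path rule
  reads left limits.\<close>

lemma pca_at_ring:
  assumes "s \<in> C x"
  shows "\<forall>\<^sub>F m in sequentially. pca med (f 0) (ring_bit C m) (nat \<lceil>s * 2 ^ m\<rceil>) x = f s x"
proof -
  define r where "r = {(p, q). snd p \<in> C (fst p) \<and> snd q \<in> C (fst q) \<and> snd p < snd q \<and> fst p \<in> nb (fst q)}"
  have "wf r"
    unfolding wf_iff_no_infinite_down_chain
  proof
    assume "\<exists>g. \<forall>i. (g (Suc i), g i) \<in> r"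
    then obtain g where "\<And>i. (g (Suc i), g i) \<in> r" by blast
    then have "\<forall>i. snd (g i) \<in> C (fst (g i)) \<and> snd (g (Suc i)) < snd (g i) \<and> fst (g (Suc i)) \<in> nb (fst (g i))"
      unfolding r_def by blast
    then have "\<exists>xs ts. \<forall>i. ts i \<in> C (xs i) \<and> ts (Suc i) < ts i \<and> xs (Suc i) \<in> nb (xs i)"
      by (intro exI[of _ "\<lambda>i. fst (g i)"] exI[of _ "\<lambda>i. snd (g i)"])
    then show False using chain unfolding no_chain_def by blast
  qed
  then show ?thesis using assms
  proof (induction "(x, s)" arbitrary: x s rule: wf_induct_rule)
    case less
    have s: "0 < s" using subsetD[OF pos less.prems] by simp
    have ev: "\<forall>\<^sub>F m in sequentially. pca med (f 0) (ring_bit C m) (nat \<lceil>s * 2 ^ m\<rceil> - 1) y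
        = Lim (at_left s) (\<lambda>t. f t y)" if y: "y \<in> nb x" for y
    proof -
      obtain a where a: "0 \<le> a" "a < s" "a = 0 \<or> a \<in> C y" "C y \<inter> {a<..<s} = {}"
        using last_ring[OF s] by blast
      have "\<forall>\<^sub>F t in at_left s. f t y = f a y"
        unfolding eventually_at_left_field
        by (intro exI[of _ a] conjI allI impI a(2)) (rule constant_between[OF a(4,1)]; simp)
      then have "((\<lambda>t. f t y) \<longlongrightarrow> f a y) (at_left s)" by (rule tendsto_eventually)
      then have lim: "Lim (at_left s) (\<lambda>t. f t y) = f a y" by (intro tendsto_Lim) auto
      have "\<forall>\<^sub>F m in sequentially. pca med (f 0) (ring_bit C m) (nat \<lceil>a * 2 ^ m\<rceil>) y = f a y"
      proof (cases "a = 0")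
        case False
        then have "((y, a), (x, s)) \<in> r" using a y less.prems by (auto simp: r_def)
        then show ?thesis using less.hyps False a(3) by blast
      qed simp
      moreover have "\<forall>\<^sub>F m in sequentially. 1 < (s - a) * 2 ^ m" using a(2) by (intro eventually_fine) simp
      ultimately show ?thesis
      proof eventually_elim
        case (elim m)
        have pos: "0 < s * 2 ^ m" "0 \<le> a * 2 ^ m" using s a(1) by simp_all
        have "a * 2 ^ m + 1 < s * 2 ^ m" using elim(2) by (simp add: algebra_simps)
        then have "nat \<lceil>a * 2 ^ m\<rceil> \<le> nat \<lceil>s * 2 ^ m\<rceil> - 1" using pos by linarith
        moreover have "real (nat \<lceil>s * 2 ^ m\<rceil> - 1) < s * 2 ^ m" using pos by linarith
        ultimately show ?case using pca_gap[of C y a s m "nat \<lceil>s * 2 ^ m\<rceil> - 1" med "f 0"] a elim(1) lim by metis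
      qed
    qed
    have "\<forall>\<^sub>F m in sequentially. \<forall>y\<in>nb x. pca med (f 0) (ring_bit C m) (nat \<lceil>s * 2 ^ m\<rceil> - 1) y
        = Lim (at_left s) (\<lambda>t. f t y)"
      using ev by (intro eventually_ball_finite) auto
    then show ?case
    proof eventually_elim
      case (elim m)
      have pos: "0 < s * 2 ^ m" using s by simp
      let ?k = "nat \<lceil>s * 2 ^ m\<rceil> - 1"
      have k: "nat \<lceil>s * 2 ^ m\<rceil> = Suc ?k" using pos by linarith
      have "real ?k < s * 2 ^ m" "s * 2 ^ m \<le> real (Suc ?k)" using pos by linarith+
      then have "s \<in> {real ?k / 2 ^ m <.. real (Suc ?k) / 2 ^ m}" by (simp add: field_simps)
      then have bit: "ring_bit C m ?k x" using less.prems unfolding ring_bit_def by blast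
      have "med (pca med (f 0) (ring_bit C m) ?k) x = med (\<lambda>y. Lim (at_left s) (\<lambda>t. f t y)) x"
          by (rule med_cong) (use elim in blast)
      also have "\<dots> = f s x" using ring_rule[OF less.prems] by (simp only: med_def)
      finally show ?case using bit by (subst k) simp
    qed
  qed
qed

theorem pca_converges:
  assumes "0 \<le> t"
  shows "\<forall>\<^sub>F m in sequentially. pca med (f 0) (ring_bit C m) (nat \<lceil>t * 2 ^ m\<rceil>) x = f t x"
proof -
  \<comment> \<open>The gap after \<open>t\<close> keeps the rounding up of \<open>t\<close> to the
    mesh from taking in a later ring. Looking back from \<open>t + \<epsilon>\<close> instead of
    \<open>t\<close> lets a ring at \<open>t\<close> itself count.\<close>
  obtain \<epsilon> where \<epsilon>: "0 < \<epsilon>" "C x \<inter> {t<..<t + \<epsilon>} = {}" using gap_after by blast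
  have "0 < t + \<epsilon>" using assms \<epsilon> by simp
  then obtain a where a: "0 \<le> a" "a < t + \<epsilon>" "a = 0 \<or> a \<in> C x" "C x \<inter> {a<..<t + \<epsilon>} = {}"
    using last_ring by blast
  have at: "a \<le> t" using a(2,3) \<epsilon>(2) assms by fastforce
  have "\<forall>\<^sub>F m in sequentially. pca med (f 0) (ring_bit C m) (nat \<lceil>a * 2 ^ m\<rceil>) x = f a x"
    using a(3)
  proof
    assume "a \<in> C x" then show ?thesis by (rule pca_at_ring)
  qed simp
  moreover have "\<forall>\<^sub>F m in sequentially. 1 < \<epsilon> * 2 ^ m" using \<epsilon>(1) by (rule eventually_fine)
  ultimately show ?thesis
  proof eventually_elim
    case (elim m)
    have "a * 2 ^ m \<le> t * 2 ^ m" using at by simp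
    then have "nat \<lceil>a * 2 ^ m\<rceil> \<le> nat \<lceil>t * 2 ^ m\<rceil>" by (intro nat_mono ceiling_mono)
    moreover have "0 \<le> t * 2 ^ m" using assms by simp
    then have "real (nat \<lceil>t * 2 ^ m\<rceil>) < t * 2 ^ m + 1" by linarith
    then have "real (nat \<lceil>t * 2 ^ m\<rceil>) < (t + \<epsilon>) * 2 ^ m" using elim(2) by (simp add: algebra_simps)
    ultimately show ?case
      using pca_gap[of C x a "t + \<epsilon>" m "nat \<lceil>t * 2 ^ m\<rceil>" med "f 0"] a elim(1)
        constant_between[OF a(4,1) at] \<epsilon>(1) by simp
  qed
qed

end

section \<open>Independent bits\<close>

lemma local_on_times: "local_on W f \<Longrightarrow> local_on W g \<Longrightarrow> local_on W (\<lambda>s. f s * g s :: real)"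
  unfolding local_on_def by metis

lemma local_on_fun_upd:
  fixes f :: "('i \<Rightarrow> bool) \<Rightarrow> 'c"
  assumes "local_on (insert j I) f"
  shows "local_on I (\<lambda>s. f (s(j := v)))"
  unfolding local_on_def
proof (intro allI impI)
  fix s s' :: "'i \<Rightarrow> bool" assume "\<forall>x\<in>I. s x = s' x"
  then show "f (s(j := v)) = f (s'(j := v))" by (intro local_onD[OF assms]) auto
qed

context prob_space
begin

text \<open>Independence together with the success probabilities \<open>q\<close>, stated through
  full patterns on a finite index set. In this form the law transfers along permutations of the
  indices, and expectations of local functionals are finite sums.\<close>

definition bernoulli_on :: "('i \<Rightarrow> 'a \<Rightarrow> bool) \<Rightarrow> ('i \<Rightarrow> real) \<Rightarrow> 'i set \<Rightarrow> bool" where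
  "bernoulli_on X q I \<longleftrightarrow> finite I \<and> (\<forall>i\<in>I. {\<omega>\<in>space M. X i \<omega>} \<in> events) \<and>
     (\<forall>b. prob {\<omega>\<in>space M. \<forall>i\<in>I. X i \<omega> = b i} = (\<Prod>i\<in>I. if b i then q i else 1 - q i))"

lemma bernoulli_onD:
  "bernoulli_on X q I \<Longrightarrow> prob {\<omega>\<in>space M. \<forall>i\<in>I. X i \<omega> = b i} = (\<Prod>i\<in>I. if b i then q i else 1 - q i)"
  unfolding bernoulli_on_def by blast

lemma bernoulli_on_pattern_event:
  assumes "bernoulli_on X q I" "J \<subseteq> I"
  shows "{\<omega>\<in>space M. \<forall>i\<in>J. X i \<omega> = b i} \<in> events"
proof -
  have "finite J" using assms finite_subset unfolding bernoulli_on_def by blast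
  moreover have "{\<omega>\<in>space M. X i \<omega> = b i} \<in> events" if "i \<in> J" for i
  proof -
    have "{\<omega>\<in>space M. X i \<omega>} \<in> events" using assms that unfolding bernoulli_on_def by blast
    then show ?thesis by (cases "b i") (auto intro: sets.sets_Collect_neg)
  qed
  ultimately show ?thesis by (intro sets.sets_Collect_finite_All) auto
qed

text \<open>Summing over both values of the removed coordinate gives the factor
  \<open>q j + (1 - q j) = 1\<close>.\<close>

lemma bernoulli_on_remove:
  assumes "bernoulli_on X q (insert j I)" "j \<notin> I"
  shows "bernoulli_on X q I"
proof -
  have fin: "finite I" using assms unfolding bernoulli_on_def by simp
  have "prob {\<omega>\<in>space M. \<forall>i\<in>I. X i \<omega> = b i} = (\<Prod>i\<in>I. if b i then q i else 1 - q i)" for b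
  proof -
    let ?E = "\<lambda>v. {\<omega>\<in>space M. \<forall>i\<in>insert j I. X i \<omega> = (b(j := v)) i}"
    have ev: "?E v \<in> events" for v using bernoulli_on_pattern_event[OF assms(1) order_refl] by blast
    have p: "prob (?E v) = (if v then q j else 1 - q j) * (\<Prod>i\<in>I. if b i then q i else 1 - q i)" for v
    proof -
      have "prob (?E v) = (\<Prod>i\<in>insert j I. if (b(j := v)) i then q i else 1 - q i)"
        by (rule bernoulli_onD[OF assms(1)])
      also have "\<dots> = (if v then q j else 1 - q j) * (\<Prod>i\<in>I. if (b(j := v)) i then q i else 1 - q i)"
        using fin assms(2) by simp
      also have "(\<Prod>i\<in>I. if (b(j := v)) i then q i else 1 - q i) = (\<Prod>i\<in>I. if b i then q i else 1 - q i)"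
        using assms(2) by (intro prod.cong) auto
      finally show ?thesis .
    qed
    have "{\<omega>\<in>space M. \<forall>i\<in>I. X i \<omega> = b i} = ?E True \<union> ?E False"
      using assms(2) by (auto simp: fun_upd_def)
    moreover have "?E True \<inter> ?E False = {}" by auto
    ultimately have "prob {\<omega>\<in>space M. \<forall>i\<in>I. X i \<omega> = b i} = prob (?E True) + prob (?E False)"
      using finite_measure_Union[OF ev[of True] ev[of False]] by simp
    then show ?thesis unfolding p by (simp add: algebra_simps)
  qed
  then show ?thesis using assms unfolding bernoulli_on_def by simp
qed

lemma bernoulli_on_subset:
  assumes "bernoulli_on X q I" "J \<subseteq> I"
  shows "bernoulli_on X q J"
proof -
  have "bernoulli_on X q J" if "finite K" "K \<inter> J = {}" "bernoulli_on X q (J \<union> K)" for K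
    using that
  proof (induction K rule: finite_induct)
    case (insert x K)
    have "bernoulli_on X q (insert x (J \<union> K))" using insert.prems by simp
    moreover have "x \<notin> J \<union> K" using insert.hyps insert.prems by blast
    ultimately have "bernoulli_on X q (J \<union> K)" by (rule bernoulli_on_remove)
    then show ?case using insert by blast
  qed simp
  moreover have "finite (I - J)" "J \<union> (I - J) = I" using assms unfolding bernoulli_on_def by auto
  ultimately show ?thesis using assms(1) by (metis Diff_disjoint inf_commute)
qed

definition pattern :: "('i \<Rightarrow> 'a \<Rightarrow> bool) \<Rightarrow> 'i set \<Rightarrow> 'i set \<Rightarrow> 'a set" where
  "pattern X I S = {\<omega>\<in>space M. \<forall>i\<in>I. X i \<omega> = (i \<in> S)}"

lemma local_expansion:
  fixes \<phi> :: "('i \<Rightarrow> bool) \<Rightarrow> real"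
  assumes "finite I" "local_on I \<phi>" "\<omega> \<in> space M"
  shows "\<phi> (\<lambda>i. X i \<omega>) = (\<Sum>S\<in>Pow I. \<phi> (\<lambda>i. i \<in> S) * indicator (pattern X I S) \<omega>)"
proof -
  let ?S = "{i\<in>I. X i \<omega>}"
  have "(\<Sum>S\<in>Pow I. \<phi> (\<lambda>i. i \<in> S) * indicator (pattern X I S) \<omega>)
      = (\<Sum>S\<in>{?S}. \<phi> (\<lambda>i. i \<in> S) * indicator (pattern X I S) \<omega>)"
  proof (rule sum.mono_neutral_right)
    show "\<forall>S\<in>Pow I - {?S}. \<phi> (\<lambda>i. i \<in> S) * indicator (pattern X I S) \<omega> = 0"
      by (auto simp: pattern_def indicator_def)
  qed (use assms in auto)
  also have "\<dots> = \<phi> (\<lambda>i. i \<in> ?S)" using assms(3) by (simp add: pattern_def)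
  also have "\<dots> = \<phi> (\<lambda>i. X i \<omega>)" by (rule local_onD[OF assms(2)]) simp
  finally show ?thesis ..
qed

context
  fixes X :: "'i \<Rightarrow> 'a \<Rightarrow> bool" and q :: "'i \<Rightarrow> real"
begin

lemma pattern_event: "bernoulli_on X q I \<Longrightarrow> pattern X I S \<in> events"
  unfolding pattern_def by (rule bernoulli_on_pattern_event) auto

lemma prob_pattern:
  assumes "bernoulli_on X q I"
  shows "prob (pattern X I S) = (\<Prod>i\<in>I. if i \<in> S then q i else 1 - q i)"
  unfolding pattern_def by (rule bernoulli_onD[OF assms])

lemma local_integrable:
  fixes \<phi> :: "('i \<Rightarrow> bool) \<Rightarrow> real"
  assumes "bernoulli_on X q I" "local_on I \<phi>"
  shows "integrable M (\<lambda>\<omega>. \<phi> (\<lambda>i. X i \<omega>))"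
proof -
  have fin: "finite I" using assms(1) unfolding bernoulli_on_def by blast
  have "integrable M (\<lambda>\<omega>. \<Sum>S\<in>Pow I. \<phi> (\<lambda>i. i \<in> S) * indicator (pattern X I S) \<omega>)"
    using pattern_event[OF assms(1)] by (intro Bochner_Integration.integrable_sum integrable_mult_right) (simp add: integrable_indicator_iff emeasure_eq_measure)
  then show ?thesis using local_expansion[OF fin assms(2)] by (subst Bochner_Integration.integrable_cong[OF refl]) auto
qed

lemma local_expectation:
  fixes \<phi> :: "('i \<Rightarrow> bool) \<Rightarrow> real"
  assumes "bernoulli_on X q I" "local_on I \<phi>"
  shows "expectation (\<lambda>\<omega>. \<phi> (\<lambda>i. X i \<omega>)) =
    (\<Sum>S\<in>Pow I. \<phi> (\<lambda>i. i \<in> S) * (\<Prod>i\<in>I. if i \<in> S then q i else 1 - q i))"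
proof -
  have fin: "finite I" using assms(1) unfolding bernoulli_on_def by blast
  have "expectation (\<lambda>\<omega>. \<phi> (\<lambda>i. X i \<omega>)) =
      expectation (\<lambda>\<omega>. \<Sum>S\<in>Pow I. \<phi> (\<lambda>i. i \<in> S) * indicator (pattern X I S) \<omega>)"
    using local_expansion[OF fin assms(2)] by (intro Bochner_Integration.integral_cong) auto
  also have "\<dots> = (\<Sum>S\<in>Pow I. expectation (\<lambda>\<omega>. \<phi> (\<lambda>i. i \<in> S) * indicator (pattern X I S) \<omega>))"
    using pattern_event[OF assms(1)]
    by (intro Bochner_Integration.integral_sum integrable_mult_right) (simp add: integrable_indicator_iff emeasure_eq_measure)
  also have "\<dots> = (\<Sum>S\<in>Pow I. \<phi> (\<lambda>i. i \<in> S) * (\<Prod>i\<in>I. if i \<in> S then q i else 1 - q i))"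
    using pattern_event[OF assms(1)] by (simp add: prob_pattern[OF assms(1)])
  finally show ?thesis .
qed

text \<open>Patterns on disjoint \<open>I\<close> and \<open>J\<close> have product weights, so the
  sum over patterns on the union splits. It takes the part of conditioning: the inner expectation
  averages the \<open>J\<close> bits with the \<open>I\<close> bits frozen.\<close>

lemma local_fubini:
  fixes H :: "('i \<Rightarrow> bool) \<Rightarrow> ('i \<Rightarrow> bool) \<Rightarrow> real"
  assumes b: "bernoulli_on X q (I \<union> J)" and disj: "I \<inter> J = {}"
    and I: "\<And>t. local_on I (\<lambda>s. H s t)" and J: "\<And>s. local_on J (H s)"
  shows "expectation (\<lambda>\<omega>. H (\<lambda>i. X i \<omega>) (\<lambda>i. X i \<omega>)) =
    expectation (\<lambda>\<omega>. expectation (\<lambda>\<omega>'. H (\<lambda>i. X i \<omega>) (\<lambda>i. X i \<omega>')))"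
proof -
  have bI: "bernoulli_on X q I" and bJ: "bernoulli_on X q J"
    using bernoulli_on_subset[OF b] by auto
  have fin: "finite I" "finite J" using b unfolding bernoulli_on_def by auto
  let ?w = "\<lambda>I S. \<Prod>i\<in>I. if i \<in> S then q i else 1 - q i"
  have loc: "local_on (I \<union> J) (\<lambda>s. H s s)"
    using I J unfolding local_on_def by (metis UnCI)
  have "expectation (\<lambda>\<omega>. H (\<lambda>i. X i \<omega>) (\<lambda>i. X i \<omega>)) =
      (\<Sum>U\<in>Pow (I \<union> J). H (\<lambda>i. i \<in> U) (\<lambda>i. i \<in> U) * ?w (I \<union> J) U)"
    by (rule local_expectation[OF b loc])
  also have "\<dots> = (\<Sum>(S, T)\<in>Pow I \<times> Pow J. H (\<lambda>i. i \<in> S) (\<lambda>i. i \<in> T) * (?w I S * ?w J T))"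
  proof (rule sum.reindex_bij_witness[of _ "\<lambda>(S, T). S \<union> T" "\<lambda>U. (U \<inter> I, U \<inter> J)"])
    fix U assume U: "U \<in> Pow (I \<union> J)"
    have "?w (I \<union> J) U = ?w I U * ?w J U" using fin disj by (rule prod.union_disjoint)
    moreover have "?w I U = ?w I (U \<inter> I)" "?w J U = ?w J (U \<inter> J)" by (auto intro: prod.cong)
    ultimately have w: "?w (I \<union> J) U = ?w I (U \<inter> I) * ?w J (U \<inter> J)" by (simp only:)
    have "H (\<lambda>i. i \<in> U) (\<lambda>i. i \<in> U) = H (\<lambda>i. i \<in> U \<inter> I) (\<lambda>i. i \<in> U)"
      by (rule local_onD[OF I]) simp
    also have "\<dots> = H (\<lambda>i. i \<in> U \<inter> I) (\<lambda>i. i \<in> U \<inter> J)"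
      by (rule local_onD[OF J]) simp
    finally have h: "H (\<lambda>i. i \<in> U) (\<lambda>i. i \<in> U) = H (\<lambda>i. i \<in> U \<inter> I) (\<lambda>i. i \<in> U \<inter> J)" .
    show "(case (U \<inter> I, U \<inter> J) of (S, T) \<Rightarrow> H (\<lambda>i. i \<in> S) (\<lambda>i. i \<in> T) * (?w I S * ?w J T))
        = H (\<lambda>i. i \<in> U) (\<lambda>i. i \<in> U) * ?w (I \<union> J) U"
      unfolding w h prod.case ..
  qed (use disj in auto)
  also have "\<dots> = (\<Sum>S\<in>Pow I. (\<Sum>T\<in>Pow J. H (\<lambda>i. i \<in> S) (\<lambda>i. i \<in> T) * ?w J T) * ?w I S)"
    by (simp add: sum.cartesian_product[symmetric] sum_distrib_left sum_distrib_right mult_ac)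
  also have "\<dots> = (\<Sum>S\<in>Pow I. expectation (\<lambda>\<omega>'. H (\<lambda>i. i \<in> S) (\<lambda>i. X i \<omega>')) * ?w I S)"
    by (intro sum.cong refl arg_cong2[where f = "(*)"] local_expectation[OF bJ J, symmetric])
  also have "\<dots> = expectation (\<lambda>\<omega>. expectation (\<lambda>\<omega>'. H (\<lambda>i. X i \<omega>) (\<lambda>i. X i \<omega>')))"
  proof (rule local_expectation[OF bI, symmetric])
    show "local_on I (\<lambda>s. expectation (\<lambda>\<omega>'. H s (\<lambda>i. X i \<omega>')))"
      unfolding local_on_def
    proof (intro allI impI)
      fix s s' :: "'i \<Rightarrow> bool" assume "\<forall>x\<in>I. s x = s' x"
      then have "H s = H s'" using I unfolding local_on_def by blast
      then show "expectation (\<lambda>\<omega>'. H s (\<lambda>i. X i \<omega>')) = expectation (\<lambda>\<omega>'. H s' (\<lambda>i. X i \<omega>'))" by simp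
    qed
  qed
  finally show ?thesis .
qed

lemma local_independence:
  fixes f g :: "('i \<Rightarrow> bool) \<Rightarrow> real"
  assumes "bernoulli_on X q (I \<union> J)" "I \<inter> J = {}" "local_on I f" "local_on J g"
  shows "expectation (\<lambda>\<omega>. f (\<lambda>i. X i \<omega>) * g (\<lambda>i. X i \<omega>)) =
    expectation (\<lambda>\<omega>. f (\<lambda>i. X i \<omega>)) * expectation (\<lambda>\<omega>. g (\<lambda>i. X i \<omega>))"
proof -
  have "expectation (\<lambda>\<omega>. f (\<lambda>i. X i \<omega>) * g (\<lambda>i. X i \<omega>)) =
      expectation (\<lambda>\<omega>. expectation (\<lambda>\<omega>'. f (\<lambda>i. X i \<omega>) * g (\<lambda>i. X i \<omega>')))"
    by (rule local_fubini[OF assms(1,2), where H = "\<lambda>s t. f s * g t"])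
      (use assms(3,4) in \<open>auto simp: local_on_def\<close>)
  then show ?thesis by simp
qed

text \<open>The direction may vary with the coordinate because a ring can raise or lower a spin.\<close>

lemma harris:
  fixes f g :: "('i \<Rightarrow> bool) \<Rightarrow> real" and up :: "'i \<Rightarrow> bool"
  assumes "bernoulli_on X q I" "local_on I f" "local_on I g"
    and "\<And>i. i \<in> I \<Longrightarrow> 0 \<le> q i \<and> q i \<le> 1"
    and "\<And>i s. i \<in> I \<Longrightarrow> f (s(i := \<not> up i)) \<le> f (s(i := up i))"
    and "\<And>i s. i \<in> I \<Longrightarrow> g (s(i := \<not> up i)) \<le> g (s(i := up i))"
  shows "expectation (\<lambda>\<omega>. f (\<lambda>i. X i \<omega>)) * expectation (\<lambda>\<omega>. g (\<lambda>i. X i \<omega>))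
    \<le> expectation (\<lambda>\<omega>. f (\<lambda>i. X i \<omega>) * g (\<lambda>i. X i \<omega>))"
proof -
  have "finite I" using assms(1) unfolding bernoulli_on_def by blast
  then show ?thesis using assms
  proof (induction I arbitrary: f g rule: finite_induct)
    case empty
    have "f s = f (\<lambda>_. True)" "g s = g (\<lambda>_. True)" for s
      using empty unfolding local_on_def by blast+
    then have "f = (\<lambda>_. f (\<lambda>_. True))" "g = (\<lambda>_. g (\<lambda>_. True))" by blast+
    then obtain c d where "f = (\<lambda>_. c)" "g = (\<lambda>_. d)" by blast
    then show ?case by (simp add: prob_space)
  next
    case (insert j I)
    let ?E = "\<lambda>\<phi>. expectation (\<lambda>\<omega>. \<phi> (\<lambda>i. X i \<omega>))"
    have bI: "bernoulli_on X q I" by (rule bernoulli_on_remove[OF insert.prems(1) insert.hyps(2)])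
    have split: "?E \<phi> = q j * ?E (\<lambda>s. \<phi> (s(j := True))) + (1 - q j) * ?E (\<lambda>s. \<phi> (s(j := False)))"
      if \<phi>: "local_on (insert j I) \<phi>" for \<phi> :: "('i \<Rightarrow> bool) \<Rightarrow> real"
    proof -
      have loc: "local_on I (\<lambda>s. \<phi> (s(j := v)))" for v
        by (rule local_on_fun_upd[OF \<phi>])
      have b: "bernoulli_on X q (I \<union> {j})" using insert.prems(1) by simp
      have bj: "bernoulli_on X q {j}" using bernoulli_on_subset[OF b] by blast
      have "(\<lambda>i. X i \<omega>)(j := X j \<omega>) = (\<lambda>i. X i \<omega>)" for \<omega> by auto
      then have "?E \<phi> = ?E (\<lambda>s. \<phi> (s(j := s j)))" by simp
      also have "\<dots> = expectation (\<lambda>\<omega>. expectation (\<lambda>\<omega>'. \<phi> ((\<lambda>i. X i \<omega>)(j := X j \<omega>'))))"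
        by (rule local_fubini[OF b, where H = "\<lambda>s t. \<phi> (s(j := t j))"])
          (use loc insert.hyps(2) in \<open>auto simp: local_on_def\<close>)
      also have "(\<lambda>\<omega>. expectation (\<lambda>\<omega>'. \<phi> ((\<lambda>i. X i \<omega>)(j := X j \<omega>')))) =
          (\<lambda>\<omega>. q j * \<phi> ((\<lambda>i. X i \<omega>)(j := True)) + (1 - q j) * \<phi> ((\<lambda>i. X i \<omega>)(j := False)))"
      proof
        fix \<omega>
        have "expectation (\<lambda>\<omega>'. \<phi> ((\<lambda>i. X i \<omega>)(j := X j \<omega>'))) =
            (\<Sum>S\<in>Pow {j}. \<phi> ((\<lambda>i. X i \<omega>)(j := j \<in> S)) * (\<Prod>i\<in>{j}. if i \<in> S then q i else 1 - q i))"
          by (rule local_expectation[OF bj, where \<phi> = "\<lambda>t. \<phi> ((\<lambda>i. X i \<omega>)(j := t j))"])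
            (simp add: local_on_def)
        also have "Pow {j} = {{}, {j}}" by auto
        finally show "expectation (\<lambda>\<omega>'. \<phi> ((\<lambda>i. X i \<omega>)(j := X j \<omega>'))) =
          q j * \<phi> ((\<lambda>i. X i \<omega>)(j := True)) + (1 - q j) * \<phi> ((\<lambda>i. X i \<omega>)(j := False))"
          by (simp add: fun_upd_def cong: if_cong)
      qed
      finally show ?thesis
        using local_integrable[OF bI loc[of True]] local_integrable[OF bI loc[of False]] by simp
    qed
    define f1 f0 g1 g0 where "f1 = (\<lambda>s. f (s(j := True)))" and "f0 = (\<lambda>s. f (s(j := False)))"
      and "g1 = (\<lambda>s. g (s(j := True)))" and "g0 = (\<lambda>s. g (s(j := False)))"
    have loc: "local_on I f1" "local_on I f0" "local_on I g1" "local_on I g0"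
      unfolding f1_def f0_def g1_def g0_def
      by (intro local_on_fun_upd insert.prems(2,3))+
    have m: "\<phi> (s(i := \<not> up i)) \<le> \<phi> (s(i := up i))"
      if "\<phi> \<in> {f1, f0, g1, g0}" "i \<in> I" for \<phi> i s
    proof -
      have ij: "i \<noteq> j" using that insert.hyps by blast
      have iI: "i \<in> insert j I" using that by blast
      have "f (s(i := \<not> up i, j := v)) \<le> f (s(i := up i, j := v))"
        "g (s(i := \<not> up i, j := v)) \<le> g (s(i := up i, j := v))" for v
        unfolding fun_upd_twist[OF ij] by (rule insert.prems(5,6)[OF iI])+
      then show ?thesis using that(1) unfolding f1_def f0_def g1_def g0_def by blast
    qed
    have "?E f1 * ?E g1 \<le> ?E (\<lambda>s. f1 s * g1 s)" "?E f0 * ?E g0 \<le> ?E (\<lambda>s. f0 s * g0 s)"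
      using insert.IH[OF bI] loc m insert.prems(4) by blast+
    have mono: "?E \<phi> \<le> ?E \<psi>" if "local_on I \<phi>" "local_on I \<psi>" "\<And>s. \<phi> s \<le> \<psi> s"
      for \<phi> \<psi> :: "('i \<Rightarrow> bool) \<Rightarrow> real"
      by (rule integral_mono[OF local_integrable[OF bI that(1)] local_integrable[OF bI that(2)] that(3)])
    \<comment> \<open>The covariance contributed by coordinate \<open>j\<close> is
      \<open>q j * (1 - q j)\<close> times this product, and both factors have the sign prescribed
      by \<open>up j\<close>.\<close>
    have "0 \<le> (?E f1 - ?E f0) * (?E g1 - ?E g0)"
    proof (cases "up j")
      case True
      then have "f0 s \<le> f1 s" "g0 s \<le> g1 s" for s
        using insert.prems(5,6)[OF insertI1, of s] True
        by (simp_all only: f1_def f0_def g1_def g0_def simp_thms)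
      then have "?E f0 \<le> ?E f1" "?E g0 \<le> ?E g1" by (intro mono loc; simp)+
      then show ?thesis by simp
    next
      case False
      then have "f1 s \<le> f0 s" "g1 s \<le> g0 s" for s
        using insert.prems(5,6)[OF insertI1, of s] False
        by (simp_all only: f1_def f0_def g1_def g0_def simp_thms)
      then have "?E f1 \<le> ?E f0" "?E g1 \<le> ?E g0" by (intro mono loc; simp)+
      then show ?thesis by (simp add: mult_nonpos_nonpos)
    qed
    moreover have q: "0 \<le> q j" "q j \<le> 1" using insert.prems(4) by auto
    ultimately have "0 \<le> q j * (1 - q j) * ((?E f1 - ?E f0) * (?E g1 - ?E g0))" by simp
    then have "(q j * ?E f1 + (1 - q j) * ?E f0) * (q j * ?E g1 + (1 - q j) * ?E g0)
        \<le> q j * (?E f1 * ?E g1) + (1 - q j) * (?E f0 * ?E g0)"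
      by (simp add: algebra_simps)
    also have "\<dots> \<le> q j * ?E (\<lambda>s. f1 s * g1 s) + (1 - q j) * ?E (\<lambda>s. f0 s * g0 s)"
      using q \<open>?E f1 * ?E g1 \<le> _\<close> \<open>?E f0 * ?E g0 \<le> _\<close> by (intro add_mono mult_left_mono) auto
    finally show ?case
      unfolding split[OF insert.prems(2)] split[OF insert.prems(3)]
        split[OF local_on_times[OF insert.prems(2,3)]] f1_def f0_def g1_def g0_def .
  qed
qed

end

lemma bernoulli_equal_expectation:
  fixes \<phi> :: "('i \<Rightarrow> bool) \<Rightarrow> real"
  assumes "bernoulli_on X q I" "bernoulli_on Y q I" "local_on I \<phi>"
  shows "expectation (\<lambda>\<omega>. \<phi> (\<lambda>i. X i \<omega>)) = expectation (\<lambda>\<omega>. \<phi> (\<lambda>i. Y i \<omega>))"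
  using local_expectation[OF assms(1,3)] local_expectation[OF assms(2,3)] by simp

lemma bernoulli_on_reindex:
  fixes X :: "'i \<Rightarrow> 'a \<Rightarrow> bool" and h :: "'j \<Rightarrow> 'i"
  assumes "bernoulli_on X q (h ` I)" "inj_on h I" "\<And>i. i \<in> I \<Longrightarrow> q (h i) = q' i" "finite I"
  shows "bernoulli_on (\<lambda>i. X (h i)) q' I"
  unfolding bernoulli_on_def
proof (intro conjI ballI allI)
  show "{\<omega>\<in>space M. X (h i) \<omega>} \<in> events" if "i \<in> I" for i
    using assms(1) that unfolding bernoulli_on_def by blast
  fix b :: "'j \<Rightarrow> bool"
  let ?b = "\<lambda>j. b (the_inv_into I h j)"
  have "prob {\<omega>\<in>space M. \<forall>i\<in>I. X (h i) \<omega> = b i} = prob {\<omega>\<in>space M. \<forall>j\<in>h ` I. X j \<omega> = ?b j}"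
    using assms(2) by (simp add: the_inv_into_f_f)
  also have "\<dots> = (\<Prod>j\<in>h ` I. if ?b j then q j else 1 - q j)"
    by (rule bernoulli_onD[OF assms(1)])
  also have "\<dots> = (\<Prod>i\<in>I. if b i then q' i else 1 - q' i)"
    by (subst prod.reindex[OF assms(2)]) (auto intro!: prod.cong simp: the_inv_into_f_f assms(2,3))
  finally show "prob {\<omega>\<in>space M. \<forall>i\<in>I. X (h i) \<omega> = b i} = (\<Prod>i\<in>I. if b i then q' i else 1 - q' i)" .
qed (rule assms(4))

lemma bernoulli_on_flip:
  fixes X :: "'i \<Rightarrow> 'a \<Rightarrow> bool"
  assumes "bernoulli_on X q I" "\<And>i. i \<in> I \<Longrightarrow> c i \<Longrightarrow> q i = 1/2"
  shows "bernoulli_on (\<lambda>i \<omega>. X i \<omega> \<noteq> c i) q I"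
  unfolding bernoulli_on_def
proof (intro conjI ballI allI)
  show "finite I" using assms(1) unfolding bernoulli_on_def by blast
  show "{\<omega>\<in>space M. X i \<omega> \<noteq> c i} \<in> events" if "i \<in> I" for i
  proof -
    have "{\<omega>\<in>space M. X i \<omega>} \<in> events" using assms(1) that unfolding bernoulli_on_def by blast
    then show ?thesis by (cases "c i") (auto intro: sets.sets_Collect_neg)
  qed
  fix b :: "'i \<Rightarrow> bool"
  have "prob {\<omega>\<in>space M. \<forall>i\<in>I. (X i \<omega> \<noteq> c i) = b i} = prob {\<omega>\<in>space M. \<forall>i\<in>I. X i \<omega> = (b i \<noteq> c i)}"
    by (rule arg_cong[where f = prob]) auto
  also have "\<dots> = (\<Prod>i\<in>I. if b i \<noteq> c i then q i else 1 - q i)"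
    by (rule bernoulli_onD[OF assms(1)])
  also have "\<dots> = (\<Prod>i\<in>I. if b i then q i else 1 - q i)"
  proof (intro prod.cong refl)
    fix i assume "i \<in> I"
    then show "(if b i \<noteq> c i then q i else 1 - q i) = (if b i then q i else 1 - q i)"
      using assms(2)[of i] by (cases "c i") auto
  qed
  finally show "prob {\<omega>\<in>space M. \<forall>i\<in>I. (X i \<omega> \<noteq> c i) = b i} = (\<Prod>i\<in>I. if b i then q i else 1 - q i)" .
qed

end

section \<open>The bits of the median process\<close>

text \<open>\<open>Inl x\<close> will index the initial comparison at \<open>x\<close>, and
  \<open>Inr (x, k)\<close> the presence of a ring at \<open>x\<close> in mesh interval number
  \<open>k\<close>.\<close>

type_synonym bit_index = "site + site \<times> nat"

definition sites_steps :: "site set \<Rightarrow> nat \<Rightarrow> bit_index set" where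
  "sites_steps V K = Inl ` V \<union> Inr ` (V \<times> {..<K})"

locale median_process =
  fixes M :: "'a measure" and R :: "site \<Rightarrow> 'a \<Rightarrow> real set" and \<eta> :: "real \<Rightarrow> site \<Rightarrow> 'a \<Rightarrow> real"
  assumes dyn: "median_dynamics z2_adj M R \<eta>"

sublocale median_process \<subseteq> prob_space M
  using dyn unfolding median_dynamics_def by blast

context median_process
begin

definition init_prob :: "real \<Rightarrow> real" where
  "init_prob p = measure (uniform_measure lborel {0..1}) {..p}"

definition ring_prob :: "nat \<Rightarrow> real" where
  "ring_prob m = 1 - exp (- (1 / 2 ^ m))"

definition bits :: "real \<Rightarrow> nat \<Rightarrow> bit_index \<Rightarrow> 'a \<Rightarrow> bool" where
  "bits p m i \<omega> = (case i of Inl x \<Rightarrow> \<eta> 0 x \<omega> \<le> p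
     | Inr (x, k) \<Rightarrow> ring_bit (\<lambda>x. R x \<omega>) m k x)"

definition rate :: "real \<Rightarrow> nat \<Rightarrow> bit_index \<Rightarrow> real" where
  "rate p m i = (case i of Inl x \<Rightarrow> init_prob p | Inr _ \<Rightarrow> ring_prob m)"

lemma clock: "poisson_clock M (R x)"
  using dyn unfolding median_dynamics_def by blast

lemma ring_prob_bounds: "0 \<le> ring_prob m" "ring_prob m \<le> 1" "ring_prob m \<le> 1 / 2 ^ m"
  using exp_ge_add_one_self[of "- (1 / 2 ^ m)"] by (auto simp: ring_prob_def)

lemma init_measurable: "\<eta> 0 x \<in> borel_measurable M"
proof -
  have "\<eta> 0 x \<in> M \<rightarrow>\<^sub>M restrict_space borel {0..1}"
    using dyn unfolding median_dynamics_def by auto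
  then show ?thesis by (simp add: measurable_restrict_space2_iff)
qed

lemma init_distr: "distr M lborel (\<eta> 0 x) = uniform_measure lborel {0..1}"
  using dyn unfolding median_dynamics_def by blast

lemma prob_init: "prob {\<omega>\<in>space M. \<eta> 0 x \<omega> \<le> p} = init_prob p"
proof -
  have "init_prob p = measure (distr M lborel (\<eta> 0 x)) {..p}"
    unfolding init_prob_def init_distr ..
  also have "\<dots> = prob (\<eta> 0 x -` {..p} \<inter> space M)"
    using init_measurable by (intro measure_distr) auto
  also have "\<eta> 0 x -` {..p} \<inter> space M = {\<omega>\<in>space M. \<eta> 0 x \<omega> \<le> p}" by auto
  finally show ?thesis ..
qed

lemma init_prob_half: "init_prob (1/2) = 1/2"
proof -
  have "{0..1} \<inter> {..1/2} = {0..1/2::real}" by auto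
  then show ?thesis unfolding init_prob_def by (subst measure_uniform_measure) auto
qed

lemma init_prob_bounds: "0 \<le> init_prob p" "init_prob p \<le> 1"
  using prob_init[of undefined p] prob_le_1 measure_nonneg by metis+

lemma rate_bounds: "0 \<le> rate p m i" "rate p m i \<le> 1"
  using ring_prob_bounds init_prob_bounds by (auto simp: rate_def split: sum.split)

lemma ring_bit_rings:
  assumes "\<omega> \<in> space M"
  shows "ring_bit (\<lambda>x. R x \<omega>) m k x \<longleftrightarrow> rings (R x) (real k / 2 ^ m) (real (Suc k) / 2 ^ m) \<omega> \<noteq> 0"
proof -
  have "finite (R x \<omega> \<inter> {..real (Suc k) / 2 ^ m})"
    using clock assms unfolding poisson_clock_def by blast
  then have "finite (R x \<omega> \<inter> {real k / 2 ^ m<..real (Suc k) / 2 ^ m})"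
    by (rule rev_finite_subset) auto
  then show ?thesis unfolding ring_bit_def rings_def by simp
qed

lemma mesh_less: "real k / 2 ^ m < real (Suc k) / 2 ^ m"
  by (simp add: divide_strict_right_mono)

lemma rings_measurable:
  "rings (R x) (real k / 2 ^ m) (real (Suc k) / 2 ^ m) \<in> M \<rightarrow>\<^sub>M count_space UNIV"
  using clock[of x] mesh_less[of k m] unfolding poisson_clock_def by simp

lemma prob_ring_bit:
  "prob {\<omega>\<in>space M. ring_bit (\<lambda>x. R x \<omega>) m k x = b} = (if b then ring_prob m else 1 - ring_prob m)"
proof -
  let ?N = "rings (R x) (real k / 2 ^ m) (real (Suc k) / 2 ^ m)"
  have "distr M (count_space UNIV) ?N = measure_pmf (poisson_pmf (real (Suc k) / 2 ^ m - real k / 2 ^ m))"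
    using clock[of x] mesh_less[of k m] unfolding poisson_clock_def by simp
  moreover have "real (Suc k) / 2 ^ m - real k / 2 ^ m = 1 / 2 ^ m" by (simp flip: diff_divide_distrib)
  ultimately have d: "distr M (count_space UNIV) ?N = measure_pmf (poisson_pmf (1 / 2 ^ m))" by simp
  have "prob (?N -` {0} \<inter> space M) = measure (distr M (count_space UNIV) ?N) {0}"
    using rings_measurable by (subst measure_distr) auto
  also have "\<dots> = exp (- (1 / 2 ^ m))" unfolding d by (simp add: measure_pmf_single)
  finally have z: "prob (?N -` {0} \<inter> space M) = 1 - ring_prob m" by (simp add: ring_prob_def)
  have ev: "?N -` {0} \<inter> space M \<in> events" using rings_measurable by (rule measurable_sets) simp
  show ?thesis
  proof (cases b)
    case True
    have "{\<omega>\<in>space M. ring_bit (\<lambda>x. R x \<omega>) m k x = b} = space M - ?N -` {0} \<inter> space M"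
      by (auto simp: ring_bit_rings True)
    then show ?thesis using prob_compl[OF ev] z True by simp
  next
    case False
    have "{\<omega>\<in>space M. ring_bit (\<lambda>x. R x \<omega>) m k x = b} = ?N -` {0} \<inter> space M"
      by (auto simp: ring_bit_rings False)
    then show ?thesis using z False by simp
  qed
qed

text \<open>Independent increments of a single clock along the mesh points give the product.
  Membership in \<open>clock_events\<close> is recorded because independence of different clocks and
  initial values is formulated for these set systems.\<close>

lemma ring_pattern:
  shows "{\<omega>\<in>space M. \<forall>k<K. ring_bit (\<lambda>x. R x \<omega>) m k x = b k} \<in> clock_events M (R x)" (is "?E \<in> _")
    and "prob {\<omega>\<in>space M. \<forall>k<K. ring_bit (\<lambda>x. R x \<omega>) m k x = b k}
      = (\<Prod>k<K. if b k then ring_prob m else 1 - ring_prob m)"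
proof -
  let ?N = "\<lambda>k. rings (R x) (real k / 2 ^ m) (real (Suc k) / 2 ^ m)"
  let ?G = "{rings (R x) s t -` {k} \<inter> space M |s t k. 0 \<le> s \<and> s < t}"
  define B where "B k = {\<omega>\<in>space M. ring_bit (\<lambda>x. R x \<omega>) m k x = b k}" for k
  have B1: "B k = space M - ?N k -` {0} \<inter> space M" if "b k" for k
    using that by (auto simp: B_def ring_bit_rings)
  have B0: "B k = ?N k -` {0} \<inter> space M" if "\<not> b k" for k
    using that by (auto simp: B_def ring_bit_rings)
  interpret C: sigma_algebra "space M" "sigma_sets (space M) ?G"
    by (rule sigma_algebra_sigma_sets) auto
  have z: "?N k -` {0} \<inter> space M \<in> sigma_sets (space M) ?G" for k
  proof (rule sigma_sets.Basic)
    have "0 \<le> real k / 2 ^ m" by simp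
    then show "?N k -` {0} \<inter> space M \<in> ?G" using mesh_less[of k m] by blast
  qed
  have Bs: "B k \<in> sigma_sets (space M) ?G" for k
  proof (cases "b k")
    case True
    show ?thesis unfolding B1[OF True] by (rule C.compl_sets[OF z])
  next
    case False
    show ?thesis unfolding B0[OF False] by (rule z)
  qed
  have E: "?E = space M \<inter> (\<Inter>k\<in>{..<K}. B k)" unfolding B_def by blast
  have "space M \<inter> (\<Inter>k\<in>{..<K}. B k) \<in> sigma_sets (space M) ?G"
  proof (induction K)
    case 0
    have "space M \<inter> (\<Inter>k\<in>{..<0::nat}. B k) = space M" by simp
    then show ?case by (rule ssubst) (rule C.top)
  next
    case (Suc K)
    have "space M \<inter> (\<Inter>k\<in>{..<Suc K}. B k) = (space M \<inter> (\<Inter>k\<in>{..<K}. B k)) \<inter> B K"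
      unfolding lessThan_Suc by blast
    then show ?case by (rule ssubst) (rule C.Int[OF Suc Bs])
  qed
  then show "?E \<in> clock_events M (R x)" unfolding E clock_events_def .
  show "prob ?E = (\<Prod>k<K. if b k then ring_prob m else 1 - ring_prob m)"
  \<comment> \<open>An intersection over no indices would be the whole type instead of
    \<open>space M\<close>.\<close>
  proof (cases "K = 0")
    case False
    have "strict_mono (\<lambda>i::nat. real i / 2 ^ m)"
      using mesh_less by (intro strict_monoI_Suc)
    then have ind: "indep_vars (\<lambda>_. count_space UNIV) ?N UNIV"
      using clock[of x] unfolding poisson_clock_def
      by (elim conjE, drule_tac spec[of _ "\<lambda>i::nat. real i / 2 ^ m"]) simp
    have B': "B k = ?N k -` (if b k then - {0} else {0}) \<inter> space M" for k
    proof (cases "b k")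
      case True
      have "space M - ?N k -` {0} \<inter> space M = ?N k -` (- {0}) \<inter> space M" by blast
      then show ?thesis using B1[OF True] True by (simp only: if_True)
    next
      case False
      then show ?thesis using B0[OF False] by (simp only: if_False)
    qed
    have "?E = (\<Inter>k\<in>{..<K}. ?N k -` (if b k then - {0} else {0}) \<inter> space M)"
    proof -
      have "0 \<in> {..<K}" using False by simp
      then have "(\<Inter>k\<in>{..<K}. B k) \<subseteq> B 0" by (rule INT_lower)
      also have "\<dots> \<subseteq> space M" unfolding B_def by (rule Collect_restrict)
      finally show ?thesis unfolding B'[symmetric] E by (rule Int_absorb1)
    qed
    also have "prob \<dots> = (\<Prod>k<K. prob (?N k -` (if b k then - {0} else {0}) \<inter> space M))"
      by (rule indep_varsD[OF ind]) (use False in auto)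
    also have "\<dots> = (\<Prod>k<K. if b k then ring_prob m else 1 - ring_prob m)"
      unfolding B'[symmetric] unfolding B_def prob_ring_bit ..
    finally show ?thesis .
  next
    case True
    then have "?E = space M" by auto
    then show ?thesis using True by (simp add: prob_space)
  qed
qed

text \<open>The pattern event is an intersection with one member for each initial value and one for
  each clock. Independence across these splits it, and \<open>ring_pattern\<close> splits each clock
  further over the steps.\<close>

lemma bernoulli_sites_steps:
  assumes "finite V"
  shows "bernoulli_on (bits p m) (rate p m) (sites_steps V K)"
  unfolding bernoulli_on_def
proof (intro conjI ballI allI)
  show "finite (sites_steps V K)" using assms by (simp add: sites_steps_def)
  fix i assume "i \<in> sites_steps V K"
  show "{\<omega>\<in>space M. bits p m i \<omega>} \<in> events"
  proof (cases i)
    case (Inl x)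
    then show ?thesis using init_measurable[of x] by (simp add: bits_def)
  next
    case (Inr y)
    obtain x k where y: "y = (x, k)" by (cases y)
    have "rings (R x) (real k / 2 ^ m) (real (Suc k) / 2 ^ m) -` (- {0}) \<inter> space M \<in> events"
      using rings_measurable by (rule measurable_sets) simp
    moreover have "{\<omega>\<in>space M. bits p m i \<omega>} =
        rings (R x) (real k / 2 ^ m) (real (Suc k) / 2 ^ m) -` (- {0}) \<inter> space M"
      by (auto simp: bits_def Inr y ring_bit_rings)
    ultimately show ?thesis by simp
  qed
next
  fix b :: "bit_index \<Rightarrow> bool"
  show "prob {\<omega>\<in>space M. \<forall>i\<in>sites_steps V K. bits p m i \<omega> = b i} =
    (\<Prod>i\<in>sites_steps V K. if b i then rate p m i else 1 - rate p m i)"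
  proof (cases "V = {}")
    case True
    then show ?thesis by (simp add: sites_steps_def prob_space)
  next
    case False
    define A where "A j = (case j of Inl x \<Rightarrow> {\<omega>\<in>space M. (\<eta> 0 x \<omega> \<le> p) = b (Inl x)}
      | Inr x \<Rightarrow> {\<omega>\<in>space M. \<forall>k<K. ring_bit (\<lambda>x. R x \<omega>) m k x = b (Inr (x, k))})" for j :: "site + site"
    define J where "J = Inl ` V \<union> Inr ` V"
    let ?F = "case_sum (\<lambda>x. value_events M (\<eta> 0 x)) (\<lambda>x. clock_events M (R x))"
    have ind: "indep_sets ?F UNIV" using dyn unfolding median_dynamics_def by blast
    have AF: "A j \<in> ?F j" for j
    proof (cases j)
      case (Inl x)
      have "A j = \<eta> 0 x -` (if b (Inl x) then {..p} else {p<..}) \<inter> space M"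
        by (auto simp: A_def Inl not_le)
      moreover have "(if b (Inl x) then {..p} else {p<..}) \<in> sets borel" by simp
      ultimately show ?thesis unfolding Inl value_events_def sum.case by blast
    next
      case (Inr x)
      then show ?thesis using ring_pattern(1)[of K m x "\<lambda>k. b (Inr (x, k))"] by (simp add: A_def)
    qed
    have "{\<omega>\<in>space M. \<forall>i\<in>sites_steps V K. bits p m i \<omega> = b i} = (\<Inter>j\<in>J. A j)"
    proof (intro equalityI subsetI)
      fix \<omega> assume w: "\<omega> \<in> {\<omega>\<in>space M. \<forall>i\<in>sites_steps V K. bits p m i \<omega> = b i}"
      have "\<omega> \<in> A (Inl x)" if "x \<in> V" for x
      proof -
        have "Inl x \<in> sites_steps V K" using that by (simp add: sites_steps_def)
        then have "bits p m (Inl x) \<omega> = b (Inl x)" using w by blast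
        then show ?thesis using w by (simp add: A_def bits_def)
      qed
      moreover have "\<omega> \<in> A (Inr x)" if "x \<in> V" for x
      proof -
        have "bits p m (Inr (x, k)) \<omega> = b (Inr (x, k))" if "k < K" for k
        proof -
          have "Inr (x, k) \<in> sites_steps V K" using that \<open>x \<in> V\<close> by (simp add: sites_steps_def)
          then show ?thesis using w by blast
        qed
        then show ?thesis using w by (simp add: A_def bits_def)
      qed
      ultimately show "\<omega> \<in> (\<Inter>j\<in>J. A j)" unfolding J_def by blast
    next
      fix \<omega> assume w: "\<omega> \<in> (\<Inter>j\<in>J. A j)"
      obtain x where "x \<in> V" using False by blast
      then have "\<omega> \<in> A (Inl x)" using w by (auto simp: J_def)
      then have "\<omega> \<in> space M" by (simp add: A_def)
      moreover have "bits p m i \<omega> = b i" if "i \<in> sites_steps V K" for i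
      proof (cases i)
        case (Inl x)
        then have "Inl x \<in> J" using that by (auto simp: sites_steps_def J_def)
        then have "\<omega> \<in> A (Inl x)" using w by blast
        then show ?thesis by (simp add: A_def Inl bits_def)
      next
        case (Inr y)
        obtain x k where y: "y = (x, k)" by (cases y)
        have "Inr x \<in> J" "k < K" using that Inr y by (auto simp: sites_steps_def J_def)
        then have "\<omega> \<in> A (Inr x)" using w by blast
        then show ?thesis using \<open>k < K\<close> by (simp add: A_def Inr y bits_def)
      qed
      ultimately show "\<omega> \<in> {\<omega>\<in>space M. \<forall>i\<in>sites_steps V K. bits p m i \<omega> = b i}" by blast
    qed
    also have "prob (\<Inter>j\<in>J. A j) = (\<Prod>j\<in>J. prob (A j))"
      by (rule indep_setsD[OF ind]) (use AF False assms in \<open>auto simp: J_def\<close>)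
    also have "\<dots> = (\<Prod>x\<in>V. prob (A (Inl x))) * (\<Prod>x\<in>V. prob (A (Inr x)))"
      unfolding J_def using assms by (subst prod.union_disjoint) (auto simp: prod.reindex)
    also have "(\<Prod>x\<in>V. prob (A (Inl x))) = (\<Prod>x\<in>V. if b (Inl x) then rate p m (Inl x) else 1 - rate p m (Inl x))"
    proof (intro prod.cong refl)
      fix x
      have ev: "{\<omega>\<in>space M. \<eta> 0 x \<omega> \<le> p} \<in> events" using init_measurable[of x] by simp
      show "prob (A (Inl x)) = (if b (Inl x) then rate p m (Inl x) else 1 - rate p m (Inl x))"
      proof (cases "b (Inl x)")
        case True then show ?thesis by (simp add: A_def rate_def prob_init)
      next
        case False
        then have "A (Inl x) = space M - {\<omega>\<in>space M. \<eta> 0 x \<omega> \<le> p}" by (auto simp: A_def)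
        then show ?thesis using prob_compl[OF ev] False by (simp add: rate_def prob_init)
      qed
    qed
    also have "(\<Prod>x\<in>V. prob (A (Inr x))) =
        (\<Prod>i\<in>V \<times> {..<K}. if b (Inr i) then rate p m (Inr i) else 1 - rate p m (Inr i))"
    proof -
      have "(\<Prod>x\<in>V. prob (A (Inr x))) = (\<Prod>x\<in>V. \<Prod>k<K. if b (Inr (x, k)) then ring_prob m else 1 - ring_prob m)"
        by (simp add: A_def ring_pattern(2))
      also have "\<dots> = (\<Prod>(x, k)\<in>V \<times> {..<K}. if b (Inr (x, k)) then ring_prob m else 1 - ring_prob m)"
        by (rule prod.cartesian_product)
      also have "\<dots> = (\<Prod>i\<in>V \<times> {..<K}. if b (Inr i) then rate p m (Inr i) else 1 - rate p m (Inr i))"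
        by (intro prod.cong refl) (simp add: rate_def case_prod_unfold)
      finally show ?thesis .
    qed
    also have "(\<Prod>x\<in>V. if b (Inl x) then rate p m (Inl x) else 1 - rate p m (Inl x)) * \<dots> =
        (\<Prod>i\<in>sites_steps V K. if b i then rate p m i else 1 - rate p m i)"
      unfolding sites_steps_def using assms by (subst prod.union_disjoint) (auto simp: prod.reindex)
    finally show ?thesis .
  qed
qed

lemma bernoulli_bits:
  assumes "finite I"
  shows "bernoulli_on (bits p m) (rate p m) I"
proof -
  define V where "V = {x. Inl x \<in> I} \<union> fst ` {y. Inr y \<in> I}"
  define K where "K = Suc (Max (insert 0 (snd ` {y. Inr y \<in> I})))"
  have f: "finite {x. Inl x \<in> I}" "finite {y. Inr y \<in> I}"
    using finite_vimageI[OF assms, of Inl] finite_vimageI[OF assms, of Inr] by (simp_all add: vimage_def)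
  then have V: "finite V" by (simp add: V_def)
  have "I \<subseteq> sites_steps V K"
  proof
    fix i assume i: "i \<in> I"
    show "i \<in> sites_steps V K"
    proof (cases i)
      case (Inl x) then show ?thesis using i by (auto simp: sites_steps_def V_def)
    next
      case (Inr y)
      have "snd y \<le> Max (insert 0 (snd ` {y. Inr y \<in> I}))"
        using f i Inr by (intro Max_ge) auto
      then have "y \<in> V \<times> {..<K}" using i Inr by (cases y) (force simp: V_def K_def)
      then show ?thesis by (auto simp: sites_steps_def Inr)
    qed
  qed
  with bernoulli_sites_steps[OF V] show ?thesis by (rule bernoulli_on_subset)
qed

end

lemma local_on_lift:
  fixes A :: "('i \<Rightarrow> bool) \<Rightarrow> 'c"
  shows "local_on I A \<Longrightarrow> local_on I (\<lambda>b. f (A b))"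
  unfolding local_on_def
proof (intro allI impI)
  fix s s' :: "'i \<Rightarrow> bool"
  assume "\<forall>s s'. (\<forall>x\<in>I. s x = s' x) \<longrightarrow> A s = A s'" "\<forall>x\<in>I. s x = s' x"
  then have "A s = A s'" by blast
  then show "f (A s) = f (A s')" by simp
qed

lemma local_on_lift2:
  fixes A :: "('i \<Rightarrow> bool) \<Rightarrow> 'c" and B :: "('i \<Rightarrow> bool) \<Rightarrow> 'd"
  shows "local_on I A \<Longrightarrow> local_on I B \<Longrightarrow> local_on I (\<lambda>b. f (A b) (B b))"
  unfolding local_on_def
proof (intro allI impI)
  fix s s' :: "'i \<Rightarrow> bool"
  assume "\<forall>s s'. (\<forall>x\<in>I. s x = s' x) \<longrightarrow> A s = A s'" "\<forall>s s'. (\<forall>x\<in>I. s x = s' x) \<longrightarrow> B s = B s'"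
    "\<forall>x\<in>I. s x = s' x"
  then have "A s = A s'" "B s = B s'" by blast+
  then show "f (A s) (B s) = f (A s') (B s')" by simp
qed

lemma local_on_coord: "i \<in> I \<Longrightarrow> local_on I (\<lambda>b. b i)"
  by (simp add: local_on_def)

lemma local_on_sum: "(\<And>j. j \<in> J \<Longrightarrow> local_on I (\<phi> j)) \<Longrightarrow> local_on I (\<lambda>b. \<Sum>j\<in>J. \<phi> j b)"
  unfolding local_on_def by (intro allI impI sum.cong refl) blast

section \<open>Finite range of dependence and backward chains\<close>

definition nbs :: "site set \<Rightarrow> site set" where
  "nbs W = (\<Union>x\<in>W. nb x)"

fun reach :: "nat \<Rightarrow> site set \<Rightarrow> site set" where
  "reach 0 W = W"
| "reach (Suc k) W = reach k (nbs W)"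

lemma self_in_nb [simp]: "x \<in> nb x"
  by (simp add: nb_eq)

lemma subset_nbs: "W \<subseteq> nbs W"
  by (auto simp: nbs_def)

lemma subset_reach: "W \<subseteq> reach k W"
proof (induction k arbitrary: W)
  case (Suc k)
  have "W \<subseteq> nbs W" by (rule subset_nbs)
  also have "\<dots> \<subseteq> reach k (nbs W)" by (rule Suc)
  finally show ?case by simp
qed simp

lemma reach_mono: "W \<subseteq> W' \<Longrightarrow> reach k W \<subseteq> reach k W'"
proof (induction k arbitrary: W W')
  case (Suc k)
  have "nbs W \<subseteq> nbs W'" using Suc.prems by (auto simp: nbs_def)
  then show ?case using Suc.IH by simp
qed simp

lemma finite_nbs [simp]: "finite W \<Longrightarrow> finite (nbs W)"
  by (simp add: nbs_def)

lemma finite_reach [simp]: "finite W \<Longrightarrow> finite (reach k W)"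
  by (induction k arbitrary: W) auto

lemma sites_steps_mono: "V \<subseteq> V' \<Longrightarrow> K \<le> K' \<Longrightarrow> sites_steps V K \<subseteq> sites_steps V' K'"
  by (auto simp: sites_steps_def)

lemma finite_sites_steps [simp]: "finite V \<Longrightarrow> finite (sites_steps V K)"
  by (simp add: sites_steps_def)

definition spin :: "nat \<Rightarrow> (bit_index \<Rightarrow> bool) \<Rightarrow> site \<Rightarrow> bool" where
  "spin k b = pca maj (\<lambda>x. b (Inl x)) (\<lambda>k x. b (Inr (x, k))) k"

lemma spin_0: "spin 0 b x = b (Inl x)"
  by (simp add: spin_def)

lemma spin_Suc: "spin (Suc k) b x = (if b (Inr (x, k)) then maj (spin k b) x else spin k b x)"
  by (simp add: spin_def)

lemma spin_cong:
  assumes "\<And>i. i \<in> sites_steps (reach k W) k \<Longrightarrow> b i = b' i" "x \<in> W"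
  shows "spin k b x = spin k b' x"
  using assms
proof (induction k arbitrary: W x)
  case 0
  then show ?case by (simp add: spin_0 sites_steps_def)
next
  case (Suc k)
  have sub: "sites_steps (reach k (nbs W)) k \<subseteq> sites_steps (reach (Suc k) W) (Suc k)"
    by (rule sites_steps_mono) auto
  have eq: "spin k b y = spin k b' y" if "y \<in> nb x" for y
    by (rule Suc.IH[of "nbs W"]) (use Suc.prems that sub in \<open>auto simp: nbs_def\<close>)
  have "x \<in> reach (Suc k) W" using Suc.prems(2) subset_reach by blast
  then have "b (Inr (x, k)) = b' (Inr (x, k))"
    by (intro Suc.prems(1)) (simp add: sites_steps_def)
  moreover have "maj (spin k b) x = maj (spin k b') x" by (rule maj_cong) (rule eq)
  ultimately show ?case using eq[of x] by (simp add: spin_Suc)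
qed

lemma local_on_spin: "local_on W A \<Longrightarrow> local_on (sites_steps (reach k W) k) (\<lambda>b. A (spin k b))"
  unfolding local_on_def[of "sites_steps (reach k W) k"]
  using spin_cong by (intro allI impI local_onD[of W A]) blast+

text \<open>The trace on a mesh of \<open>n\<close> links of a chain as in \<open>no_chain\<close>,
  read backwards from \<open>x\<close> and step \<open>K\<close>.\<close>

fun chain :: "nat \<Rightarrow> site \<Rightarrow> nat \<Rightarrow> (bit_index \<Rightarrow> bool) \<Rightarrow> bool" where
  "chain 0 x K b = True"
| "chain (Suc n) x K b = (\<exists>k<K. b (Inr (x, k)) \<and> (\<exists>y\<in>nb x. chain n y k b))"

lemma chain_cong:
  assumes "\<And>i. i \<in> sites_steps (reach n {x}) K \<Longrightarrow> b i = b' i"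
  shows "chain n x K b = chain n x K b'"
  using assms
proof (induction n arbitrary: x K)
  case (Suc n)
  have "chain n y k b = chain n y k b'" if "k < K" "y \<in> nb x" for k y
  proof (rule Suc.IH)
    have "reach n {y} \<subseteq> reach (Suc n) {x}" using that by (auto intro!: reach_mono simp: nbs_def)
    then have "sites_steps (reach n {y}) k \<subseteq> sites_steps (reach (Suc n) {x}) K"
      using that by (intro sites_steps_mono) auto
    then show "b i = b' i" if "i \<in> sites_steps (reach n {y}) k" for i using Suc.prems that by blast
  qed
  moreover have "b (Inr (x, k)) = b' (Inr (x, k))" if "k < K" for k
    using that subset_reach[of "{x}" "Suc n"] by (intro Suc.prems) (auto simp: sites_steps_def)
  ultimately show ?case unfolding chain.simps by blast
qed simp

lemma local_on_chain: "local_on (sites_steps (reach n {x}) K) (chain n x K)"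
  unfolding local_on_def using chain_cong by blast

lemma ring_bit_index:
  assumes "s \<in> C x" "0 < s"
  shows "ring_bit C m (nat \<lceil>s * 2 ^ m\<rceil> - 1) x"
proof -
  have pos: "0 < s * 2 ^ m" using assms by simp
  let ?k = "nat \<lceil>s * 2 ^ m\<rceil> - 1"
  have "real ?k < s * 2 ^ m" "s * 2 ^ m \<le> real (Suc ?k)" using pos by linarith+
  then have "s \<in> {real ?k / 2 ^ m <.. real (Suc ?k) / 2 ^ m}" by (simp add: field_simps)
  then show ?thesis using assms unfolding ring_bit_def by blast
qed

text \<open>In a fine mesh consecutive rings of the chain are more than one mesh width apart and
  fall into distinct steps in the right order. Only finitely many links can be separated at once, so
  \<open>n\<close> is fixed before the mesh.\<close>

lemma chain_of_rings:
  assumes "\<And>i. ts i \<in> C (xs i) \<and> ts (Suc i) < ts i \<and> xs (Suc i) \<in> nb (xs i)"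
    and "\<And>x. C x \<subseteq> {0<..}"
  shows "\<forall>\<^sub>F m in sequentially. \<forall>K. ts j * 2 ^ m \<le> real K \<longrightarrow>
    chain n (xs j) K (\<lambda>i. case i of Inl x \<Rightarrow> u x | Inr (x, k) \<Rightarrow> ring_bit C m k x)"
proof (induction n arbitrary: j)
  case (Suc n)
  have "\<forall>\<^sub>F m in sequentially. 1 < (ts j - ts (Suc j)) * 2 ^ m"
    using assms(1)[of j] by (intro eventually_fine) simp
  with Suc[of "Suc j"] show ?case
  proof eventually_elim
    case (elim m)
    show ?case
    proof (intro allI impI)
      fix K assume K: "ts j * 2 ^ m \<le> real K"
      let ?k = "nat \<lceil>ts j * 2 ^ m\<rceil> - 1"
      have ring: "ts j \<in> C (xs j)" "0 < ts j" using assms(1)[of j] assms(2)[of "xs j"] by auto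
      then have pos: "0 < ts j * 2 ^ m" by simp
      have "?k < K" using pos K by linarith
      moreover have "ring_bit C m ?k (xs j)" using ring by (rule ring_bit_index)
      moreover have "ts (Suc j) * 2 ^ m + 1 < ts j * 2 ^ m" using elim(2) by (simp add: algebra_simps)
      then have "ts (Suc j) * 2 ^ m \<le> real ?k" using pos by linarith
      moreover have "xs (Suc j) \<in> nb (xs j)" using assms(1) by blast
      ultimately show "chain (Suc n) (xs j) K (\<lambda>i. case i of Inl x \<Rightarrow> u x | Inr (x, k) \<Rightarrow> ring_bit C m k x)"
        using elim(1) by auto
    qed
  qed
qed simp

context prob_space
begin

lemma prob_tendsto:
  assumes "\<And>m. A m \<in> events" "B \<in> events" "AE \<omega> in M. \<forall>\<^sub>F m in sequentially. \<omega> \<in> A m \<longleftrightarrow> \<omega> \<in> B"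
  shows "(\<lambda>m. prob (A m)) \<longlonglongrightarrow> prob B"
proof -
  have "(\<lambda>m. expectation (indicator (A m))) \<longlonglongrightarrow> expectation (indicator B :: 'a \<Rightarrow> real)"
  proof (rule integral_dominated_convergence[where w = "\<lambda>_. 1"])
    show "AE \<omega> in M. (\<lambda>m. indicator (A m) \<omega>) \<longlonglongrightarrow> (indicator B \<omega> :: real)"
      using assms(3)
    proof eventually_elim
      case (elim \<omega>)
      show ?case
        by (rule tendsto_eventually, rule eventually_mono[OF elim]) (simp add: indicator_def)
    qed
  qed (use assms in \<open>auto simp: indicator_def\<close>)
  then show ?thesis using assms by simp
qed

lemma events_tail_Int:
  assumes "\<And>m::nat. A m \<in> events"
  shows "(\<Inter>m\<in>{k..}. A m) \<in> events"
proof (rule sets.countable_INT')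
  show "A ` {k..} \<subseteq> events" using assms by blast
qed auto

lemma events_liminf: "(\<And>m::nat. A m \<in> events) \<Longrightarrow> (\<Union>k. \<Inter>m\<in>{k..}. A m) \<in> events"
  by (intro sets.countable_UN) (use events_tail_Int in blast)

lemma prob_liminf_le:
  fixes A :: "nat \<Rightarrow> 'a set"
  assumes "\<And>m. A m \<in> events" "\<And>m. m \<ge> m0 \<Longrightarrow> prob (A m) \<le> c"
  shows "prob (\<Union>k. \<Inter>m\<in>{k..}. A m) \<le> c"
proof -
  note ev = events_tail_Int[of A, OF assms(1)]
  have lim: "(\<lambda>k. prob (\<Inter>m\<in>{k..}. A m)) \<longlonglongrightarrow> prob (\<Union>k. \<Inter>m\<in>{k..}. A m)"
    by (rule finite_Lim_measure_incseq) (use ev in \<open>auto simp: incseq_def\<close>)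
  have "prob (\<Inter>m\<in>{k..}. A m) \<le> c" if "m0 \<le> k" for k
  proof -
    have "prob (\<Inter>m\<in>{k..}. A m) \<le> prob (A k)" using assms(1) by (intro finite_measure_mono) auto
    then show ?thesis using assms(2)[OF that] by linarith
  qed
  then show ?thesis using lim by (intro LIMSEQ_le_const2[OF lim]) blast
qed

lemma local_bits_event:
  assumes "bernoulli_on X q I" "local_on I A"
  shows "{\<omega>\<in>space M. A (\<lambda>i. X i \<omega>)} \<in> events"
proof -
  have "local_on I (\<lambda>b. of_bool (A b) :: real)" by (rule local_on_lift[OF assms(2)])
  from local_integrable[OF assms(1) this]
  have "(\<lambda>\<omega>. of_bool (A (\<lambda>i. X i \<omega>)) :: real) \<in> borel_measurable M" by (rule borel_measurable_integrable)
  then have "{\<omega>\<in>space M. of_bool (A (\<lambda>i. X i \<omega>)) = (1::real)} \<in> events" by measurable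
  then show ?thesis by simp
qed

lemma prob_eq_expectation:
  assumes "{\<omega>\<in>space M. A \<omega>} \<in> events"
  shows "prob {\<omega>\<in>space M. A \<omega>} = expectation (\<lambda>\<omega>. of_bool (A \<omega>))"
proof -
  have "expectation (\<lambda>\<omega>. of_bool (A \<omega>) :: real) = expectation (indicator {\<omega>\<in>space M. A \<omega>})"
    by (intro Bochner_Integration.integral_cong) (auto simp: indicator_def)
  then show ?thesis using assms by simp
qed

end

context median_process
begin

definition EE :: "real \<Rightarrow> nat \<Rightarrow> ((bit_index \<Rightarrow> bool) \<Rightarrow> real) \<Rightarrow> real" where
  "EE p m \<phi> = expectation (\<lambda>\<omega>. \<phi> (\<lambda>i. bits p m i \<omega>))"

lemma integrable_bits: "finite I \<Longrightarrow> local_on I \<phi> \<Longrightarrow> integrable M (\<lambda>\<omega>. \<phi> (\<lambda>i. bits p m i \<omega>) :: real)"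
  by (rule local_integrable[OF bernoulli_bits])

lemma EE_mono: "finite I \<Longrightarrow> local_on I \<phi> \<Longrightarrow> local_on I \<psi> \<Longrightarrow> (\<And>b. \<phi> b \<le> \<psi> b) \<Longrightarrow> EE p m \<phi> \<le> EE p m \<psi>"
  unfolding EE_def by (intro integral_mono integrable_bits)

lemma EE_sum:
  "finite I \<Longrightarrow> (\<And>j. j \<in> J \<Longrightarrow> local_on I (\<phi> j)) \<Longrightarrow> EE p m (\<lambda>b. \<Sum>j\<in>J. \<phi> j b) = (\<Sum>j\<in>J. EE p m (\<phi> j))"
  unfolding EE_def by (intro Bochner_Integration.integral_sum integrable_bits)

lemma EE_add:
  "finite I \<Longrightarrow> local_on I \<phi> \<Longrightarrow> local_on I \<psi> \<Longrightarrow> EE p m (\<lambda>b. \<phi> b + \<psi> b) = EE p m \<phi> + EE p m \<psi>"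
  unfolding EE_def by (intro Bochner_Integration.integral_add integrable_bits)

lemma EE_indep:
  assumes "finite I" "finite J" "I \<inter> J = {}" "local_on I f" "local_on J g"
  shows "EE p m (\<lambda>b. f b * g b) = EE p m f * EE p m g"
  unfolding EE_def by (rule local_independence[OF bernoulli_bits]) (use assms in auto)

lemma EE_ring: "EE p m (\<lambda>b. of_bool (b (Inr (x, k)))) = ring_prob m"
proof -
  have "Pow {Inr (x, k) :: bit_index} = {{}, {Inr (x, k)}}" by auto
  moreover have "EE p m (\<lambda>b. of_bool (b (Inr (x, k)))) =
    (\<Sum>S\<in>Pow {Inr (x, k)}. of_bool (Inr (x, k) \<in> S) * (\<Prod>i\<in>{Inr (x, k)}. if i \<in> S then rate p m i else 1 - rate p m i))"
    unfolding EE_def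
    by (rule local_expectation[OF bernoulli_bits, of "{Inr (x, k)}" "\<lambda>b. of_bool (b (Inr (x, k)))"])
      (auto simp: local_on_def)
  ultimately show ?thesis by (simp add: rate_def)
qed

text \<open>First moment bound: the bit at step \<open>k\<close> is independent of the chain
  continuing below \<open>k\<close>, and there are five neighbours, so a link costs a sum over
  \<open>k\<close> of terms \<open>5 * ring_prob m\<close>. Against the weight
  \<open>(1 + 10 * ring_prob m) ^ k\<close> a sum with 10 in place of 5 telescopes; the weight was
  chosen with twice the number of neighbours to leave a factor 1/2 per link.\<close>

lemma EE_chain: "EE p m (\<lambda>b. of_bool (chain n x K b)) \<le> (1 + 10 * ring_prob m) ^ K / 2 ^ n"
proof (induction n arbitrary: x K)
  case 0
  have "1 \<le> (1 + 10 * ring_prob m) ^ K" using ring_prob_bounds by (intro one_le_power) auto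
  then show ?case by (simp add: EE_def prob_space)
next
  case (Suc n)
  let ?r = "ring_prob m"
  let ?I = "sites_steps (reach (Suc n) {x}) K"
  have loc1: "local_on ?I (\<lambda>b. of_bool (b (Inr (x, k))) * of_bool (chain n y k b) :: real)"
    if "k < K" "y \<in> nb x" for k y
  proof -
    have "reach n {y} \<subseteq> reach (Suc n) {x}" using that by (auto intro!: reach_mono simp: nbs_def)
    then have "sites_steps (reach n {y}) k \<subseteq> ?I" using that by (intro sites_steps_mono) auto
    then have "local_on ?I (chain n y k)" using local_on_chain local_on_mono by blast
    moreover have "Inr (x, k) \<in> ?I"
      using that subset_reach[of "{x}" "Suc n"] by (auto simp: sites_steps_def)
    ultimately show ?thesis
      by (intro local_on_lift2[of _ _ _ "(*)"] local_on_lift[of _ _ of_bool] local_on_coord)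
  qed
  have "EE p m (\<lambda>b. of_bool (chain (Suc n) x K b))
      \<le> EE p m (\<lambda>b. \<Sum>k<K. \<Sum>y\<in>nb x. of_bool (b (Inr (x, k))) * of_bool (chain n y k b))"
  proof (rule EE_mono[of ?I])
    show "local_on ?I (\<lambda>b. of_bool (chain (Suc n) x K b) :: real)"
      by (rule local_on_lift[OF local_on_chain])
    show "local_on ?I (\<lambda>b. \<Sum>k<K. \<Sum>y\<in>nb x. of_bool (b (Inr (x, k))) * of_bool (chain n y k b) :: real)"
      by (intro local_on_sum loc1) auto
    fix b
    show "(of_bool (chain (Suc n) x K b) :: real)
        \<le> (\<Sum>k<K. \<Sum>y\<in>nb x. of_bool (b (Inr (x, k))) * of_bool (chain n y k b))"
    proof (cases "chain (Suc n) x K b")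
      case True
      then obtain k y where ky: "k < K" "b (Inr (x, k))" "y \<in> nb x" "chain n y k b" by auto
      have "(1::real) = of_bool (b (Inr (x, k))) * of_bool (chain n y k b)" using ky by simp
      also have "\<dots> \<le> (\<Sum>y\<in>nb x. of_bool (b (Inr (x, k))) * of_bool (chain n y k b))"
        by (rule member_le_sum[of y]) (use ky in auto)
      also have "\<dots> \<le> (\<Sum>k<K. \<Sum>y\<in>nb x. of_bool (b (Inr (x, k))) * of_bool (chain n y k b))"
        by (rule member_le_sum[of k]) (use ky in \<open>auto intro!: sum_nonneg\<close>)
      finally show ?thesis by simp
    next
      case False
      have "0 \<le> (\<Sum>k<K. \<Sum>y\<in>nb x. of_bool (b (Inr (x, k))) * of_bool (chain n y k b) :: real)"
        by (intro sum_nonneg) auto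
      moreover have "(of_bool (chain (Suc n) x K b) :: real) = 0" unfolding of_bool_eq_0_iff by (rule False)
      ultimately show ?thesis by linarith
    qed
  qed simp
  also have "\<dots> = (\<Sum>k<K. \<Sum>y\<in>nb x. EE p m (\<lambda>b. of_bool (b (Inr (x, k))) * of_bool (chain n y k b)))"
  proof -
    have "EE p m (\<lambda>b. \<Sum>k<K. \<Sum>y\<in>nb x. of_bool (b (Inr (x, k))) * of_bool (chain n y k b))
      = (\<Sum>k<K. EE p m (\<lambda>b. \<Sum>y\<in>nb x. of_bool (b (Inr (x, k))) * of_bool (chain n y k b)))"
    proof (rule EE_sum[of ?I])
      fix k assume "k \<in> {..<K}"
      then show "local_on ?I (\<lambda>b. \<Sum>y\<in>nb x. of_bool (b (Inr (x, k))) * of_bool (chain n y k b) :: real)"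
        by (intro local_on_sum loc1) auto
    qed simp
    also have "\<dots> = (\<Sum>k<K. \<Sum>y\<in>nb x. EE p m (\<lambda>b. of_bool (b (Inr (x, k))) * of_bool (chain n y k b)))"
      by (intro sum.cong refl EE_sum[of ?I] loc1) auto
    finally show ?thesis .
  qed
  also have "\<dots> \<le> (\<Sum>k<K. \<Sum>y\<in>nb x. ?r * ((1 + 10 * ?r) ^ k / 2 ^ n))"
  proof (intro sum_mono)
    fix k y
    have "EE p m (\<lambda>b. of_bool (b (Inr (x, k))) * of_bool (chain n y k b))
        = EE p m (\<lambda>b. of_bool (b (Inr (x, k)))) * EE p m (\<lambda>b. of_bool (chain n y k b))"
    proof (rule EE_indep)
      show "local_on (sites_steps (reach n {y}) k) (\<lambda>b. of_bool (chain n y k b) :: real)"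
        by (rule local_on_lift[OF local_on_chain])
      show "local_on {Inr (x, k)} (\<lambda>b. of_bool (b (Inr (x, k))) :: real)" by (simp add: local_on_def)
    qed (auto simp: sites_steps_def)
    then show "EE p m (\<lambda>b. of_bool (b (Inr (x, k))) * of_bool (chain n y k b))
        \<le> ?r * ((1 + 10 * ?r) ^ k / 2 ^ n)"
      using mult_left_mono[OF Suc[of y k] ring_prob_bounds(1)[of m]] by (simp only: EE_ring)
  qed
  also have "\<dots> = (\<Sum>k<K. 10 * ?r * (1 + 10 * ?r) ^ k) / 2 ^ Suc n"
    by (simp add: card_nb sum_divide_distrib sum_distrib_left)
  also have "(\<Sum>k<K. 10 * ?r * (1 + 10 * ?r) ^ k) = (1 + 10 * ?r) ^ K - 1"
    using power_diff_1_eq[of "1 + 10 * ?r" K] by (simp add: sum_distrib_left)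
  also have "((1 + 10 * ?r) ^ K - 1) / 2 ^ Suc n \<le> (1 + 10 * ?r) ^ K / 2 ^ Suc n"
    by (intro divide_right_mono) auto
  finally show ?case .
qed

text \<open>Since \<open>ring_prob m \<le> 1 / 2 ^ m\<close>, the \<open>T * 2 ^ m\<close> steps up
  to time \<open>T\<close> give a bound that does not involve the mesh.\<close>

lemma prob_chain_le:
  "prob {\<omega>\<in>space M. chain n x (T * 2 ^ m) (\<lambda>i. bits p m i \<omega>)} \<le> exp (10 * real T) / 2 ^ n"
proof -
  have ev: "{\<omega>\<in>space M. chain n x (T * 2 ^ m) (\<lambda>i. bits p m i \<omega>)} \<in> events"
    by (rule local_bits_event[OF bernoulli_bits local_on_chain]) simp
  have "prob {\<omega>\<in>space M. chain n x (T * 2 ^ m) (\<lambda>i. bits p m i \<omega>)} \<le> (1 + 10 * ring_prob m) ^ (T * 2 ^ m) / 2 ^ n"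
    using EE_chain[of p m n x "T * 2 ^ m"] unfolding prob_eq_expectation[OF ev] EE_def .
  also have "(1 + 10 * ring_prob m) ^ (T * 2 ^ m) \<le> exp (10 / 2 ^ m) ^ (T * 2 ^ m)"
  proof (rule power_mono)
    have "1 + 10 * ring_prob m \<le> 1 + 10 / 2 ^ m" using ring_prob_bounds(3)[of m] by simp
    also have "\<dots> \<le> exp (10 / 2 ^ m)" by (rule exp_ge_add_one_self)
    finally show "1 + 10 * ring_prob m \<le> exp (10 / 2 ^ m)" .
  qed (use ring_prob_bounds(1)[of m] in simp)
  also have "exp (10 / 2 ^ m) ^ (T * 2 ^ m) = exp (10 * real T)"
    by (simp flip: exp_of_nat_mult)
  finally show ?thesis by (simp add: divide_right_mono)
qed

lemma clock_points:
  assumes "\<omega> \<in> space M"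
  shows "R x \<omega> \<subseteq> {0<..}" "finite (R x \<omega> \<inter> {..t})"
  using clock[of x] assms unfolding poisson_clock_def by blast+

lemma bits_eq:
  "(\<lambda>i. bits p m i \<omega>) = (\<lambda>i. case i of Inl x \<Rightarrow> \<eta> 0 x \<omega> \<le> p | Inr (x, k) \<Rightarrow> ring_bit (\<lambda>x. R x \<omega>) m k x)"
  by (simp add: bits_def)

text \<open>An infinite chain starting no later than \<open>T\<close> shows chains of every length
  \<open>n\<close> in all fine meshes. This has probability at most
  \<open>exp (10 * real T) / 2 ^ n\<close> for each \<open>n\<close>, which tends to 0.\<close>

lemma AE_no_chain: "AE \<omega> in M. no_chain (\<lambda>x. R x \<omega>)"
proof -
  let ?A = "\<lambda>n x T m. {\<omega>\<in>space M. chain n x (T * 2 ^ m) (\<lambda>i. bits 0 m i \<omega>)}"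
  let ?L = "\<lambda>n x T. \<Union>k. \<Inter>m\<in>{k..}. ?A n x T m"
  have ev: "?A n x T m \<in> events" for n x T m
    by (rule local_bits_event[OF bernoulli_bits local_on_chain]) simp
  have evL: "?L n x T \<in> events" for n x T
    by (rule events_liminf[OF ev])
  have null: "AE \<omega> in M. \<omega> \<notin> (\<Inter>n. ?L n x T)" for x T
  proof -
    have N: "(\<Inter>n. ?L n x T) \<in> events" by (rule sets.countable_INT) (use evL in \<open>blast, simp\<close>)
    have "prob (\<Inter>n. ?L n x T) \<le> exp (10 * real T) / 2 ^ n" for n
    proof -
      have "prob (\<Inter>n. ?L n x T) \<le> prob (?L n x T)" by (rule finite_measure_mono[OF _ evL]) blast
      also have "\<dots> \<le> exp (10 * real T) / 2 ^ n" by (rule prob_liminf_le[OF ev prob_chain_le])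
      finally show ?thesis .
    qed
    moreover have "(\<lambda>n. exp (10 * real T) / 2 ^ n) \<longlonglongrightarrow> 0" by (rule LIMSEQ_divide_realpow_zero) simp
    ultimately have "prob (\<Inter>n. ?L n x T) \<le> 0" by (intro LIMSEQ_le_const) auto
    then have "prob (\<Inter>n. ?L n x T) = 0" by (simp add: antisym)
    then show ?thesis using N prob_eq_0 by blast
  qed
  have "AE \<omega> in M. \<forall>x T. \<omega> \<notin> (\<Inter>n. ?L n x T)"
    unfolding AE_all_countable using null by blast
  with AE_space[of M] show ?thesis
  proof eventually_elim
    case (elim \<omega>)
    show ?case unfolding no_chain_def
    proof
      assume "\<exists>xs ts. \<forall>i::nat. ts i \<in> R (xs i) \<omega> \<and> ts (Suc i) < ts i \<and> xs (Suc i) \<in> nb (xs i)"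
      then obtain xs ts where ch: "\<And>i::nat. ts i \<in> R (xs i) \<omega> \<and> ts (Suc i) < ts i \<and> xs (Suc i) \<in> nb (xs i)"
        by blast
      obtain T :: nat where T: "ts 0 \<le> real T" using real_arch_simple by blast
      have "\<omega> \<in> ?L n (xs 0) T" for n
      proof -
        have "\<forall>\<^sub>F m in sequentially. \<forall>K. ts 0 * 2 ^ m \<le> real K \<longrightarrow> chain n (xs 0) K (\<lambda>i. bits 0 m i \<omega>)"
          unfolding bits_eq by (rule chain_of_rings[where C = "\<lambda>x. R x \<omega>" and ts = ts and xs = xs,
                OF ch clock_points(1)[OF elim(1)]])
        then have "\<forall>\<^sub>F m in sequentially. chain n (xs 0) (T * 2 ^ m) (\<lambda>i. bits 0 m i \<omega>)"
          by eventually_elim (use T in \<open>simp add: mult_right_mono\<close>)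
        then show ?thesis using elim(1) by (auto simp: eventually_sequentially)
      qed
      then show False using elim(2) by blast
    qed
  qed
qed

theorem AE_pca_converges:
  "AE \<omega> in M. \<forall>t\<ge>0. \<forall>x. \<forall>\<^sub>F m in sequentially.
     pca med (\<lambda>x. \<eta> 0 x \<omega>) (ring_bit (\<lambda>x. R x \<omega>) m) (nat \<lceil>t * 2 ^ m\<rceil>) x = \<eta> t x \<omega>"
proof -
  have "AE \<omega> in M. median_path z2_adj (\<lambda>x. R x \<omega>) (\<lambda>t x. \<eta> t x \<omega>)"
    using dyn unfolding median_dynamics_def by blast
  with AE_space[of M] AE_no_chain show ?thesis
  proof eventually_elim
    case (elim \<omega>)
    show ?case
      using pca_converges[OF elim(3) clock_points[OF elim(1)] elim(2)] by blast
  qed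
qed

lemma spin_bits: "spin k (\<lambda>i. bits p m i \<omega>) x \<longleftrightarrow>
    pca med (\<lambda>x. \<eta> 0 x \<omega>) (ring_bit (\<lambda>x. R x \<omega>) m) k x \<le> p"
  by (simp add: spin_def pca_threshold bits_def)

end

section \<open>Energy and fixation at a fixed level\<close>

lemma nb_iff: "y \<in> nb x \<longleftrightarrow> y = x \<or> z2_adj x y"
proof
  assume "y \<in> nb x"
  then show "y = x \<or> z2_adj x y" by (auto simp: nb_eq z2_adj_def)
next
  assume "y = x \<or> z2_adj x y"
  then show "y \<in> nb x"
  proof
    assume "z2_adj x y"
    then show ?thesis by (cases rule: z2_adj_cases) (auto simp: nb_eq)
  qed simp
qed

lemma nb_automorphism:
  assumes "automorphism f"
  shows "nb (f x) = f ` nb x"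
proof -
  have "y \<in> nb (f x) \<longleftrightarrow> y \<in> f ` nb x" for y
  proof -
    obtain z where z: "y = f z" using assms unfolding automorphism_def by (metis bij_pointE)
    have "inj f" using assms unfolding automorphism_def bij_def by blast
    then have "y \<in> f ` nb x \<longleftrightarrow> z \<in> nb x" "f z = f x \<longleftrightarrow> z = x"
      unfolding z by (simp_all add: inj_image_mem_iff inj_eq)
    then show ?thesis using assms unfolding automorphism_def nb_iff z by simp
  qed
  then show ?thesis by blast
qed

lemma maj_automorphism:
  assumes "automorphism f"
  shows "maj (\<lambda>z. s (f z)) x = maj s (f x)"
proof -
  have inj: "inj f" using assms unfolding automorphism_def bij_def by blast
  have "{w\<in>nb (f x). s w} = f ` {z\<in>nb x. s (f z)}"
    unfolding nb_automorphism[OF assms] by blast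
  then have "card {w\<in>nb (f x). s w} = card {z\<in>nb x. s (f z)}"
    by (simp only: card_image[OF inj_on_subset[OF inj subset_UNIV]])
  then show ?thesis by (simp add: maj_def)
qed

definition lift_index :: "(site \<Rightarrow> site) \<Rightarrow> bit_index \<Rightarrow> bit_index" where
  "lift_index f i = (case i of Inl x \<Rightarrow> Inl (f x) | Inr (x, k) \<Rightarrow> Inr (f x, k))"

lemma lift_index_simps [simp]: "lift_index f (Inl x) = Inl (f x)" "lift_index f (Inr (x, k)) = Inr (f x, k)"
  by (simp_all add: lift_index_def)

lemma inj_lift_index: "inj f \<Longrightarrow> inj (lift_index f)"
proof (rule injI)
  fix i j assume f: "inj f" and eq: "lift_index f i = lift_index f j"
  show "i = j"
  proof (cases i; cases j)
    fix y z assume "i = Inr y" "j = Inr z"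
    moreover obtain a k where "y = (a, k)" by (rule prod.exhaust)
    moreover obtain c l where "z = (c, l)" by (rule prod.exhaust)
    moreover from calculation have "f a = f c" "k = l" using eq by simp_all
    ultimately show ?thesis using injD[OF f] by simp
  next
    fix y z assume "i = Inr y" "j = Inl z"
    then show ?thesis using eq by (cases y) simp
  next
    fix y z assume "i = Inl y" "j = Inr z"
    then show ?thesis using eq by (cases z) simp
  next
    fix y z assume "i = Inl y" "j = Inl z"
    moreover from this have "f y = f z" using eq by simp
    ultimately show ?thesis using injD[OF f] by simp
  qed
qed

lemma spin_lift:
  assumes "automorphism f"
  shows "spin k (\<lambda>i. b (lift_index f i)) x = spin k b (f x)"
proof (induction k arbitrary: x)
  case (Suc k)
  have "spin k (\<lambda>i. b (lift_index f i)) = (\<lambda>x. spin k b (f x))" using Suc by blast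
  then show ?case by (simp add: spin_Suc maj_automorphism[OF assms])
qed (simp add: spin_0)

section \<open>Flips and disagreeing edges\<close>

definition dirs :: "site set" where
  "dirs = {(1, 0), (- 1, 0), (0, 1), (0, - 1)}"

lemma sum_dirs: "(\<Sum>d\<in>dirs. g d) = g (1, 0) + g (- 1, 0) + g (0, 1) + (g (0, - 1) :: 'b::comm_monoid_add)"
  by (simp add: dirs_def add_ac)

lemma card_dirs: "card dirs = 4"
  by (simp add: dirs_def)

lemma sum_dirs_uminus: "(\<Sum>d\<in>dirs. g (- d)) = (\<Sum>d\<in>dirs. g d :: 'b::comm_monoid_add)"
  by (simp add: sum_dirs add_ac)

lemma maj_sum: "maj s x \<longleftrightarrow> (3::nat) \<le> of_bool (s x) + (\<Sum>d\<in>dirs. of_bool (s (x + d)))"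
proof -
  obtain a b where x: "x = (a, b)" by (cases x)
  have 1: "card {z\<in>nb x. s z} = (\<Sum>z\<in>nb x. of_bool (s z))" by (simp add: Int_def)
  have nb: "nb x = {(a, b), (a + 1, b), (a - 1, b), (a, b + 1), (a, b - 1)}" by (simp add: nb_eq x)
  have 2: "(\<Sum>z\<in>nb x. of_bool (s z)) = (of_bool (s x) + (\<Sum>d\<in>dirs. of_bool (s (x + d))) :: nat)"
    unfolding nb by (simp add: sum_dirs x)
  show ?thesis unfolding maj_def 1 2 ..
qed

text \<open>The change in the disagreement of the edge between \<open>x\<close> and \<open>y\<close>
  due to the update of \<open>x\<close> with \<open>y\<close> held fixed.\<close>

definition edge_gain :: "nat \<Rightarrow> site \<Rightarrow> site \<Rightarrow> (bit_index \<Rightarrow> bool) \<Rightarrow> real" where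
  "edge_gain k x y b = of_bool (b (Inr (x, k))) *
     (of_bool (maj (spin k b) x \<noteq> spin k b y) - of_bool (spin k b x \<noteq> spin k b y))"

definition flips :: "nat \<Rightarrow> site \<Rightarrow> (bit_index \<Rightarrow> bool) \<Rightarrow> real" where
  "flips k x b = of_bool (spin (Suc k) b x \<noteq> spin k b x)"

definition disagree :: "nat \<Rightarrow> site \<Rightarrow> site \<Rightarrow> (bit_index \<Rightarrow> bool) \<Rightarrow> real" where
  "disagree k x y b = of_bool (spin k b x \<noteq> spin k b y)"

text \<open>If at most one end rings, the change is exactly the sum of the gains. If both ring, the
  gains overstate the decrease by at most two, the extreme case being that each end adopts the spin
  of the other.\<close>

lemma disagree_Suc:
  "disagree (Suc k) x y b \<le> disagree k x y b + (edge_gain k x y b + edge_gain k y x b)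
     + 2 * (of_bool (b (Inr (x, k))) * of_bool (b (Inr (y, k))))"
  unfolding disagree_def edge_gain_def spin_Suc
  by (cases "b (Inr (x, k))"; cases "b (Inr (y, k))"; cases "spin k b x"; cases "spin k b y";
      cases "maj (spin k b) x"; cases "maj (spin k b) y"; simp)

text \<open>An update that changes a spin has at least three disagreeing neighbours before and at most one
  after, since the site itself votes.\<close>

lemma edge_gain_sum: "(\<Sum>d\<in>dirs. edge_gain k x (x + d) b) \<le> - 2 * flips k x b"
  unfolding edge_gain_def flips_def spin_Suc maj_sum sum_dirs
  by (cases "b (Inr (x, k))"; cases "spin k b x"; cases "spin k b (x + (1, 0))";
      cases "spin k b (x + (- 1, 0))"; cases "spin k b (x + (0, 1))"; cases "spin k b (x + (0, - 1))"; simp)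

lemma local_on_spin_at:
  assumes "x \<in> W" "l \<le> k"
  shows "local_on (sites_steps (reach k W) k) (\<lambda>b. spin l b x)"
proof -
  have "W \<subseteq> reach (k - l) W" by (rule subset_reach)
  have r: "reach (i + j) V = reach j (reach i V)" for i j V
  proof (induction i arbitrary: j V)
    case (Suc i)
    have "reach (Suc i + j) V = reach (i + j) (nbs V)" by simp
    then show ?case using Suc by simp
  qed simp
  have "reach l W \<subseteq> reach l (reach (k - l) W)" using \<open>W \<subseteq> _\<close> by (rule reach_mono)
  also have "\<dots> = reach k W" using r[of "k - l" l W] assms(2) by simp
  finally have "sites_steps (reach l W) l \<subseteq> sites_steps (reach k W) k"
    using assms(2) by (rule sites_steps_mono)
  moreover have "local_on (sites_steps (reach l W) l) (\<lambda>b. spin l b x)"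
    by (rule local_on_spin[where A = "\<lambda>s. s x"]) (rule local_on_coord[OF assms(1)])
  ultimately show ?thesis by (rule local_on_mono[rotated])
qed

text \<open>A finite set of bits that determines everything happening to \<open>W\<close> and its neighbours
  before step \<open>k\<close>.\<close>

definition window :: "site set \<Rightarrow> nat \<Rightarrow> bit_index set" where
  "window W k = sites_steps (reach k (nbs W)) k"

lemma finite_window [simp]: "finite W \<Longrightarrow> finite (window W k)"
  by (simp add: window_def)

lemma local_window_spin: "x \<in> W \<Longrightarrow> l \<le> k \<Longrightarrow> local_on (window W k) (\<lambda>b. spin l b x)"
  unfolding window_def using subset_nbs by (intro local_on_spin_at) auto

lemma local_window_bit: "x \<in> W \<Longrightarrow> l < k \<Longrightarrow> local_on (window W k) (\<lambda>b. b (Inr (x, l)))"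
  unfolding window_def using subset_reach[of "nbs W" k] subset_nbs[of W]
  by (intro local_on_coord) (auto simp: sites_steps_def)

lemma local_window_maj:
  assumes "x \<in> W" "l \<le> k"
  shows "local_on (window W k) (\<lambda>b. maj (spin l b) x)"
  unfolding local_on_def
proof (intro allI impI maj_cong)
  fix s s' :: "bit_index \<Rightarrow> bool" and z
  assume e: "\<forall>i\<in>window W k. s i = s' i" and z: "z \<in> nb x"
  have "local_on (window W k) (\<lambda>b. spin l b z)"
    unfolding window_def by (rule local_on_spin_at) (use assms z in \<open>auto simp: nbs_def\<close>)
  then show "spin l s z = spin l s' z" using e unfolding local_on_def by blast
qed

lemma local_disagree: "x \<in> W \<Longrightarrow> y \<in> W \<Longrightarrow> l \<le> k \<Longrightarrow> local_on (window W k) (disagree l x y)"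
  unfolding disagree_def [abs_def]
  by (intro local_on_lift2[where f = "\<lambda>u v. of_bool (u \<noteq> v)"] local_window_spin)

lemma local_flips: "x \<in> W \<Longrightarrow> l < k \<Longrightarrow> local_on (window W k) (flips l x)"
  unfolding flips_def [abs_def]
  by (intro local_on_lift2[where f = "\<lambda>u v. of_bool (u \<noteq> v)"] local_window_spin) auto

lemma local_edge_gain: "x \<in> W \<Longrightarrow> y \<in> W \<Longrightarrow> l < k \<Longrightarrow> local_on (window W k) (edge_gain l x y)"
  unfolding edge_gain_def [abs_def]
  by (intro local_on_lift2[where f = "(*)"] local_on_lift2[where f = "(-)"] local_on_lift[where f = of_bool]
      local_on_lift2[where f = "\<lambda>u v. u \<noteq> v"] local_window_spin local_window_bit local_window_maj) auto

lemma flip_count_mono: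
  assumes "i \<le> j" "spin i b x \<noteq> spin j b x"
  shows "(\<Sum>k<i. flips k x b) + 1 \<le> (\<Sum>k<j. flips k x b)"
proof -
  have "\<exists>k. i \<le> k \<and> k < j \<and> spin (Suc k) b x \<noteq> spin k b x"
  proof (rule ccontr)
    assume neg: "\<not> ?thesis"
    have "spin j b x = spin i b x" using assms(1)
      by (induction j rule: dec_induct) (use neg in auto)
    then show False using assms(2) by simp
  qed
  then obtain k where k: "i \<le> k" "k < j" "flips k x b = 1" by (auto simp: flips_def)
  have "(\<Sum>k<j. flips k x b) = (\<Sum>k<i. flips k x b) + (\<Sum>k\<in>{i..<j}. flips k x b)"
    using assms(1) by (simp add: lessThan_atLeast0 sum.atLeastLessThan_concat)
  moreover have "flips k x b \<le> (\<Sum>k\<in>{i..<j}. flips k x b)"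
    by (rule member_le_sum) (use k in \<open>auto simp: flips_def\<close>)
  ultimately show ?thesis using k by simp
qed

lemma flip_count_ge:
  fixes \<kappa> :: "nat \<Rightarrow> nat"
  assumes "\<And>n. n < N \<Longrightarrow> \<kappa> n \<le> \<kappa> (Suc n) \<and> spin (\<kappa> n) b x \<noteq> spin (\<kappa> (Suc n)) b x" "\<kappa> N \<le> K"
  shows "real N \<le> (\<Sum>k<K. flips k x b)"
proof -
  have "n \<le> N \<longrightarrow> real n \<le> (\<Sum>k<\<kappa> n. flips k x b)" for n
  proof (induction n)
    case 0 show ?case by (simp add: flips_def sum_nonneg)
  next
    case (Suc n)
    then show ?case using flip_count_mono[of "\<kappa> n" "\<kappa> (Suc n)" b x] assms(1)[of n] by fastforce
  qed
  then have "real N \<le> (\<Sum>k<\<kappa> N. flips k x b)" by blast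
  also have "\<dots> \<le> (\<Sum>k<K. flips k x b)" by (intro sum_mono2) (use assms(2) in \<open>auto simp: flips_def\<close>)
  finally show ?thesis .
qed

lemma (in prob_space) events_Inter:
  assumes "\<And>n::nat. A n \<in> events"
  shows "(\<Inter>n. A n) \<in> events"
proof (rule sets.countable_INT)
  show "range A \<subseteq> events" using assms by blast
qed simp

context median_process
begin

lemma EE_lift:
  assumes "finite I" "local_on I \<phi>" "inj f"
  shows "EE p m (\<lambda>b. \<phi> (\<lambda>i. b (lift_index f i))) = EE p m \<phi>"
proof -
  have "bernoulli_on (\<lambda>i. bits p m (lift_index f i)) (rate p m) I"
  proof (rule bernoulli_on_reindex[OF bernoulli_bits])
    show "rate p m (lift_index f i) = rate p m i" for i
      by (simp add: rate_def lift_index_def split: sum.split prod.split)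
    show "inj_on (lift_index f) I" using inj_lift_index[OF assms(3)] inj_on_subset by blast
  qed (use assms(1) in auto)
  from bernoulli_equal_expectation[OF this bernoulli_bits[OF assms(1)] assms(2)]
  show ?thesis by (simp add: EE_def)
qed

lemma EE_cmult: "EE p m (\<lambda>b. c * \<phi> b) = c * EE p m \<phi>"
  by (simp add: EE_def)

lemma EE_const: "EE p m (\<lambda>_. c) = c"
  by (simp add: EE_def prob_space)

text \<open>Mass transport: translation invariance identifies what the neighbour \<open>d\<close>
  contributes to its edge to the origin with what the origin contributes to its edge in direction
  \<open>- d\<close>.\<close>

lemma EE_edge_gain_swap: "EE p m (edge_gain k d (0, 0)) = EE p m (edge_gain k (0, 0) (- d))"
proof -
  let ?W = "{(0, 0), - d}"
  have aut: "automorphism ((+) d)" by simp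
  have "EE p m (\<lambda>b. edge_gain k (0, 0) (- d) (\<lambda>i. b (lift_index ((+) d) i))) = EE p m (edge_gain k (0, 0) (- d))"
    by (rule EE_lift[OF _ local_edge_gain[of _ ?W _ _ "Suc k"]]) auto
  moreover have "edge_gain k (0, 0) (- d) (\<lambda>i. b (lift_index ((+) d) i)) = edge_gain k d (0, 0) b" for b
  proof -
    have "d + (0, 0) = d" "d + - d = (0, 0)" by (simp_all add: prod_eq_iff)
    moreover have "spin k (\<lambda>i. b (lift_index ((+) d) i)) = (\<lambda>x. spin k b (d + x))"
      using spin_lift[OF aut] by blast
    moreover have "maj (\<lambda>x. spin k b (d + x)) (0, 0) = maj (spin k b) (d + (0, 0))"
      by (rule maj_automorphism[OF aut])
    ultimately show ?thesis unfolding edge_gain_def by simp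
  qed
  ultimately show ?thesis by simp
qed

text \<open>Summed over all directions, the gains from the far ends equal those of the origin, so
  the latter count twice; by \<open>edge_gain_sum\<close> they amount to at most \<open>- 2\<close>
  per flip, hence the 4. The 8 is four edges times the correction 2, and the square is the
  probability that both ends ring.\<close>

lemma energy_step:
  "(\<Sum>d\<in>dirs. EE p m (disagree (Suc k) (0, 0) d)) + 4 * EE p m (flips k (0, 0))
     \<le> (\<Sum>d\<in>dirs. EE p m (disagree k (0, 0) d)) + 8 * (ring_prob m)\<^sup>2"
proof -
  let ?o = "(0, 0) :: site"
  let ?W = "insert ?o dirs"
  let ?I = "window ?W (Suc k)"
  let ?D = "\<lambda>k d. EE p m (disagree k ?o d)"
  let ?G = "\<lambda>d. EE p m (edge_gain k ?o d)"
  have fin: "finite ?I" by (simp add: dirs_def)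
  have 1: "?D (Suc k) d \<le> ?D k d + (?G d + ?G (- d)) + 2 * (ring_prob m)\<^sup>2" if d: "d \<in> dirs" for d
  proof -
    let ?\<beta> = "\<lambda>b. of_bool (b (Inr (?o, k))) * of_bool (b (Inr (d, k))) :: real"
    have l: "local_on ?I (disagree (Suc k) ?o d)" "local_on ?I (disagree k ?o d)"
      "local_on ?I (edge_gain k ?o d)" "local_on ?I (edge_gain k d ?o)" "local_on ?I ?\<beta>"
      using d by (auto intro!: local_disagree local_edge_gain local_on_lift2[where f = "(*)"]
          local_on_lift[where f = of_bool] local_window_bit)
    have "?D (Suc k) d \<le> EE p m (\<lambda>b. disagree k ?o d b + (edge_gain k ?o d b + edge_gain k d ?o b) + 2 * ?\<beta> b)"
      by (rule EE_mono[OF fin l(1)])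
        (intro local_on_lift2[where f = "(+)"] local_on_lift[where f = "\<lambda>v. 2 * v"] l, rule disagree_Suc)
    also have "\<dots> = ?D k d + (?G d + EE p m (edge_gain k d ?o)) + 2 * EE p m ?\<beta>"
      using fin l by (simp add: EE_add[of ?I] EE_cmult local_on_lift2[where f = "(+)"] local_on_lift[where f = "\<lambda>v. 2 * v"])
    also have "EE p m ?\<beta> = ring_prob m * ring_prob m"
    proof -
      have "?o \<noteq> d" using d by (auto simp: dirs_def)
      then have "EE p m ?\<beta> = EE p m (\<lambda>b. of_bool (b (Inr (?o, k)))) * EE p m (\<lambda>b. of_bool (b (Inr (d, k))))"
        by (intro EE_indep[of "{Inr (?o, k)}" "{Inr (d, k)}"]) (auto simp: local_on_def)
      then show ?thesis by (simp add: EE_ring)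
    qed
    finally show ?thesis by (simp add: EE_edge_gain_swap power2_eq_square)
  qed
  have "(\<Sum>d\<in>dirs. ?D (Suc k) d) \<le> (\<Sum>d\<in>dirs. ?D k d + (?G d + ?G (- d)) + 2 * (ring_prob m)\<^sup>2)"
    using 1 by (rule sum_mono)
  also have "\<dots> = (\<Sum>d\<in>dirs. ?D k d) + 2 * (\<Sum>d\<in>dirs. ?G d) + 8 * (ring_prob m)\<^sup>2"
    using sum_dirs_uminus[of ?G] by (simp add: sum.distrib card_dirs)
  also have "(\<Sum>d\<in>dirs. ?G d) \<le> - 2 * EE p m (flips k ?o)"
  proof -
    have lG: "local_on ?I (edge_gain k ?o d)" if "d \<in> dirs" for d using that by (auto intro!: local_edge_gain)
    have lf: "local_on ?I (\<lambda>b. - 2 * flips k ?o b)"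
      by (rule local_on_lift[where f = "\<lambda>v. - 2 * v"]) (rule local_flips; simp)
    have "(\<Sum>d\<in>dirs. ?G d) = EE p m (\<lambda>b. \<Sum>d\<in>dirs. edge_gain k ?o d b)"
      by (rule EE_sum[OF fin lG, symmetric])
    also have "\<dots> \<le> EE p m (\<lambda>b. - 2 * flips k ?o b)"
    proof (rule EE_mono[OF fin local_on_sum[OF lG] lf])
      fix b
      have e: "?o + d = d" for d by (simp add: prod_eq_iff)
      show "(\<Sum>d\<in>dirs. edge_gain k ?o d b) \<le> - 2 * flips k ?o b"
        using edge_gain_sum[of k ?o b] unfolding e .
    qed
    also have "\<dots> = - 2 * EE p m (flips k ?o)" by (rule EE_cmult)
    finally show ?thesis .
  qed
  finally show ?thesis by simp
qed

lemma EE_flips_translate: "EE p m (flips k x) = EE p m (flips k (0, 0))"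
proof -
  have aut: "automorphism ((+) x)" by simp
  have "EE p m (\<lambda>b. flips k (0, 0) (\<lambda>i. b (lift_index ((+) x) i))) = EE p m (flips k (0, 0))"
    by (rule EE_lift[OF _ local_flips[of _ "{(0, 0)}" _ "Suc k"]]) auto
  moreover have "flips k (0, 0) (\<lambda>i. b (lift_index ((+) x) i)) = flips k x b" for b
  proof -
    have "x + (0, 0) = x" by (simp add: prod_eq_iff)
    then show ?thesis unfolding flips_def spin_lift[OF aut] by simp
  qed
  ultimately show ?thesis by simp
qed

text \<open>Telescoping the energy: four times the expected number of flips is at most the initial
  energy, itself at most 4, plus all errors. With \<open>T \<le> 2 ^ m\<close> there are at most
  \<open>2 ^ m * 2 ^ m\<close> steps with error at most \<open>8 / (2 ^ m * 2 ^ m)\<close> each, so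
  the errors total at most 8. The bound does not grow with \<open>T\<close>.\<close>

lemma EE_flips_sum:
  assumes "T \<le> 2 ^ m"
  shows "EE p m (\<lambda>b. \<Sum>k<T * 2 ^ m. flips k x b) \<le> 3"
proof -
  let ?D = "\<lambda>k. \<Sum>d\<in>dirs. EE p m (disagree k (0, 0) d)"
  have bounds: "0 \<le> ?D k" "?D k \<le> 4" for k
  proof -
    have "0 \<le> EE p m (disagree k (0, 0) d)" "EE p m (disagree k (0, 0) d) \<le> 1" for d
    proof -
      have l: "local_on (window {(0, 0), d} k) (disagree k (0, 0) d)" by (rule local_disagree) auto
      have "EE p m (\<lambda>_. 0) \<le> EE p m (disagree k (0, 0) d)" "EE p m (disagree k (0, 0) d) \<le> EE p m (\<lambda>_. 1)"
        by (rule EE_mono[OF _ _ l] EE_mono[OF _ l]; simp add: disagree_def local_on_def)+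
      then show "0 \<le> EE p m (disagree k (0, 0) d)" "EE p m (disagree k (0, 0) d) \<le> 1" by (simp_all add: EE_const)
    qed
    then have "0 \<le> ?D k" "?D k \<le> (\<Sum>d\<in>dirs. 1)" by (auto intro!: sum_nonneg sum_mono simp del: sum_constant)
    then show "0 \<le> ?D k" "?D k \<le> 4" by (simp_all add: card_dirs)
  qed
  have "?D K + 4 * (\<Sum>k<K. EE p m (flips k (0, 0))) \<le> ?D 0 + real K * (8 * (ring_prob m)\<^sup>2)" for K
  proof (induction K)
    case (Suc K)
    then show ?case using energy_step[of p m K] by (simp add: algebra_simps)
  qed simp
  from this[of "T * 2 ^ m"]
  have "4 * (\<Sum>k<T * 2 ^ m. EE p m (flips k (0, 0))) \<le> 4 + real (T * 2 ^ m) * (8 * (ring_prob m)\<^sup>2)"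
    using bounds[of 0] bounds[of "T * 2 ^ m"] by linarith
  also have "real (T * 2 ^ m) * (8 * (ring_prob m)\<^sup>2) \<le> real (2 ^ m * 2 ^ m) * (8 * (1 / 2 ^ m)\<^sup>2)"
    using assms ring_prob_bounds[of m]
    by (intro mult_mono power_mono) (auto simp flip: of_nat_mult intro!: of_nat_mono mult_right_mono)
  also have "\<dots> = 8" by (simp add: power2_eq_square)
  finally have "(\<Sum>k<T * 2 ^ m. EE p m (flips k x)) \<le> 3" by (simp add: EE_flips_translate[of p m _ x])
  moreover have "EE p m (\<lambda>b. \<Sum>k<T * 2 ^ m. flips k x b) = (\<Sum>k<T * 2 ^ m. EE p m (flips k x))"
    by (rule EE_sum[of "window {x} (T * 2 ^ m)"]) (auto intro!: local_flips)
  ultimately show ?thesis by simp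
qed

lemma prob_many_flips:
  assumes "T \<le> 2 ^ m" "0 < N"
  shows "{\<omega>\<in>space M. real N \<le> (\<Sum>k<T * 2 ^ m. flips k x (\<lambda>i. bits p m i \<omega>))} \<in> events" (is "?A \<in> _")
    and "prob {\<omega>\<in>space M. real N \<le> (\<Sum>k<T * 2 ^ m. flips k x (\<lambda>i. bits p m i \<omega>))} \<le> 3 / real N"
proof -
  let ?I = "window {x} (T * 2 ^ m)"
  let ?F = "\<lambda>b. \<Sum>k<T * 2 ^ m. flips k x b"
  have l: "local_on ?I ?F" by (intro local_on_sum local_flips) auto
  have l': "local_on ?I (\<lambda>b. real N \<le> ?F b)" by (rule local_on_lift[OF l])
  show ev: "?A \<in> events" by (rule local_bits_event[OF bernoulli_bits l']) simp
  have "prob ?A = EE p m (\<lambda>b. of_bool (real N \<le> ?F b))"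
    unfolding EE_def by (rule prob_eq_expectation[OF ev])
  also have "\<dots> \<le> EE p m (\<lambda>b. 1 / real N * ?F b)"
  proof (rule EE_mono[of ?I])
    show "local_on ?I (\<lambda>b. of_bool (real N \<le> ?F b) :: real)" by (rule local_on_lift[OF l'])
    show "local_on ?I (\<lambda>b. 1 / real N * ?F b)" by (rule local_on_lift[OF l])
    fix b
    have "0 \<le> ?F b" by (intro sum_nonneg) (simp add: flips_def)
    then show "of_bool (real N \<le> ?F b) \<le> 1 / real N * ?F b" using assms(2) by (auto simp: field_simps of_bool_def)
  qed simp
  also have "\<dots> = 1 / real N * EE p m ?F" by (rule EE_cmult)
  also have "\<dots> \<le> 1 / real N * 3" by (intro mult_left_mono EE_flips_sum assms) simp
  finally show "prob ?A \<le> 3 / real N" by simp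
qed

text \<open>Infinitely many changes of the level at \<open>x\<close> give more than \<open>N\<close>
  flips before some time \<open>T\<close> in all fine meshes. Markov's inequality bounds this by
  \<open>3 / real (Suc N)\<close> for all \<open>T\<close> alike, so letting \<open>T\<close> and
  then \<open>N\<close> grow leaves a null set.\<close>

theorem AE_level_fixates: "AE \<omega> in M. \<exists>T\<ge>0. \<forall>t\<ge>T. (\<eta> t x \<omega> \<le> p) = (\<eta> T x \<omega> \<le> p)"
proof -
  \<comment> \<open>The clause \<open>T \<le> 2 ^ m\<close> makes the event empty for meshes too
    coarse for the flip bound, so the estimate holds for every \<open>m\<close>.\<close>
  let ?A = "\<lambda>N T m. {\<omega>\<in>space M. T \<le> 2 ^ m \<and> real N \<le> (\<Sum>k<T * 2 ^ m. flips k x (\<lambda>i. bits p m i \<omega>))}"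
  let ?L = "\<lambda>N T. \<Union>k. \<Inter>m\<in>{k..}. ?A N T m"
  have evA: "?A (Suc N) T m \<in> events" and pA: "prob (?A (Suc N) T m) \<le> 3 / real (Suc N)" for N T m :: nat
    using prob_many_flips[of T m "Suc N" x p] by (cases "T \<le> 2 ^ m"; simp)+
  have evL: "?L (Suc N) T \<in> events" for N T by (rule events_liminf[OF evA])
  have sub: "?L (Suc N) T \<subseteq> ?L (Suc N) (Suc T)" for N T
  proof
    fix \<omega> assume "\<omega> \<in> ?L (Suc N) T"
    then obtain k where "\<omega> \<in> (\<Inter>m\<in>{k..}. ?A (Suc N) T m)" by blast
    then have k: "\<omega> \<in> ?A (Suc N) T m" if "k \<le> m" for m using that by blast
    have "\<omega> \<in> ?A (Suc N) (Suc T) m" if m: "max k (Suc T) \<le> m" for m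
    proof -
      have "Suc T \<le> 2 ^ m" using less_exp[of m] m by linarith
      moreover have "(\<Sum>k<T * 2 ^ m. flips k x (\<lambda>i. bits p m i \<omega>)) \<le> (\<Sum>k<Suc T * 2 ^ m. flips k x (\<lambda>i. bits p m i \<omega>))"
        by (intro sum_mono2) (auto simp: flips_def)
      ultimately show ?thesis using k[of m] m by auto
    qed
    then show "\<omega> \<in> ?L (Suc N) (Suc T)" by blast
  qed
  let ?U = "\<lambda>N. \<Union>T. ?L (Suc N) T"
  have evU: "?U N \<in> events" for N using evL by (intro sets.countable_UN) blast
  have pU: "prob (?U N) \<le> 3 / real (Suc N)" for N
  proof -
    have "(\<lambda>T. prob (?L (Suc N) T)) \<longlonglongrightarrow> prob (?U N)"
    proof (rule finite_Lim_measure_incseq)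
      show "range (\<lambda>T. ?L (Suc N) T) \<subseteq> events" using evL by blast
      show "incseq (\<lambda>T. ?L (Suc N) T)" using sub by (rule incseq_SucI)
    qed
    moreover have "prob (?L (Suc N) T) \<le> 3 / real (Suc N)" for T by (rule prob_liminf_le[OF evA pA])
    ultimately show ?thesis by (elim LIMSEQ_le_const2) blast
  qed
  have N: "(\<Inter>N. ?U N) \<in> events" by (rule events_Inter[OF evU])
  have "prob (\<Inter>N. ?U N) \<le> 3 / real (Suc N)" for N
  proof -
    have "prob (\<Inter>N. ?U N) \<le> prob (?U N)" by (rule finite_measure_mono[OF _ evU]) blast
    then show ?thesis using pU[of N] by linarith
  qed
  then have le: "\<exists>N0. \<forall>N\<ge>N0. prob (\<Inter>N. ?U N) \<le> 3 / real (Suc N)" by blast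
  have "(\<lambda>N. 3 / real (Suc N)) \<longlonglongrightarrow> 0"
    by (rule LIMSEQ_Suc[OF lim_const_over_n])
  then have "prob (\<Inter>N. ?U N) \<le> 0" by (rule LIMSEQ_le_const[OF _ le])
  then have "prob (\<Inter>N. ?U N) = 0" by (simp add: antisym)
  then have "AE \<omega> in M. \<omega> \<notin> (\<Inter>N. ?U N)" using N prob_eq_0 by blast
  with AE_space[of M] AE_pca_converges show ?thesis
  proof eventually_elim
    case (elim \<omega>)
    let ?v = "\<lambda>t. \<eta> t x \<omega> \<le> p"
    show ?case
    proof (rule ccontr)
      assume "\<not> ?thesis"
      then have next_time: "\<exists>t>T. ?v t \<noteq> ?v T" if "0 \<le> T" for T using that by (metis order_le_less)
      have "\<exists>g. \<forall>n. 0 \<le> g n \<and> g n < g (Suc n) \<and> ?v (g (Suc n)) \<noteq> ?v (g n)"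
      proof -
        have "\<exists>g. \<forall>n. 0 \<le> g n \<and> (g n < g (Suc n) \<and> ?v (g (Suc n)) \<noteq> ?v (g n))"
        proof (rule dependent_nat_choice)
          show "\<exists>t::real. 0 \<le> t" by (rule exI[of _ 0]) simp
          show "\<exists>t'. 0 \<le> t' \<and> (t < t' \<and> ?v t' \<noteq> ?v t)" if t: "0 \<le> t" for t
            using next_time[OF t] t by (meson less_imp_le order_trans)
        qed
        then show ?thesis .
      qed
      then obtain g where g: "\<And>n. 0 \<le> g n" "\<And>n. g n < g (Suc n)" "\<And>n. ?v (g (Suc n)) \<noteq> ?v (g n)"
        by blast
      have "\<omega> \<in> ?U N" for N
      proof -
        obtain T :: nat where T: "g (Suc N) \<le> real T" using real_arch_simple by blast
        have "\<forall>\<^sub>F m in sequentially. \<forall>n\<in>{..Suc N}. spin (nat \<lceil>g n * 2 ^ m\<rceil>) (\<lambda>i. bits p m i \<omega>) x = ?v (g n)"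
        proof (rule eventually_ball_finite, simp, rule ballI)
          fix n
          have "\<forall>\<^sub>F m in sequentially. pca med (\<lambda>x. \<eta> 0 x \<omega>) (ring_bit (\<lambda>x. R x \<omega>) m) (nat \<lceil>g n * 2 ^ m\<rceil>) x
              = \<eta> (g n) x \<omega>" using elim(2) g(1) by blast
          then show "\<forall>\<^sub>F m in sequentially. spin (nat \<lceil>g n * 2 ^ m\<rceil>) (\<lambda>i. bits p m i \<omega>) x = ?v (g n)"
            by eventually_elim (simp add: spin_bits)
        qed
        moreover have "\<forall>\<^sub>F m in sequentially. T \<le> 2 ^ m"
          unfolding eventually_sequentially using less_exp by (metis less_imp_le order_trans)
        ultimately have "\<forall>\<^sub>F m in sequentially. \<omega> \<in> ?A (Suc N) T m"
        proof eventually_elim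
          case (elim m)
          have "real (Suc N) \<le> (\<Sum>k<T * 2 ^ m. flips k x (\<lambda>i. bits p m i \<omega>))"
          proof (rule flip_count_ge[where \<kappa> = "\<lambda>n. nat \<lceil>g n * 2 ^ m\<rceil>"])
            fix n assume n: "n < Suc N"
            have "nat \<lceil>g n * 2 ^ m\<rceil> \<le> nat \<lceil>g (Suc n) * 2 ^ m\<rceil>"
              using g(2)[of n] by (intro nat_mono ceiling_mono mult_right_mono) auto
            moreover have "spin (nat \<lceil>g n * 2 ^ m\<rceil>) (\<lambda>i. bits p m i \<omega>) x = ?v (g n)"
              "spin (nat \<lceil>g (Suc n) * 2 ^ m\<rceil>) (\<lambda>i. bits p m i \<omega>) x = ?v (g (Suc n))"
              using elim(1) n by auto
            ultimately show "nat \<lceil>g n * 2 ^ m\<rceil> \<le> nat \<lceil>g (Suc n) * 2 ^ m\<rceil> \<and>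
                spin (nat \<lceil>g n * 2 ^ m\<rceil>) (\<lambda>i. bits p m i \<omega>) x \<noteq> spin (nat \<lceil>g (Suc n) * 2 ^ m\<rceil>) (\<lambda>i. bits p m i \<omega>) x"
              using g(3)[of n] by simp
          next
            have "g (Suc N) * 2 ^ m \<le> real T * 2 ^ m" using T by (intro mult_right_mono) auto
            then have "\<lceil>g (Suc N) * 2 ^ m\<rceil> \<le> int (T * 2 ^ m)" by (simp add: ceiling_le_iff)
            then show "nat \<lceil>g (Suc N) * 2 ^ m\<rceil> \<le> T * 2 ^ m" by linarith
          qed
          then show ?case using elim(2) \<open>\<omega> \<in> space M\<close> by blast
        qed
        then show ?thesis unfolding eventually_sequentially by blast
      qed
      then show False using elim(3) by blast
    qed
  qed
qed

end

section \<open>Symmetry, positive association and mixing of the limiting signs\<close>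

lemma maj_not: "maj (\<lambda>z. \<not> s z) x \<longleftrightarrow> \<not> maj s x"
proof -
  have "{z\<in>nb x. \<not> s z} = nb x - {z\<in>nb x. s z}" by blast
  moreover have "card {z\<in>nb x. s z} \<le> card (nb x)" by (intro card_mono) auto
  ultimately show ?thesis unfolding maj_def by (simp add: card_Diff_subset card_nb) linarith
qed

lemma maj_mono: "s \<le> s' \<Longrightarrow> maj s x \<Longrightarrow> maj s' x"
proof -
  assume "s \<le> s'" "maj s x"
  have "card {z\<in>nb x. s z} \<le> card {z\<in>nb x. s' z}"
    using \<open>s \<le> s'\<close> by (intro card_mono) (auto simp: le_fun_def)
  then show ?thesis using \<open>maj s x\<close> unfolding maj_def by linarith
qed

text \<open>Comparison with \<open>isl i\<close> negates the initial bits and keeps the ring bits;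
  majority among five sites commutes with negation.\<close>

lemma spin_flip: "spin k (\<lambda>i. b i \<noteq> isl i) x \<longleftrightarrow> \<not> spin k b x"
proof (induction k arbitrary: x)
  case (Suc k)
  then have "spin k (\<lambda>i. b i \<noteq> isl i) = (\<lambda>x. \<not> spin k b x)" by blast
  then show ?case by (simp add: spin_Suc maj_not)
qed (simp add: spin_0)

text \<open>The bits of a coarse mesh in terms of those of a mesh that is \<open>2 ^ d\<close> times finer.\<close>

definition coarse :: "nat \<Rightarrow> (bit_index \<Rightarrow> bool) \<Rightarrow> bit_index \<Rightarrow> bool" where
  "coarse d b i = (case i of Inl x \<Rightarrow> b (Inl x)
     | Inr (x, k) \<Rightarrow> \<exists>j\<in>{k * 2 ^ d..<Suc k * 2 ^ d}. b (Inr (x, j)))"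

lemma coarse_lift: "coarse d (\<lambda>i. b (lift_index f i)) = (\<lambda>i. coarse d b (lift_index f i))"
  by (rule ext) (simp add: coarse_def lift_index_def split: sum.split prod.split)

lemma ring_bit_coarse:
  assumes "C x \<subseteq> {0<..}"
  shows "ring_bit C m k x \<longleftrightarrow> (\<exists>j\<in>{k * 2 ^ d..<Suc k * 2 ^ d}. ring_bit C (m + d) j x)"
proof
  assume "ring_bit C m k x"
  then obtain s where s: "s \<in> C x" "real k / 2 ^ m < s" "s \<le> real (Suc k) / 2 ^ m"
    unfolding ring_bit_def by auto
  have "0 < s" using s(1) assms by auto
  let ?j = "nat \<lceil>s * 2 ^ (m + d)\<rceil> - 1"
  have "real (k * 2 ^ d) < s * 2 ^ (m + d)" "s * 2 ^ (m + d) \<le> real (Suc k * 2 ^ d)"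
  proof -
    have "real k < s * 2 ^ m" "s * 2 ^ m \<le> real (Suc k)" using s(2,3) by (simp_all add: field_simps)
    then have "real k * 2 ^ d < s * 2 ^ m * 2 ^ d" "s * 2 ^ m * 2 ^ d \<le> real (Suc k) * 2 ^ d"
      by (simp_all only: mult_less_cancel_right_pos mult_le_cancel_right_pos zero_less_power zero_less_numeral)
    then show "real (k * 2 ^ d) < s * 2 ^ (m + d)" "s * 2 ^ (m + d) \<le> real (Suc k * 2 ^ d)"
      unfolding power_add of_nat_mult of_nat_power of_nat_numeral mult.assoc[symmetric] .
  qed
  then have "?j \<in> {k * 2 ^ d..<Suc k * 2 ^ d}" by (simp only: atLeastLessThan_iff) linarith
  moreover have "ring_bit C (m + d) ?j x" using s(1) \<open>0 < s\<close> by (rule ring_bit_index)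
  ultimately show "\<exists>j\<in>{k * 2 ^ d..<Suc k * 2 ^ d}. ring_bit C (m + d) j x" by blast
next
  assume "\<exists>j\<in>{k * 2 ^ d..<Suc k * 2 ^ d}. ring_bit C (m + d) j x"
  then obtain j s where j: "k * 2 ^ d \<le> j" "j < Suc k * 2 ^ d"
    and s: "s \<in> C x" "real j / 2 ^ (m + d) < s" "s \<le> real (Suc j) / 2 ^ (m + d)"
    unfolding ring_bit_def by auto
  have "real (k * 2 ^ d) \<le> real j" "real (Suc j) \<le> real (Suc k * 2 ^ d)"
    using j Suc_leI[OF j(2)] by (simp_all only: of_nat_le_iff)
  then have "real (k * 2 ^ d) / 2 ^ (m + d) \<le> real j / 2 ^ (m + d)"
    "real (Suc j) / 2 ^ (m + d) \<le> real (Suc k * 2 ^ d) / 2 ^ (m + d)"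
    by (intro divide_right_mono; simp)+
  moreover have "real (l * 2 ^ d) / 2 ^ (m + d) = real l / 2 ^ m" for l by (simp add: power_add)
  ultimately have "real k / 2 ^ m \<le> real j / 2 ^ (m + d)" "real (Suc j) / 2 ^ (m + d) \<le> real (Suc k) / 2 ^ m"
    by (simp_all only:)
  then have "s \<in> C x \<inter> {real k / 2 ^ m <.. real (Suc k) / 2 ^ m}" using s by auto
  then show "ring_bit C m k x" unfolding ring_bit_def by blast
qed

lemma local_on_spin_coarse:
  assumes "x \<in> W"
  shows "local_on (sites_steps (reach k W) (k * 2 ^ d)) (\<lambda>b. spin k (coarse d b) x)"
  unfolding local_on_def
proof (intro allI impI)
  fix b b' :: "bit_index \<Rightarrow> bool"
  assume e: "\<forall>i\<in>sites_steps (reach k W) (k * 2 ^ d). b i = b' i"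
  show "spin k (coarse d b) x = spin k (coarse d b') x"
  proof (rule spin_cong[OF _ assms])
    fix i :: bit_index assume i: "i \<in> sites_steps (reach k W) k"
    show "coarse d b i = coarse d b' i"
    proof (cases i)
      case (Inl y)
      then have "Inl y \<in> sites_steps (reach k W) (k * 2 ^ d)" using i by (auto simp: sites_steps_def)
      then show ?thesis using e by (simp add: coarse_def Inl)
    next
      case (Inr z)
      obtain y l where z: "z = (y, l)" by (cases z)
      have yl: "y \<in> reach k W" "l < k" using i Inr z by (auto simp: sites_steps_def)
      have "b (Inr (y, j)) = b' (Inr (y, j))" if "j < Suc l * 2 ^ d" for j
      proof -
        have "Suc l * 2 ^ d \<le> k * 2 ^ d" using yl(2) by (intro mult_right_mono) auto
        then have "Inr (y, j) \<in> sites_steps (reach k W) (k * 2 ^ d)"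
          using that yl(1) by (simp add: sites_steps_def)
        then show ?thesis using e by blast
      qed
      then show ?thesis by (simp add: coarse_def Inr z)
    qed
  qed
qed

lemma spin_local:
  assumes "x \<in> W"
  shows "local_on (sites_steps (reach k W) k) (\<lambda>b. spin k b x)"
  by (rule local_on_spin_at[OF assms]) simp

lemma local_on_compose:
  fixes I :: "'i set"
  assumes "local_on W \<psi>" "\<And>i. i \<in> W \<Longrightarrow> local_on I (\<lambda>b. Y b i)"
  shows "local_on I (\<lambda>b. \<psi> (Y b))"
  unfolding local_on_def
proof (intro allI impI)
  fix s s' :: "'i \<Rightarrow> bool" assume e: "\<forall>i\<in>I. s i = s' i"
  show "\<psi> (Y s) = \<psi> (Y s')"
  proof (rule local_onD[OF assms(1)])
    fix i assume "i \<in> W"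
    from assms(2)[OF this] e show "Y s i = Y s' i" unfolding local_on_def by blast
  qed
qed

context prob_space
begin

lemma prob_local_tendsto:
  assumes "finite W" "local_on W \<psi>"
    and "\<And>m i. i \<in> W \<Longrightarrow> {\<omega>\<in>space M. Y m \<omega> i} \<in> events" "\<And>i. i \<in> W \<Longrightarrow> {\<omega>\<in>space M. Z \<omega> i} \<in> events"
    and "\<And>i. i \<in> W \<Longrightarrow> AE \<omega> in M. \<forall>\<^sub>F m in sequentially. Y m \<omega> i = Z \<omega> i"
  shows "(\<lambda>m. prob {\<omega>\<in>space M. \<psi> (Y m \<omega>)}) \<longlonglongrightarrow> prob {\<omega>\<in>space M. \<psi> (Z \<omega>)}"
proof (rule prob_tendsto)
  have "AE \<omega> in M. \<forall>i\<in>W. \<forall>\<^sub>F m in sequentially. Y m \<omega> i = Z \<omega> i"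
    using assms(1,5) by (intro AE_finite_allI)
  then show "AE \<omega> in M. \<forall>\<^sub>F m in sequentially. (\<omega> \<in> {\<omega>\<in>space M. \<psi> (Y m \<omega>)}) = (\<omega> \<in> {\<omega>\<in>space M. \<psi> (Z \<omega>)})"
  proof eventually_elim
    case (elim \<omega>)
    then have "\<forall>\<^sub>F m in sequentially. \<forall>i\<in>W. Y m \<omega> i = Z \<omega> i"
      using assms(1) by (rule eventually_ball_finite[rotated])
    then show ?case
    proof eventually_elim
      case (elim m)
      then have "\<psi> (Y m \<omega>) = \<psi> (Z \<omega>)" by (intro local_onD[OF assms(2)]) blast
      then show ?case by simp
    qed
  qed
next
  show "{\<omega>\<in>space M. \<psi> (Y m \<omega>)} \<in> events" for m
    by (rule local_collect_event[OF assms(1,2,3)])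
  show "{\<omega>\<in>space M. \<psi> (Z \<omega>)} \<in> events"
    by (rule local_collect_event[OF assms(1,2,4)])
qed

end

context median_process
begin

lemma bits_coarse:
  assumes "\<omega> \<in> space M"
  shows "bits p m i \<omega> = coarse d (\<lambda>i. bits p (m + d) i \<omega>) i"
  unfolding bits_def coarse_def
  using ring_bit_coarse[of "\<lambda>x. R x \<omega>", OF clock_points(1)[OF assms]]
  by (simp split: sum.split prod.split)

lemma coarse_bits: "\<omega> \<in> space M \<Longrightarrow> coarse d (\<lambda>i. bits p (m + d) i \<omega>) = (\<lambda>i. bits p m i \<omega>)"
  using bits_coarse by (intro ext) (rule sym)

lemma spin_event: "{\<omega>\<in>space M. spin k (\<lambda>i. bits p m i \<omega>) x} \<in> events"
  by (rule local_bits_event[OF bernoulli_bits spin_local[of x "{x}"]]) auto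

lemma value_event: "0 \<le> t \<Longrightarrow> {\<omega>\<in>space M. \<eta> t x \<omega> \<le> p} \<in> events"
proof -
  assume "0 \<le> t"
  then have "\<eta> t x \<in> M \<rightarrow>\<^sub>M restrict_space borel {0..1}"
    using dyn unfolding median_dynamics_def by auto
  then have "\<eta> t x \<in> borel_measurable M" by (simp add: measurable_restrict_space2_iff)
  then show ?thesis by simp
qed

text \<open>The limiting sign at level \<open>p\<close>. Integer times make it a countable
  combination of events, and almost surely it is the eventual value because the level
  fixates.\<close>

definition final :: "real \<Rightarrow> site \<Rightarrow> 'a \<Rightarrow> bool" where
  "final p x \<omega> \<longleftrightarrow> (\<exists>n0::nat. \<forall>n\<ge>n0. \<eta> (real n) x \<omega> \<le> p)"

lemma final_event: "{\<omega>\<in>space M. final p x \<omega>} \<in> events"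
  unfolding final_def using value_event
  by (intro sets.sets_Collect_countable_Ex sets.sets_Collect_countable_All sets.sets_Collect_imp) auto

lemma AE_final: "AE \<omega> in M. \<forall>\<^sub>F n in sequentially. (\<eta> (real n) x \<omega> \<le> p) = final p x \<omega>"
  using AE_level_fixates[of x p]
proof eventually_elim
  case (elim \<omega>)
  then obtain T where T: "\<And>t. T \<le> t \<Longrightarrow> (\<eta> t x \<omega> \<le> p) = (\<eta> T x \<omega> \<le> p)" by blast
  obtain N :: nat where N: "T \<le> real N" using real_arch_simple by blast
  have c: "(\<eta> (real n) x \<omega> \<le> p) = (\<eta> T x \<omega> \<le> p)" if "N \<le> n" for n
    using T[of "real n"] N that by (meson of_nat_le_iff order_trans)
  have "final p x \<omega> = (\<eta> T x \<omega> \<le> p)"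
    unfolding final_def using c by (meson nat_le_linear)
  then show ?case using c unfolding eventually_sequentially by blast
qed

lemma AE_spin_value:
  "AE \<omega> in M. \<forall>\<^sub>F m in sequentially. spin (n * 2 ^ m) (\<lambda>i. bits p m i \<omega>) x = (\<eta> (real n) x \<omega> \<le> p)"
  using AE_pca_converges
proof eventually_elim
  case (elim \<omega>)
  have "nat \<lceil>real n * 2 ^ m\<rceil> = n * 2 ^ m" for m
  proof -
    have "real n * 2 ^ m = of_int (int (n * 2 ^ m))" by simp
    then show ?thesis by (simp only: ceiling_of_int nat_int)
  qed
  moreover have "\<forall>\<^sub>F m in sequentially. pca med (\<lambda>x. \<eta> 0 x \<omega>) (ring_bit (\<lambda>x. R x \<omega>) m) (nat \<lceil>real n * 2 ^ m\<rceil>) x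
      = \<eta> (real n) x \<omega>" using elim by (meson of_nat_0_le_iff)
  ultimately show ?case by (simp add: spin_bits eventually_mono)
qed

text \<open>A discrete approximation and the limiting signs side by side. Invariance of the pair,
  and not merely of each layer, controls the approximation error after a translation.\<close>

definition joint :: "real \<Rightarrow> nat \<Rightarrow> nat \<Rightarrow> 'a \<Rightarrow> site + site \<Rightarrow> bool" where
  "joint p m k \<omega> = case_sum (spin k (\<lambda>i. bits p m i \<omega>)) (\<lambda>x. final p x \<omega>)"

lemma joint_event: "{\<omega>\<in>space M. joint p m k \<omega> i} \<in> events"
  by (cases i) (simp_all add: joint_def spin_event final_event)

text \<open>The limiting signs are limits of spins on the meshes \<open>m + d\<close>, and the bits
  of mesh \<open>m\<close> are functions of the finer ones by \<open>coarse\<close>. For finite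
  \<open>d\<close> both layers are thus built equivariantly from one family of independent bits with
  an invariant law; then \<open>d\<close>, and after it the time \<open>n\<close>, tends to
  infinity.\<close>

theorem joint_invariant:
  assumes W: "finite W" "local_on W \<psi>" and f: "automorphism f"
  shows "prob {\<omega>\<in>space M. \<psi> (\<lambda>i. joint p m k \<omega> (map_sum f f i))} = prob {\<omega>\<in>space M. \<psi> (joint p m k \<omega>)}"
proof -
  define refined where "refined n d b = case_sum (spin k (coarse d b)) (spin (n * 2 ^ (m + d)) b)"
    for n d :: nat and b :: "bit_index \<Rightarrow> bool"
  define mid where "mid n \<omega> = case_sum (spin k (\<lambda>i. bits p m i \<omega>)) (\<lambda>x. \<eta> (real n) x \<omega> \<le> p)" for n :: nat and \<omega>
  have mid_event: "{\<omega>\<in>space M. mid n \<omega> i} \<in> events" for n i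
    by (cases i) (simp_all add: mid_def spin_event value_event)
  have lim: "(\<lambda>n. prob {\<omega>\<in>space M. \<psi> (\<lambda>i. mid n \<omega> (h i))}) \<longlonglongrightarrow> prob {\<omega>\<in>space M. \<psi> (\<lambda>i. joint p m k \<omega> (h i))}" for h
  proof (rule prob_local_tendsto[OF W])
    fix i
    show "AE \<omega> in M. \<forall>\<^sub>F n in sequentially. mid n \<omega> (h i) = joint p m k \<omega> (h i)"
      using AE_final[of _ p] by (cases "h i") (simp_all add: mid_def joint_def)
  qed (rule mid_event joint_event)+
  define S where "S = {x. Inl x \<in> W \<or> Inr x \<in> W}"
  have "finite S"
    using finite_vimageI[OF W(1), of Inl] finite_vimageI[OF W(1), of Inr] by (simp add: S_def vimage_def Collect_disj_eq)
  define I where "I n d = sites_steps (reach k S) (k * 2 ^ d) \<union> sites_steps (reach (n * 2 ^ (m + d)) S) (n * 2 ^ (m + d))"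
    for n d :: nat
  have finI: "finite (I n d)" for n d using \<open>finite S\<close> by (simp add: I_def)
  have loc: "local_on (I n d) (\<lambda>b. \<psi> (refined n d b))" for n d
  proof (rule local_on_compose[OF W(2)])
    fix i assume i: "i \<in> W"
    show "local_on (I n d) (\<lambda>b. refined n d b i)"
    proof (cases i)
      case (Inl x)
      then show ?thesis using i
        by (auto simp: refined_def I_def S_def intro!: local_on_mono[OF local_on_spin_coarse[of x S]])
    next
      case (Inr x)
      then show ?thesis using i
        by (auto simp: refined_def I_def S_def intro!: local_on_mono[OF spin_local[of x S]])
    qed
  qed
  have lift: "refined n d (\<lambda>i. b (lift_index f i)) = (\<lambda>i. refined n d b (map_sum f f i))" for n d b
    by (rule ext) (simp add: refined_def coarse_lift spin_lift[OF f] split: sum.split)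
  have refined_event: "{\<omega>\<in>space M. refined n d (\<lambda>i. bits p (m + d) i \<omega>) i} \<in> events" for n d i
  proof (cases i)
    case (Inl x)
    have "{\<omega>\<in>space M. spin k (coarse d (\<lambda>i. bits p (m + d) i \<omega>)) x} = {\<omega>\<in>space M. spin k (\<lambda>i. bits p m i \<omega>) x}"
    proof (intro Collect_cong conj_cong refl)
      fix \<omega> assume "\<omega> \<in> space M"
      then have "coarse d (\<lambda>i. bits p (m + d) i \<omega>) = (\<lambda>i. bits p m i \<omega>)"
        by (rule coarse_bits)
      then show "spin k (coarse d (\<lambda>i. bits p (m + d) i \<omega>)) x = spin k (\<lambda>i. bits p m i \<omega>) x" by simp
    qed
    then show ?thesis using spin_event by (simp add: refined_def Inl)
  qed (simp add: refined_def spin_event)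
  have eq: "prob {\<omega>\<in>space M. \<psi> (\<lambda>i. refined n d (\<lambda>i. bits p (m + d) i \<omega>) (map_sum f f i))}
      = prob {\<omega>\<in>space M. \<psi> (refined n d (\<lambda>i. bits p (m + d) i \<omega>))}" for n d
  proof -
    have ev: "{\<omega>\<in>space M. \<psi> (\<lambda>i. refined n d (\<lambda>i. bits p (m + d) i \<omega>) (h i))} \<in> events" for h
      by (rule local_collect_event[OF W]) (rule refined_event)
    have inj: "inj f" using f unfolding automorphism_def bij_def by blast
    have "EE p (m + d) (\<lambda>b. of_bool (\<psi> (refined n d (\<lambda>i. b (lift_index f i)))))
        = EE p (m + d) (\<lambda>b. of_bool (\<psi> (refined n d b)))"
      by (rule EE_lift[OF finI local_on_lift[OF loc] inj])
    then show ?thesis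
      unfolding lift EE_def using prob_eq_expectation[OF ev[of "map_sum f f"]] prob_eq_expectation[OF ev[of "\<lambda>i. i"]]
      by simp
  qed
  have limd: "(\<lambda>d. prob {\<omega>\<in>space M. \<psi> (\<lambda>i. refined n d (\<lambda>i. bits p (m + d) i \<omega>) (h i))})
      \<longlonglongrightarrow> prob {\<omega>\<in>space M. \<psi> (\<lambda>i. mid n \<omega> (h i))}" for n h
  proof (rule prob_local_tendsto[OF W])
    fix i
    show "AE \<omega> in M. \<forall>\<^sub>F d in sequentially. refined n d (\<lambda>i. bits p (m + d) i \<omega>) (h i) = mid n \<omega> (h i)"
    proof (cases "h i")
      case (Inl x)
      show ?thesis
        using AE_space[of M] by eventually_elim (simp add: refined_def mid_def Inl coarse_bits)
    next
      case (Inr x)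
      show ?thesis
        using AE_spin_value[of n p x]
      proof eventually_elim
        case (elim \<omega>)
        then have "\<forall>\<^sub>F d in sequentially. spin (n * 2 ^ (d + m)) (\<lambda>i. bits p (d + m) i \<omega>) x = (\<eta> (real n) x \<omega> \<le> p)"
          by (rule sequentially_offset)
        then show ?case by (simp add: refined_def mid_def Inr add.commute)
      qed
    qed
  qed (rule mid_event refined_event)+
  have "prob {\<omega>\<in>space M. \<psi> (\<lambda>i. mid n \<omega> (map_sum f f i))} = prob {\<omega>\<in>space M. \<psi> (mid n \<omega>)}" for n
    by (rule LIMSEQ_unique[OF limd]) (use limd[of n "\<lambda>i. i"] in \<open>simp add: eq\<close>)
  then show ?thesis
    by (intro LIMSEQ_unique[OF lim]) (use lim[of "\<lambda>i. i"] in simp)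
qed

lemma final_double_limit:
  assumes "finite W" "local_on W A"
  shows "(\<lambda>n. prob {\<omega>\<in>space M. A (\<lambda>x. \<eta> (real n) x \<omega> \<le> p)}) \<longlonglongrightarrow> prob {\<omega>\<in>space M. A (\<lambda>x. final p x \<omega>)}"
    and "(\<lambda>m. prob {\<omega>\<in>space M. A (spin (n * 2 ^ m) (\<lambda>i. bits p m i \<omega>))})
      \<longlonglongrightarrow> prob {\<omega>\<in>space M. A (\<lambda>x. \<eta> (real n) x \<omega> \<le> p)}"
  by (rule prob_local_tendsto[OF assms]; intro value_event final_event spin_event AE_final AE_spin_value; simp)+

lemma spin_collect_event:
  assumes "finite W" "local_on W A"
  shows "{\<omega>\<in>space M. A (spin k (\<lambda>i. bits p m i \<omega>))} \<in> events"
  using assms spin_event by (rule local_collect_event)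

lemma EE_flip:
  assumes "finite I" "local_on I \<phi>"
  shows "EE (1/2) m (\<lambda>b. \<phi> (\<lambda>i. b i \<noteq> isl i)) = EE (1/2) m \<phi>"
proof -
  have "bernoulli_on (\<lambda>i \<omega>. bits (1/2) m i \<omega> \<noteq> isl i) (rate (1/2) m) I"
  proof (rule bernoulli_on_flip[OF bernoulli_bits[OF assms(1)]])
    show "isl i \<Longrightarrow> rate (1/2) m i = 1/2" for i
      by (cases i) (simp_all only: rate_def init_prob_half sum.case sum.disc)
  qed
  from bernoulli_equal_expectation[OF this bernoulli_bits[OF assms(1)] assms(2)]
  show ?thesis by (simp only: EE_def)
qed

text \<open>At level 1/2 the initial bits are fair, so negating them preserves the law of the spins.
  The identity passes through both limits, the mesh first and the time second.\<close>

theorem final_flip: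
  assumes "finite W" "local_on W A"
  shows "prob {\<omega>\<in>space M. A (\<lambda>x. \<not> final (1/2) x \<omega>)} = prob {\<omega>\<in>space M. A (\<lambda>x. final (1/2) x \<omega>)}"
proof -
  have An: "local_on W (\<lambda>s. A (\<lambda>x. \<not> s x))" by (rule local_on_not[OF assms(2)])
  have "prob {\<omega>\<in>space M. A (\<lambda>x. \<not> spin k (\<lambda>i. bits (1/2) m i \<omega>) x)} = prob {\<omega>\<in>space M. A (spin k (\<lambda>i. bits (1/2) m i \<omega>))}" for k m
  proof -
    have "local_on (sites_steps (reach k W) k) (\<lambda>b. of_bool (A (spin k b)) :: real)"
      by (rule local_on_lift[OF local_on_spin[OF assms(2)]])
    from EE_flip[OF finite_sites_steps[OF finite_reach[OF assms(1)]] this]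
    have "EE (1/2) m (\<lambda>b. of_bool (A (spin k (\<lambda>i. b i \<noteq> isl i)))) = EE (1/2) m (\<lambda>b. of_bool (A (spin k b)))" .
    moreover have "spin k (\<lambda>i. b i \<noteq> isl i) = (\<lambda>x. \<not> spin k b x)" for b using spin_flip by blast
    ultimately have "EE (1/2) m (\<lambda>b. of_bool (A (\<lambda>x. \<not> spin k b x))) = EE (1/2) m (\<lambda>b. of_bool (A (spin k b)))"
      by (simp only:)
    then show ?thesis
      unfolding EE_def prob_eq_expectation[OF spin_collect_event[OF assms]] prob_eq_expectation[OF spin_collect_event[OF assms(1) An]] .
  qed
  then have "prob {\<omega>\<in>space M. A (\<lambda>x. \<not> \<eta> (real n) x \<omega> \<le> 1/2)} = prob {\<omega>\<in>space M. A (\<lambda>x. \<eta> (real n) x \<omega> \<le> 1/2)}" for n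
    using final_double_limit(2)[OF assms, of n "1/2"] final_double_limit(2)[OF assms(1) An, of n "1/2"] LIMSEQ_unique by simp
  then show ?thesis
    using final_double_limit(1)[OF assms, of "1/2"] final_double_limit(1)[OF assms(1) An, of "1/2"] LIMSEQ_unique by simp
qed

end

section \<open>Positive association\<close>

definition update :: "nat \<Rightarrow> (site \<Rightarrow> bool) \<Rightarrow> (bit_index \<Rightarrow> bool) \<Rightarrow> site \<Rightarrow> bool" where
  "update k s b x = (if b (Inr (x, k)) then maj s x else s x)"

lemma spin_Suc_update: "spin (Suc k) b = update k (spin k b) b"
  by (rule ext) (simp add: spin_Suc update_def)

lemma local_on_update_bits:
  assumes "local_on W f"
  shows "local_on (Inr ` (W \<times> {k})) (\<lambda>b. f (update k s b))"
  unfolding local_on_def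
proof (intro allI impI local_onD[OF assms])
  fix b b' :: "bit_index \<Rightarrow> bool" and x
  assume "\<forall>i\<in>Inr ` (W \<times> {k}). b i = b' i" "x \<in> W"
  then have "b (Inr (x, k)) = b' (Inr (x, k))" by blast
  then show "update k s b x = update k s b' x" by (simp add: update_def)
qed

lemma local_on_update_config:
  assumes "local_on W f"
  shows "local_on (nbs W) (\<lambda>s. f (update k s b))"
  unfolding local_on_def
proof (intro allI impI local_onD[OF assms])
  fix s s' :: "site \<Rightarrow> bool" and x
  assume e: "\<forall>y\<in>nbs W. s y = s' y" and x: "x \<in> W"
  have "maj s x = maj s' x" by (rule maj_cong) (use e x in \<open>auto simp: nbs_def\<close>)
  moreover have "s x = s' x" using e x subset_nbs by blast
  ultimately show "update k s b x = update k s' b x" by (simp add: update_def)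
qed

lemma update_mono: "s \<le> s' \<Longrightarrow> update k s b \<le> update k s' b"
  using maj_mono[of s s'] by (auto simp: update_def le_fun_def)

text \<open>Given the configuration, turning on the bit of \<open>x\<close> either raises or lowers the spin at \<open>x\<close>.\<close>

lemma update_direction:
  fixes f :: "(site \<Rightarrow> bool) \<Rightarrow> real" and s :: "site \<Rightarrow> bool"
  assumes "mono f"
  defines "up \<equiv> \<lambda>i. case i of Inl _ \<Rightarrow> True | Inr (x, _) \<Rightarrow> s x \<longrightarrow> maj s x"
  shows "f (update k s (b(i := \<not> up i))) \<le> f (update k s (b(i := up i)))"
proof (rule monoD[OF assms(1)], rule le_funI)
  fix y
  show "update k s (b(i := \<not> up i)) y \<le> update k s (b(i := up i)) y"
    by (cases "i = Inr (y, k)") (auto simp: update_def up_def)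
qed

context median_process
begin

text \<open>Induction over the steps. With the configuration at step \<open>k\<close> frozen, each
  bit of that step acts monotonically in a direction fixed by the configuration, so
  \<open>harris\<close> applies. The averages \<open>?avg f\<close> and \<open>?avg g\<close> over
  these bits are again local and increasing in the configuration, and the induction hypothesis
  covers the past.\<close>

lemma EE_positive_association:
  fixes f g :: "(site \<Rightarrow> bool) \<Rightarrow> real"
  assumes "finite W" "local_on W f" "local_on W g" "mono f" "mono g"
  shows "EE p m (\<lambda>b. f (spin k b)) * EE p m (\<lambda>b. g (spin k b)) \<le> EE p m (\<lambda>b. f (spin k b) * g (spin k b))"
  using assms
proof (induction k arbitrary: W f g)
  case 0
  have s0: "spin 0 b = (\<lambda>x. b (Inl x))" for b by (rule ext) (rule spin_0)
  have loc: "local_on (Inl ` W) (\<lambda>b. h (spin 0 b))" if "local_on W h" for h :: "(site \<Rightarrow> bool) \<Rightarrow> real"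
    by (rule local_on_compose[OF that]) (simp add: s0 local_on_def)
  have mon: "h (spin 0 (b(i := \<not> True))) \<le> h (spin 0 (b(i := True)))" if "mono h"
    for h :: "(site \<Rightarrow> bool) \<Rightarrow> real" and b i
    by (rule monoD[OF that]) (auto simp: s0 le_fun_def)
  show ?case unfolding EE_def
    by (rule harris[OF bernoulli_bits[OF finite_imageI[OF 0(1)]] loc[OF 0(2)] loc[OF 0(3)],
          where up = "\<lambda>_. True"])
      (intro conjI rate_bounds mon 0)+
next
  case (Suc k)
  let ?avg = "\<lambda>h s. EE p m (\<lambda>b. h (update k s b))"
  let ?J = "Inr ` (W \<times> {k}) :: bit_index set"
  have finJ: "finite ?J" using Suc.prems(1) by simp
  have step: "EE p m (\<lambda>b. h (spin (Suc k) b)) = EE p m (\<lambda>b. ?avg h (spin k b))"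
    if h: "local_on W h" for h :: "(site \<Rightarrow> bool) \<Rightarrow> real"
    unfolding EE_def spin_Suc_update
  proof (rule local_fubini[OF bernoulli_bits, where H = "\<lambda>a b. h (update k (spin k a) b)"])
    show "local_on (sites_steps (reach k (nbs W)) k) (\<lambda>a. h (update k (spin k a) b))" for b
      by (rule local_on_spin[OF local_on_update_config[OF h]])
    show "local_on ?J (\<lambda>b. h (update k (spin k a) b))" for a by (rule local_on_update_bits[OF h])
    show "finite (sites_steps (reach k (nbs W)) k \<union> ?J)" using Suc.prems(1) by simp
    show "sites_steps (reach k (nbs W)) k \<inter> ?J = {}" by (auto simp: sites_steps_def)
  qed
  have avg_local: "local_on (nbs W) (?avg h)" if "local_on W h" for h :: "(site \<Rightarrow> bool) \<Rightarrow> real"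
    unfolding local_on_def
  proof (intro allI impI)
    fix s s' :: "site \<Rightarrow> bool" assume "\<forall>x\<in>nbs W. s x = s' x"
    then have "h (update k s b) = h (update k s' b)" for b
      using local_on_update_config[OF that] unfolding local_on_def by blast
    then show "?avg h s = ?avg h s'" by simp
  qed
  have avg_mono: "mono (?avg h)" if "local_on W h" "mono h" for h :: "(site \<Rightarrow> bool) \<Rightarrow> real"
  proof (rule monoI)
    fix s s' :: "site \<Rightarrow> bool" assume "s \<le> s'"
    then show "?avg h s \<le> ?avg h s'"
      by (intro EE_mono[OF finJ] local_on_update_bits that monoD[OF that(2)] update_mono)
  qed
  have fg: "local_on W (\<lambda>s. f s * g s)" by (rule local_on_times[OF Suc.prems(2,3)])
  have "?avg f s * ?avg g s \<le> ?avg (\<lambda>s. f s * g s) s" for s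
    unfolding EE_def
    by (rule harris[OF bernoulli_bits[OF finJ],
          where up = "\<lambda>i. case i of Inl _ \<Rightarrow> True | Inr (x, _) \<Rightarrow> s x \<longrightarrow> maj s x"])
      (intro local_on_update_bits Suc.prems conjI rate_bounds update_direction)+
  then have "EE p m (\<lambda>b. ?avg f (spin k b) * ?avg g (spin k b)) \<le> EE p m (\<lambda>b. ?avg (\<lambda>s. f s * g s) (spin k b))"
    by (intro EE_mono[of "sites_steps (reach k (nbs W)) k"] local_on_spin[where A = "\<lambda>s. ?avg f s * ?avg g s"]
        local_on_spin[where A = "?avg (\<lambda>s. f s * g s)"] local_on_times avg_local fg Suc.prems(2,3))
      (simp_all add: Suc.prems(1))
  moreover have "EE p m (\<lambda>b. ?avg f (spin k b)) * EE p m (\<lambda>b. ?avg g (spin k b))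
      \<le> EE p m (\<lambda>b. ?avg f (spin k b) * ?avg g (spin k b))"
    by (rule Suc.IH[of "nbs W"]) (intro finite_nbs avg_local avg_mono Suc.prems)+
  ultimately show ?case using step[OF Suc.prems(2)] step[OF Suc.prems(3)] step[OF fg] by simp
qed

lemma final_positive_association:
  assumes W: "finite W" "local_on W A" "local_on W B" and inc: "increasing A" "increasing B"
  shows "prob {\<omega>\<in>space M. A (\<lambda>x. final p x \<omega>)} * prob {\<omega>\<in>space M. B (\<lambda>x. final p x \<omega>)}
    \<le> prob {\<omega>\<in>space M. A (\<lambda>x. final p x \<omega>) \<and> B (\<lambda>x. final p x \<omega>)}"
proof -
  have AB: "local_on W (\<lambda>s. A s \<and> B s)" using W by (intro local_on_conj)
  have mon: "mono (\<lambda>s. of_bool (C s) :: real)" if "increasing C" for C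
    using that unfolding increasing_def by (intro monoI) (auto simp: le_fun_def of_bool_def)
  have spin: "prob {\<omega>\<in>space M. A (spin k (\<lambda>i. bits p m i \<omega>))} * prob {\<omega>\<in>space M. B (spin k (\<lambda>i. bits p m i \<omega>))}
      \<le> prob {\<omega>\<in>space M. A (spin k (\<lambda>i. bits p m i \<omega>)) \<and> B (spin k (\<lambda>i. bits p m i \<omega>))}" for k m
  proof -
    have "EE p m (\<lambda>b. of_bool (A (spin k b))) * EE p m (\<lambda>b. of_bool (B (spin k b)))
        \<le> EE p m (\<lambda>b. of_bool (A (spin k b)) * of_bool (B (spin k b)))"
      by (rule EE_positive_association[OF W(1) local_on_lift[OF W(2)] local_on_lift[OF W(3)] mon mon])
        (rule inc)+
    then show ?thesis
      unfolding EE_def prob_eq_expectation[OF spin_collect_event[OF W(1,2)]]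
        prob_eq_expectation[OF spin_collect_event[OF W(1,3)]]
        prob_eq_expectation[OF spin_collect_event[OF W(1) AB]] of_bool_conj .
  qed
  have "prob {\<omega>\<in>space M. A (\<lambda>x. \<eta> (real n) x \<omega> \<le> p)} * prob {\<omega>\<in>space M. B (\<lambda>x. \<eta> (real n) x \<omega> \<le> p)}
      \<le> prob {\<omega>\<in>space M. A (\<lambda>x. \<eta> (real n) x \<omega> \<le> p) \<and> B (\<lambda>x. \<eta> (real n) x \<omega> \<le> p)}" for n
    by (rule LIMSEQ_le[OF tendsto_mult[OF final_double_limit(2)[OF W(1,2)] final_double_limit(2)[OF W(1,3)]]
          final_double_limit(2)[OF W(1) AB]]) (use spin in blast)
  then show ?thesis
    by (intro LIMSEQ_le[OF tendsto_mult[OF final_double_limit(1)[OF W(1,2)] final_double_limit(1)[OF W(1,3)]]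
          final_double_limit(1)[OF W(1) AB]]) blast
qed

lemma prob_diff_le:
  assumes "E \<in> events" "F \<in> events" "H \<in> events" "E \<subseteq> F \<union> H" "F \<subseteq> E \<union> H"
  shows "\<bar>prob E - prob F\<bar> \<le> prob H"
proof -
  have "prob E \<le> prob F + prob H"
    using finite_measure_mono[OF assms(4)] measure_Un_le[OF assms(2,3)] assms(1-3) by fastforce
  moreover have "prob F \<le> prob E + prob H"
    using finite_measure_mono[OF assms(5)] measure_Un_le[OF assms(1,3)] assms(1-3) by fastforce
  ultimately show ?thesis by linarith
qed

section \<open>Mixing\<close>

definition differ :: "((site \<Rightarrow> bool) \<Rightarrow> bool) \<Rightarrow> ((site \<Rightarrow> bool) \<Rightarrow> bool) \<Rightarrow> (site + site \<Rightarrow> bool) \<Rightarrow> bool" where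
  "differ A B c \<longleftrightarrow> A (\<lambda>x. c (Inl x)) \<noteq> A (\<lambda>x. c (Inr x)) \<or> B (\<lambda>x. c (Inl x)) \<noteq> B (\<lambda>x. c (Inr x))"

lemma local_on_differ:
  assumes "local_on W A" "local_on W B"
  shows "local_on (Inl ` W \<union> Inr ` W) (differ A B)"
proof -
  have "local_on (Inl ` W \<union> Inr ` W) (\<lambda>c. C (\<lambda>x. c (h x)))"
    if "local_on W C" "h = Inl \<or> h = Inr" for C :: "(site \<Rightarrow> bool) \<Rightarrow> bool" and h
    by (rule local_on_compose[OF that(1)]) (use that(2) in \<open>auto intro: local_on_coord\<close>)
  note l = this[OF assms(1)] this[OF assms(2)]
  show ?thesis unfolding differ_def [abs_def]
    by (intro local_on_lift2[where f = "(\<or>)"] local_on_lift2[where f = "\<lambda>u v. u \<noteq> v"] l) simp_all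
qed

text \<open>Time first, mesh second: at a late integer time the level indicators agree with the
  limiting signs with high probability, and a fine mesh reproduces that time on the finitely many
  relevant sites.\<close>

lemma finite_approximation:
  assumes W: "finite W" "local_on W A" "local_on W B" and \<epsilon>: "0 < \<epsilon>"
  shows "\<exists>m k. prob {\<omega>\<in>space M. differ A B (joint p m k \<omega>)} < \<epsilon>"
proof -
  define mid where "mid n \<omega> = case_sum (\<lambda>x. \<eta> (real n) x \<omega> \<le> p) (\<lambda>x. final p x \<omega>)" for n :: nat and \<omega>
  define lim where "lim \<omega> = case_sum (\<lambda>x. final p x \<omega>) (\<lambda>x. final p x \<omega>)" for \<omega>
  have fin: "finite (Inl ` W \<union> Inr ` W)" using W(1) by simp
  have mid_event: "{\<omega>\<in>space M. mid n \<omega> i} \<in> events" for n i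
    by (cases i) (simp_all add: mid_def final_event value_event)
  have lim_event: "{\<omega>\<in>space M. lim \<omega> i} \<in> events" for i
    by (cases i) (simp_all add: lim_def final_event)
  have "(\<lambda>n. prob {\<omega>\<in>space M. differ A B (mid n \<omega>)}) \<longlonglongrightarrow> prob {\<omega>\<in>space M. differ A B (lim \<omega>)}"
  proof (rule prob_local_tendsto[OF fin local_on_differ[OF W(2,3)] mid_event lim_event])
    fix i show "AE \<omega> in M. \<forall>\<^sub>F n in sequentially. mid n \<omega> i = lim \<omega> i"
      using AE_final by (cases i) (simp_all add: mid_def lim_def)
  qed
  moreover have "prob {\<omega>\<in>space M. differ A B (lim \<omega>)} = 0" by (simp add: differ_def lim_def)
  ultimately have "\<forall>\<^sub>F n in sequentially. prob {\<omega>\<in>space M. differ A B (mid n \<omega>)} < \<epsilon>"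
    using order_tendstoD(2) \<epsilon> by fastforce
  then obtain n where n: "prob {\<omega>\<in>space M. differ A B (mid n \<omega>)} < \<epsilon>"
    by (auto dest: eventually_happens)
  have "(\<lambda>m. prob {\<omega>\<in>space M. differ A B (joint p m (n * 2 ^ m) \<omega>)}) \<longlonglongrightarrow> prob {\<omega>\<in>space M. differ A B (mid n \<omega>)}"
  proof (rule prob_local_tendsto[OF fin local_on_differ[OF W(2,3)] joint_event mid_event])
    fix i show "AE \<omega> in M. \<forall>\<^sub>F m in sequentially. joint p m (n * 2 ^ m) \<omega> i = mid n \<omega> i"
      using AE_spin_value by (cases i) (simp_all add: mid_def joint_def)
  qed
  from order_tendstoD(2)[OF this n]
  have "\<forall>\<^sub>F m in sequentially. prob {\<omega>\<in>space M. differ A B (joint p m (n * 2 ^ m) \<omega>)} < \<epsilon>" .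
  from eventually_happens'[OF sequentially_bot this] show ?thesis by blast
qed

text \<open>Spins on \<open>W\<close> after \<open>k\<close> steps depend on bits over
  \<open>reach k W\<close> only. A shift by more than twice the horizontal extent of that set makes
  the two families of bits disjoint, and from then on the equality is exact.\<close>

lemma spin_decouples:
  assumes W: "finite W" "local_on W A" "local_on W B"
  shows "\<forall>\<^sub>F n in sequentially.
    EE p m (\<lambda>b. of_bool (A (spin k b)) * of_bool (B (\<lambda>x. spin k b (x + (int n, 0))))) =
    EE p m (\<lambda>b. of_bool (A (spin k b))) * EE p m (\<lambda>b. of_bool (B (spin k b)))"
proof -
  define V where "V = reach k W"
  define L where "L = (\<Sum>x\<in>V. \<bar>fst x\<bar>)"
  have finV: "finite V" using W(1) by (simp add: V_def)
  have L: "\<bar>fst x\<bar> \<le> L" if "x \<in> V" for x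
    unfolding L_def by (rule member_le_sum[OF that]) (use finV in auto)
  have "EE p m (\<lambda>b. of_bool (A (spin k b)) * of_bool (B (\<lambda>x. spin k b (x + (int n, 0))))) =
    EE p m (\<lambda>b. of_bool (A (spin k b))) * EE p m (\<lambda>b. of_bool (B (spin k b)))" if n: "2 * L < int n" for n
  proof -
    let ?f = "\<lambda>x::site. x + (int n, 0)"
    let ?I = "sites_steps V k"
    have aut: "automorphism ?f" by simp
    have sl: "spin k (\<lambda>i. b (lift_index ?f i)) = (\<lambda>x. spin k b (?f x))" for b
      using spin_lift[OF aut] by blast
    have lB: "local_on ?I (\<lambda>b. of_bool (B (spin k b)) :: real)"
      unfolding V_def by (rule local_on_lift[OF local_on_spin[OF W(3)]])
    have "?I \<inter> lift_index ?f ` ?I = {}"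
    proof (rule ccontr)
      assume "?I \<inter> lift_index ?f ` ?I \<noteq> {}"
      then obtain x where "x \<in> V" "?f x \<in> V" by (auto simp: sites_steps_def)
      then show False using L[of x] L[of "?f x"] n by (cases x) auto
    qed
    then have "EE p m (\<lambda>b. of_bool (A (spin k b)) * of_bool (B (spin k (\<lambda>i. b (lift_index ?f i))))) =
      EE p m (\<lambda>b. of_bool (A (spin k b))) * EE p m (\<lambda>b. of_bool (B (spin k (\<lambda>i. b (lift_index ?f i)))))"
    proof (rule EE_indep[rotated 2])
      show "local_on ?I (\<lambda>b. of_bool (A (spin k b)) :: real)"
        unfolding V_def by (rule local_on_lift[OF local_on_spin[OF W(2)]])
      show "local_on (lift_index ?f ` ?I) (\<lambda>b. of_bool (B (spin k (\<lambda>i. b (lift_index ?f i)))) :: real)"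
        by (rule local_on_compose[OF lB, where Y = "\<lambda>b i. b (lift_index ?f i)"]) (rule local_on_coord, blast)
    qed (use finV in simp_all)
    also have "EE p m (\<lambda>b. of_bool (B (spin k (\<lambda>i. b (lift_index ?f i))))) = EE p m (\<lambda>b. of_bool (B (spin k b)))"
      using EE_lift[OF _ lB, of ?f] finV aut unfolding automorphism_def bij_def by simp
    finally show ?thesis unfolding sl .
  qed
  moreover have "\<forall>\<^sub>F n in sequentially. 2 * L < int n"
    unfolding eventually_sequentially by (rule exI[of _ "nat (2 * L) + 1"]) linarith
  ultimately show ?thesis by (auto elim: eventually_mono)
qed

text \<open>Passing from limiting signs to spins costs at most \<open>r / 5\<close> each for
  \<open>A\<close> alone, for \<open>B\<close> alone, and for the unshifted and the shifted part of
  the joint event, the last by \<open>joint_invariant\<close>. The spins themselves decouple exactly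
  for large shifts, so the total error is at most \<open>4 * (r / 5)\<close>.\<close>

lemma final_mixing:
  assumes W: "finite W" "local_on W A" "local_on W B"
  shows "(\<lambda>n. prob {\<omega>\<in>space M. A (\<lambda>x. final p x \<omega>) \<and> B (\<lambda>x. final p (x + (int n, 0)) \<omega>)})
    \<longlonglongrightarrow> prob {\<omega>\<in>space M. A (\<lambda>x. final p x \<omega>)} * prob {\<omega>\<in>space M. B (\<lambda>x. final p x \<omega>)}"
proof (rule LIMSEQ_I)
  fix r :: real assume "0 < r"
  then have "0 < r / 5" by simp
  from finite_approximation[OF W this] obtain m k
    where D: "prob {\<omega>\<in>space M. differ A B (joint p m k \<omega>)} < r / 5" (is "prob ?D < _") by blast
  let ?f = "\<lambda>n x::site. x + (int n, 0)"
  let ?Df = "\<lambda>n. {\<omega>\<in>space M. differ A B (\<lambda>i. joint p m k \<omega> (map_sum (?f n) (?f n) i))}"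
  have fin: "finite (Inl ` W \<union> Inr ` W)" using W(1) by simp
  have Dev: "?D \<in> events" "?Df n \<in> events" for n
    by (rule local_collect_event[OF fin local_on_differ[OF W(2,3)]], rule joint_event)+
  have Df: "prob (?Df n) < r / 5" for n
    using joint_invariant[OF fin local_on_differ[OF W(2,3)], of "?f n"] D by simp
  let ?F = "\<lambda>A. {\<omega>\<in>space M. A (\<lambda>x. final p x \<omega>)}"
  let ?S = "\<lambda>A. {\<omega>\<in>space M. A (spin k (\<lambda>i. bits p m i \<omega>))}"
  have Fev: "?F C \<in> events" if "local_on V C" "finite V" for C V
    by (rule local_collect_event[OF that(2,1)]) (rule final_event)
  have Sev: "?S C \<in> events" if "local_on V C" "finite V" for C V
    by (rule spin_collect_event[OF that(2,1)])
  have single: "\<bar>prob (?S C) - prob (?F C)\<bar> \<le> r / 5" if "C \<in> {A, B}" for C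
  proof -
    have "\<bar>prob (?S C) - prob (?F C)\<bar> \<le> prob ?D"
      by (rule prob_diff_le[OF Sev Fev Dev(1)]) (use that W in \<open>auto simp: differ_def joint_def\<close>)
    then show ?thesis using D by linarith
  qed
  have "\<forall>\<^sub>F n in sequentially. norm (prob {\<omega>\<in>space M. A (\<lambda>x. final p x \<omega>) \<and> B (\<lambda>x. final p (?f n x) \<omega>)}
      - prob (?F A) * prob (?F B)) < r"
    using spin_decouples[OF W, of p m k]
  proof eventually_elim
    case (elim n)
    let ?AB = "\<lambda>s. A s \<and> B (\<lambda>x. s (?f n x))"
    have lAB: "local_on (W \<union> ?f n ` W) ?AB"
      by (intro local_on_conj local_on_mono[OF W(2)] local_on_comp_image[OF W(3)]) auto
    have fAB: "finite (W \<union> ?f n ` W)" using W(1) by simp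
    have "\<bar>prob (?S ?AB) - prob (?F ?AB)\<bar> \<le> prob (?D \<union> ?Df n)"
      by (rule prob_diff_le[OF Sev[OF lAB fAB] Fev[OF lAB fAB]]) (use Dev in \<open>auto simp: differ_def joint_def\<close>)
    also have "\<dots> \<le> prob ?D + prob (?Df n)" by (rule measure_Un_le[OF Dev])
    finally have 1: "\<bar>prob (?S ?AB) - prob (?F ?AB)\<bar> \<le> 2 * (r / 5)" using D Df[of n] by linarith
    have 2: "prob (?S ?AB) = prob (?S A) * prob (?S B)"
      using elim unfolding EE_def prob_eq_expectation[OF Sev[OF lAB fAB]]
        prob_eq_expectation[OF Sev[OF W(2,1)]] prob_eq_expectation[OF Sev[OF W(3,1)]] of_bool_conj .
    have "\<bar>prob (?S A) * prob (?S B) - prob (?F A) * prob (?F B)\<bar>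
        = \<bar>(prob (?S A) - prob (?F A)) * prob (?S B) + prob (?F A) * (prob (?S B) - prob (?F B))\<bar>"
      by (simp add: algebra_simps)
    also have "\<dots> \<le> \<bar>prob (?S A) - prob (?F A)\<bar> * prob (?S B) + prob (?F A) * \<bar>prob (?S B) - prob (?F B)\<bar>"
      by (rule order_trans[OF abs_triangle_ineq]) (simp add: abs_mult)
    also have "\<dots> \<le> \<bar>prob (?S A) - prob (?F A)\<bar> * 1 + 1 * \<bar>prob (?S B) - prob (?F B)\<bar>"
      by (intro add_mono mult_left_mono mult_right_mono) auto
    also have "\<dots> \<le> 2 * (r / 5)" using single[of A] single[of B] by simp
    finally show ?case using 1 2 \<open>0 < r\<close> by (simp only: real_norm_def)
  qed
  then show "\<exists>n0. \<forall>n\<ge>n0. norm (prob {\<omega>\<in>space M. A (\<lambda>x. final p x \<omega>) \<and> B (\<lambda>x. final p (x + (int n, 0)) \<omega>)}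
      - prob (?F A) * prob (?F B)) < r"
    unfolding eventually_sequentially .
qed

theorem final_planar_field: "planar_field M (\<lambda>\<omega> x. final (1/2) x \<omega>)"
proof
  show "{\<omega>\<in>space M. final (1/2) x \<omega>} \<in> events" for x by (rule final_event)
  fix W :: "site set" and A :: "(site \<Rightarrow> bool) \<Rightarrow> bool" assume W: "finite W" "local_on W A"
  show "prob {\<omega>\<in>space M. A (\<lambda>x. \<not> final (1/2) x \<omega>)} = prob {\<omega>\<in>space M. A (\<lambda>x. final (1/2) x \<omega>)}"
    by (rule final_flip[OF W])
  show "prob {\<omega>\<in>space M. A (\<lambda>x. final (1/2) (f x) \<omega>)} = prob {\<omega>\<in>space M. A (\<lambda>x. final (1/2) x \<omega>)}"
    if f: "automorphism f" for f
  proof -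
    have "local_on (Inr ` W) (\<lambda>c. A (\<lambda>x. c (Inr x)))"
      by (rule local_on_compose[OF W(2)]) (rule local_on_coord, blast)
    from joint_invariant[OF _ this f, of "1/2" 0 0] W(1) show ?thesis by (simp add: joint_def)
  qed
  fix B :: "(site \<Rightarrow> bool) \<Rightarrow> bool" assume B: "local_on W B"
  show "(\<lambda>n. prob {\<omega>\<in>space M. A (\<lambda>x. final (1/2) x \<omega>) \<and> B (\<lambda>x. final (1/2) (x + (int n, 0)) \<omega>)})
    \<longlonglongrightarrow> prob {\<omega>\<in>space M. A (\<lambda>x. final (1/2) x \<omega>)} * prob {\<omega>\<in>space M. B (\<lambda>x. final (1/2) x \<omega>)}"
    by (rule final_mixing[OF W B])
  assume "increasing A" "increasing B"
  then show "prob {\<omega>\<in>space M. A (\<lambda>x. final (1/2) x \<omega>)} * prob {\<omega>\<in>space M. B (\<lambda>x. final (1/2) x \<omega>)}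
    \<le> prob {\<omega>\<in>space M. A (\<lambda>x. final (1/2) x \<omega>) \<and> B (\<lambda>x. final (1/2) x \<omega>)}"
    by (rule final_positive_association[OF W B])
qed

end

section \<open>Fixation\<close>

lemma last_ring_since:
  fixes C :: "site \<Rightarrow> real set"
  assumes fin: "finite (C y \<inter> {..t})" and "T \<le> t"
  obtains (none) "C y \<inter> {T<..t} = {}"
    | (last) a where "a \<in> C y" "T < a" "a \<le> t" "C y \<inter> {a<..t} = {}"
proof (cases "C y \<inter> {T<..t} = {}")
  case False
  let ?S = "C y \<inter> {T<..t}"
  have "finite ?S" by (rule finite_subset[OF _ fin]) auto
  then have "Max ?S \<in> ?S" "\<forall>r\<in>?S. r \<le> Max ?S" using False Max_in[of ?S] Max_ge[of ?S] by blast+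
  then show ?thesis using last[of "Max ?S"] by force
qed (rule none)

text \<open>Inside a finite sign cluster whose signs no longer change, an update copies a value from
  the same cluster, so no new values enter.\<close>

lemma values_confined:
  fixes f :: "real \<Rightarrow> site \<Rightarrow> real" and s :: "site \<Rightarrow> bool"
  assumes path: "median_path z2_adj C f"
    and pos: "\<And>x. C x \<subseteq> {0<..}" and fin: "\<And>x t. finite (C x \<inter> {..t})"
    and S: "finite S" "\<And>y z. y \<in> S \<Longrightarrow> z \<in> nb y \<Longrightarrow> s z = s y \<Longrightarrow> z \<in> S"
    and T: "0 \<le> T" "\<And>y t. y \<in> S \<union> nbs S \<Longrightarrow> T \<le> t \<Longrightarrow> (f t y \<le> p) = s y"
    and y: "y \<in> S" "T \<le> t"
  shows "f t y \<in> f T ` S"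
  using y
\<comment> \<open>The measure counts the rings in \<open>S\<close> after \<open>T\<close> and up to
  \<open>t\<close>; tracing the value of \<open>y\<close> back past its last ring removes at least
  that ring.\<close>
proof (induction "card (\<Union>z\<in>S. C z \<inter> {T<..t})" arbitrary: y t rule: less_induct)
  case less
  have const: "f t z = f a z" if "C z \<inter> {a<..t} = {}" "0 \<le> a" "a \<le> t" for a t z
    using path that unfolding median_path_def by blast
  from fin[of y t] less.prems(2) show ?case
  proof (cases rule: last_ring_since)
    case none
    then show ?thesis using const[of y T t] T(1) less.prems by auto
  next
    case (last a)
    have fy: "f t y = f a y" using const[of y a t] last T(1) by auto
    have left: "\<exists>a'. T \<le> a' \<and> a' < a \<and> Lim (at_left a) (\<lambda>t. f t z) = f a' z" for z
    proof -
      have "0 < a" using last T(1) by linarith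
      let ?S = "insert T (C z \<inter> {..<a})"
      have "C z \<inter> {..<a} \<subseteq> C z \<inter> {..a}" by auto
      then have finS: "finite ?S" using finite_subset fin by blast
      define a' where "a' = Max ?S"
      have "a' \<in> ?S" unfolding a'_def using finS by (intro Max_in) auto
      then have a': "T \<le> a'" "a' < a" using last(2) Max_ge[OF finS, of T] unfolding a'_def by auto
      have gap: "C z \<inter> {a'<..<a} = {}" using Max_ge[OF finS] unfolding a'_def by fastforce
      have "\<forall>\<^sub>F t in at_left a. f t z = f a' z"
        unfolding eventually_at_left_field
      proof (intro exI[of _ a'] conjI allI impI a'(2))
        fix t assume t: "a' < t" "t < a"
        then have "C z \<inter> {a'<..t} = {}" using gap by auto
        then show "f t z = f a' z" using const t a'(1) T(1) by auto
      qed
      then have "((\<lambda>t. f t z) \<longlongrightarrow> f a' z) (at_left a)" by (rule tendsto_eventually)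
      then have "Lim (at_left a) (\<lambda>t. f t z) = f a' z" by (intro tendsto_Lim) auto
      then show ?thesis using a' by blast
    qed
    have "f a y = med (\<lambda>z. Lim (at_left a) (\<lambda>t. f t z)) y"
      using path last(1) unfolding median_path_def med_def by blast
    then obtain z where z: "z \<in> nb y" "f a y = Lim (at_left a) (\<lambda>t. f t z)"
      using med_in[of "\<lambda>z. Lim (at_left a) (\<lambda>t. f t z)" y] by auto
    obtain a' where a': "T \<le> a'" "a' < a" "f a y = f a' z" using left[of z] z(2) by auto
    have "z \<in> S \<union> nbs S" using z(1) less.prems(1) by (auto simp: nbs_def)
    \<comment> \<open>One and the same value is seen at \<open>z\<close> at time \<open>a'\<close>
      and at \<open>y\<close> at time \<open>a\<close>, neither before \<open>T\<close>, so both
      settled signs are read off from it.\<close>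
    then have "s z = s y" using T(2)[of z a'] T(2)[of y a] a' last(2) less.prems(1) by auto
    then have zS: "z \<in> S" using S(2) z(1) less.prems(1) by blast
    have "card (\<Union>z\<in>S. C z \<inter> {T<..a'}) < card (\<Union>z\<in>S. C z \<inter> {T<..t})"
    proof (rule psubset_card_mono)
      show "finite (\<Union>z\<in>S. C z \<inter> {T<..t})"
        using S(1) by (intro finite_UN_I) (auto intro: finite_subset[OF _ fin[of _ t]])
      have "a \<in> (\<Union>z\<in>S. C z \<inter> {T<..t})" using last less.prems(1) by auto
      moreover have "a \<notin> (\<Union>z\<in>S. C z \<inter> {T<..a'})" using a' by auto
      moreover have "(\<Union>z\<in>S. C z \<inter> {T<..a'}) \<subseteq> (\<Union>z\<in>S. C z \<inter> {T<..t})" using a' last by force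
      ultimately show "(\<Union>z\<in>S. C z \<inter> {T<..a'}) \<subset> (\<Union>z\<in>S. C z \<inter> {T<..t})" by blast
    qed
    from less.hyps[OF this zS a'(1)] show ?thesis using fy a'(3) by simp
  qed
qed

text \<open>Any two of the finitely many values are separated by a rational level. Once these
  finitely many levels have settled, passing from one value to another would still change one of
  them.\<close>

lemma finitely_valued_fixates:
  fixes g :: "real \<Rightarrow> real"
  assumes "finite V" "\<And>t. T \<le> t \<Longrightarrow> g t \<in> V"
    and levels: "\<And>q::rat. \<exists>T. \<forall>t\<ge>T. (g t \<le> of_rat q) = (g T \<le> of_rat q)"
  shows "\<exists>T\<ge>0. \<forall>t\<ge>T. g t = g T"
proof -
  have "\<forall>w\<in>V \<times> V. \<exists>q. fst w < snd w \<longrightarrow> fst w \<le> of_rat q \<and> of_rat q < snd w"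
    using of_rat_dense by (metis less_imp_le)
  then obtain Q where Q: "\<And>u v. u \<in> V \<Longrightarrow> v \<in> V \<Longrightarrow> u < v \<Longrightarrow> u \<le> of_rat (Q (u, v)) \<and> of_rat (Q (u, v)) < v"
    by (metis (no_types, lifting) bchoice SigmaI fst_conv snd_conv)
  obtain L where L: "\<And>q t. L q \<le> t \<Longrightarrow> (g t \<le> of_rat q) = (g (L q) \<le> of_rat q)"
    using levels by metis
  define T1 where "T1 = Max (insert 0 (insert T ((\<lambda>w. L (Q w)) ` (V \<times> V))))"
  have fin: "finite (insert 0 (insert T ((\<lambda>w. L (Q w)) ` (V \<times> V))))" using assms(1) by simp
  have T1: "0 \<le> T1" "T \<le> T1" "\<And>w. w \<in> V \<times> V \<Longrightarrow> L (Q w) \<le> T1"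
    unfolding T1_def using Max_ge[OF fin] by blast+
  have "g t = g T1" if t: "T1 \<le> t" for t
  proof (rule ccontr)
    assume ne: "g t \<noteq> g T1"
    have V: "g t \<in> V" "g T1 \<in> V" using assms(2) T1(2) t by auto
    have same: "(g t \<le> of_rat (Q w)) = (g T1 \<le> of_rat (Q w))" if "w \<in> V \<times> V" for w
      using L[of "Q w" t] L[of "Q w" T1] T1(3)[OF that] t by auto
    show False
    proof (cases "g t < g T1")
      case True
      then show False using Q[OF V True] same[of "(g t, g T1)"] V by auto
    next
      case False
      then have lt: "g T1 < g t" using ne by simp
      then show False using Q[OF V(2,1) lt] same[of "(g T1, g t)"] V by auto
    qed
  qed
  then show ?thesis using T1(1) by blast
qed

lemma cluster_closed:
  assumes "y \<in> cluster s x" "z \<in> nb y" "s z"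
  shows "z \<in> cluster s x"
proof (cases "z = y")
  case False
  then have "z2_adj y z" using assms(2) by (simp add: nb_iff)
  then show ?thesis using assms(1,3) unfolding cluster_def by (auto intro: conn_step)
qed (use assms in simp)

lemma cluster_sign: "y \<in> cluster s x \<Longrightarrow> s y"
  unfolding cluster_def using conn_in2 by blast

context median_process
begin

lemma AE_fixates: "AE \<omega> in M. \<forall>x. \<exists>T\<ge>0. \<forall>t\<ge>T. \<eta> t x \<omega> = \<eta> T x \<omega>"
proof -
  interpret F: planar_field M "\<lambda>\<omega> x. final (1/2) x \<omega>" by (rule final_planar_field)
  have levels: "AE \<omega> in M. \<forall>x (q::rat). \<exists>T\<ge>0. \<forall>t\<ge>T. (\<eta> t x \<omega> \<le> of_rat q) = (\<eta> T x \<omega> \<le> of_rat q)"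
    unfolding AE_all_countable using AE_level_fixates by blast
  have finals: "AE \<omega> in M. \<forall>x. \<forall>\<^sub>F n in sequentially. (\<eta> (real n) x \<omega> \<le> 1/2) = final (1/2) x \<omega>"
    unfolding AE_all_countable using AE_final by blast
  have path: "AE \<omega> in M. median_path z2_adj (\<lambda>x. R x \<omega>) (\<lambda>t x. \<eta> t x \<omega>)"
    using dyn unfolding median_dynamics_def by blast
  from AE_space[of M] levels finals path F.AE_finite_clusters show ?thesis
  proof eventually_elim
    case (elim \<omega>)
    let ?s = "\<lambda>x. final (1/2) x \<omega>"
    have sign: "\<exists>T\<ge>0. \<forall>t\<ge>T. (\<eta> t y \<omega> \<le> 1/2) = ?s y" for y
    proof -
      obtain T where T: "0 \<le> T" "\<And>t. T \<le> t \<Longrightarrow> (\<eta> t y \<omega> \<le> 1/2) = (\<eta> T y \<omega> \<le> 1/2)"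
        using elim(2)[rule_format, of y "1/2"] by (auto simp: of_rat_divide)
      obtain N where N: "\<And>n. N \<le> n \<Longrightarrow> (\<eta> (real n) y \<omega> \<le> 1/2) = ?s y"
        using elim(3) unfolding eventually_sequentially by blast
      obtain n :: nat where n: "T \<le> real n" using real_arch_simple by blast
      have "T \<le> real (max n N)" using n by simp
      then have "(\<eta> T y \<omega> \<le> 1/2) = ?s y" using T(2)[of "real (max n N)"] N[of "max n N"] by simp
      then show ?thesis using T by blast
    qed
    show ?case
    proof
      fix x
      define g where "g y \<longleftrightarrow> ?s y = ?s x" for y
      define S where "S = cluster g x"
      have "g = ?s \<or> g = (\<lambda>y. \<not> ?s y)" by (cases "?s x") (auto simp: g_def)
      then have finS: "finite S" using elim(5) unfolding S_def by auto
      have xS: "x \<in> S" unfolding S_def cluster_def g_def by (simp add: conn_refl)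
      \<comment> \<open>The signs must have settled on the bordering sites as well, so that a
        neighbour outside \<open>S\<close> can no longer offer a value with the sign of
        \<open>S\<close>.\<close>
      have "\<exists>T. 0 \<le> T \<and> (\<forall>y\<in>S \<union> nbs S. \<forall>t\<ge>T. (\<eta> t y \<omega> \<le> 1/2) = ?s y)"
      proof -
        obtain L where L: "\<And>y. 0 \<le> L y \<and> (\<forall>t\<ge>L y. (\<eta> t y \<omega> \<le> 1/2) = ?s y)" using sign by metis
        have fin: "finite (S \<union> nbs S)" using finS by simp
        have "0 \<le> (\<Sum>y\<in>S \<union> nbs S. L y)" using L by (intro sum_nonneg) auto
        moreover have "L y \<le> (\<Sum>y\<in>S \<union> nbs S. L y)" if "y \<in> S \<union> nbs S" for y
          using L fin that by (intro member_le_sum) auto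
        ultimately show ?thesis using L by (meson order_trans)
      qed
      then obtain T where T: "0 \<le> T" "\<And>y t. y \<in> S \<union> nbs S \<Longrightarrow> T \<le> t \<Longrightarrow> (\<eta> t y \<omega> \<le> 1/2) = ?s y" by blast
      have "\<eta> t x \<omega> \<in> (\<lambda>y. \<eta> T y \<omega>) ` S" if "T \<le> t" for t
      proof (rule values_confined[OF elim(4) clock_points[OF elim(1)] finS _ T xS that])
        fix y z assume "y \<in> S" "z \<in> nb y" "?s z = ?s y"
        then show "z \<in> S" unfolding S_def using cluster_closed cluster_sign by (metis g_def)
      qed
      then show "\<exists>T\<ge>0. \<forall>t\<ge>T. \<eta> t x \<omega> = \<eta> T x \<omega>"
        by (intro finitely_valued_fixates[of "(\<lambda>y. \<eta> T y \<omega>) ` S" T]) (use finS elim(2) in blast)+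
    qed
  qed
qed

lemma AE_initial_values: "AE \<omega> in M. \<forall>t\<ge>0. \<forall>x. \<exists>y. \<eta> t x \<omega> = \<eta> 0 y \<omega>"
  using AE_pca_converges
proof eventually_elim
  case (elim \<omega>)
  show ?case
  proof (intro allI impI)
    fix t :: real and x assume "0 \<le> t"
    then have "\<forall>\<^sub>F m in sequentially. pca med (\<lambda>x. \<eta> 0 x \<omega>) (ring_bit (\<lambda>x. R x \<omega>) m) (nat \<lceil>t * 2 ^ m\<rceil>) x = \<eta> t x \<omega>"
      using elim by blast
    from eventually_happens'[OF sequentially_bot this]
    show "\<exists>y. \<eta> t x \<omega> = \<eta> 0 y \<omega>" using pca_med_range by (metis rangeE)
  qed
qed

lemma initial_value_absolutely_continuous:
  assumes "A \<in> null_sets lborel"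
  shows "AE \<omega> in M. \<eta> 0 y \<omega> \<notin> A"
proof -
  have "emeasure (distr M lborel (\<eta> 0 y)) A = 0"
  proof -
    have "{0..1} \<inter> A \<in> null_sets lborel" by (rule null_set_Int1[OF assms]) simp
    then show ?thesis
      unfolding init_distr using assms by (subst emeasure_uniform_measure) (auto simp: null_sets_def)
  qed
  moreover have "A \<in> sets borel" using assms by (auto simp: null_sets_def)
  ultimately have "emeasure M (\<eta> 0 y -` A \<inter> space M) = 0" "\<eta> 0 y -` A \<inter> space M \<in> events"
    using init_measurable[of y] by (auto simp: emeasure_distr)
  then show ?thesis by (intro AE_I[of _ _ "\<eta> 0 y -` A \<inter> space M"]) auto
qed

text \<open>The limit is one of countably many initial values, each with an absolutely continuous
  law, so a Lebesgue null set is almost surely avoided by all of them at once. \<open>L\<close> is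
  taken along integer times for the sake of measurability.\<close>

lemma limit_absolutely_continuous:
  "\<exists>\<eta>_inf \<in> borel_measurable M.
     (AE \<omega> in M. ((\<lambda>t. \<eta> t x \<omega>) \<longlongrightarrow> \<eta>_inf \<omega>) at_top) \<and>
     absolutely_continuous lborel (distr M lborel \<eta>_inf)"
proof -
  define L where "L \<omega> = lim (\<lambda>n. \<eta> (real n) x \<omega>)" for \<omega>
  have meas: "\<eta> (real n) x \<in> borel_measurable M" for n
  proof -
    have "\<eta> (real n) x \<in> M \<rightarrow>\<^sub>M restrict_space borel {0..1}"
      using dyn unfolding median_dynamics_def by simp
    then show ?thesis by (simp add: measurable_restrict_space2_iff)
  qed
  have L: "L \<in> borel_measurable M"
    unfolding L_def [abs_def] by (rule borel_measurable_lim_metric) (rule meas)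
  have lim: "AE \<omega> in M. ((\<lambda>t. \<eta> t x \<omega>) \<longlongrightarrow> L \<omega>) at_top \<and> (\<exists>y. L \<omega> = \<eta> 0 y \<omega>)"
    using AE_fixates AE_initial_values
  proof eventually_elim
    case (elim \<omega>)
    obtain T where T: "0 \<le> T" "\<And>t. T \<le> t \<Longrightarrow> \<eta> t x \<omega> = \<eta> T x \<omega>" using elim(1) by blast
    then have ev: "\<forall>\<^sub>F t in at_top. \<eta> t x \<omega> = \<eta> T x \<omega>" unfolding eventually_at_top_linorder by blast
    then have c: "((\<lambda>t. \<eta> t x \<omega>) \<longlongrightarrow> \<eta> T x \<omega>) at_top" by (rule tendsto_eventually)
    then have "(\<lambda>n. \<eta> (real n) x \<omega>) \<longlonglongrightarrow> \<eta> T x \<omega>"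
      using filterlim_compose[OF _ filterlim_real_sequentially] by blast
    then have "L \<omega> = \<eta> T x \<omega>" unfolding L_def by (rule limI)
    then show ?case using c elim(2) T(1) by auto
  qed
  have "absolutely_continuous lborel (distr M lborel L)"
    unfolding absolutely_continuous_def
  proof
    fix A assume A: "A \<in> null_sets (lborel :: real measure)"
    then have Ab: "A \<in> sets borel" by (auto simp: null_sets_def)
    have "AE \<omega> in M. \<forall>y. \<eta> 0 y \<omega> \<notin> A"
      unfolding AE_all_countable using initial_value_absolutely_continuous[OF A] by blast
    with lim have "AE \<omega> in M. L \<omega> \<notin> A" by eventually_elim auto
    moreover have ev: "L -` A \<inter> space M \<in> events" using L Ab by (rule measurable_sets)
    ultimately have "emeasure M (L -` A \<inter> space M) = 0"
      by (subst AE_iff_measurable[symmetric, where P = "\<lambda>\<omega>. L \<omega> \<notin> A"]) auto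
    then show "A \<in> null_sets (distr M lborel L)" using L Ab by (auto simp: null_sets_def emeasure_distr)
  qed
  moreover have "AE \<omega> in M. ((\<lambda>t. \<eta> t x \<omega>) \<longlongrightarrow> L \<omega>) at_top" using lim by eventually_elim blast
  ultimately show ?thesis using L by blast
qed

end

theorem theorem4p3:
  fixes M :: "'a measure"
    and R :: "site \<Rightarrow> 'a \<Rightarrow> real set"
    and \<eta> :: "real \<Rightarrow> site \<Rightarrow> 'a \<Rightarrow> real"
  assumes "median_dynamics z2_adj M R \<eta>"
  shows "fixates M \<eta> \<and>
    (\<exists>\<eta>_inf \<in> borel_measurable M.
       (AE \<omega> in M. ((\<lambda>t. \<eta> t (0, 0) \<omega>) \<longlongrightarrow> \<eta>_inf \<omega>) at_top) \<and>
       absolutely_continuous lborel (distr M lborel \<eta>_inf))"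
proof -
  interpret median_process M R \<eta> by unfold_locales (rule assms)
  have "fixates M \<eta>"
    unfolding fixates_def using AE_fixates by (simp only: AE_all_countable) blast
  then show ?thesis using limit_absolutely_continuous by blast
qed

end
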